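(* Let $\psi$, $\mathcal{V}$ satisfy the standing assumptions stated in the context and let $\psi(x)>0$ for all $x\in\mathbb{R}$. Then the mean-field dynamics $$\partial_t f=-\nabla_{(r,v)}\cdot\left(f\int_{\mathbb{R}^d\times\mathbb{R}^d}\begin{pmatrix}v-\hat v\\-\nabla\mathcal{V}(r-\hat r)-\psi(|r-\hat r|)(v-\hat v)\end{pmatrix}\mathrm{d}f(t,\hat r,\hat v)\right)$$ admits for every compactly supported Borel probability measure $f_0$ on $\mathbb{R}^d\times\mathbb{R}^d$ a unique weak measure solution $f$ (in the sense of the context) with initial condition $f_0$. Moreover, the solution is dissipative, i.e. $$\frac{\mathrm{d}}{\mathrm{d}t}\mathcal{H}(f)\le 0.$$ Further, for every compactly supported initial condition $f_0$ there exists a vector $\bar v\in\mathbb{R}^d$ such that $$\int v\,\mathrm{d}f(t,r,v)=\bar v\quad\text{for all }t\ge 0.$$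
   Context: Here $d\ge 1$, and $\mathcal{P}_2(\mathbb{R}^d\times\mathbb{R}^d)$ is the space of Borel probability measures with finite second moment with the 2-Wasserstein distance. Standing assumptions: $\psi:\mathbb{R}\to\mathbb{R}_{\ge 0}$; $\mathcal{V}:\mathbb{R}^d\to\mathbb{R}$ is continuously differentiable with $\nabla\mathcal{V}(-x)=-\nabla\mathcal{V}(x)$; and for $N\ge 2$ the functions $F_i(t,x,v)=\frac1N\sum_{j=1}^N\psi(|x_j-x_i|)(v_j-v_i)-\frac1N\sum_{j=1}^N\nabla\mathcal{V}(x_i-x_j)$, $i=1,\dots,N$, are continuous, satisfy $|F_i(t,x,v)|\le C(1+|x|+|v|)$ for some $C>0$, and are Lipschitz in $(x,v)$ on every compact subset of $\mathbb{R}^{dN}\times\mathbb{R}^{dN}$. A weak measure solution on $[0,T]$ with initial condition $f_0$ is $f\in C([0,T];\mathcal{P}_2(\mathbb{R}^d\times\mathbb{R}^d))$, $f_t=f(t,\cdot)$, such that for every $h\in C_c^\infty([0,T)\times\mathbb{R}^d\times\mathbb{R}^d)$ $$\int_0^T\!\!\int\Big(\partial_t h_t(r,v)+\Big(\int(v-\hat v)\,\mathrm{d}f_t(\hat r,\hat v)\Big)\cdot\nabla_r h_t(r,v)\Big)\mathrm{d}f_t(r,v)\,\mathrm{d}t+\int h_0\,\mathrm{d}f_0$$ $$=\int_0^T\!\!\int\Big(\int\big[\psi(|r-\hat r|)(v-\hat v)+\nabla\mathcal{V}(r-\hat r)\big]\,\mathrm{d}f_t(\hat r,\hat v)\Big)\cdot\nabla_v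 h_t(r,v)\,\mathrm{d}f_t(r,v)\,\mathrm{d}t.$$ A solution on $[0,\infty)$ is an $f\in C([0,\infty);\mathcal{P}_2(\mathbb{R}^d\times\mathbb{R}^d))$ whose restriction to $[0,T]$ is a weak measure solution for every $T>0$. The mean-field Hamiltonian is $$\mathcal{H}(f)=\frac12\int|v-\bar v|^2\,\mathrm{d}f(t,r,v)+\frac12\int\int\mathcal{V}(r-\hat r)\,\mathrm{d}f(t,\hat r,\hat v)\,\mathrm{d}f(t,r,v),\qquad\bar v=\int\hat v\,\mathrm{d}f(t,\hat r,\hat v).$$ *)

theory Defs
  imports "HOL-Probability.Probability"
begin

subsection \<open>Gradients and smooth test functions\<close>

definition gradient :: "('a::real_inner \<Rightarrow> real) \<Rightarrow> 'a \<Rightarrow> 'a" where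
  "gradient f x = (THE D. GDERIV f x :> D)"

primrec C_upto :: "nat \<Rightarrow> ('a::real_normed_vector \<Rightarrow> 'b::real_normed_vector) \<Rightarrow> bool" where
  "C_upto 0 f \<longleftrightarrow> continuous_on UNIV f"
| "C_upto (Suc k) f \<longleftrightarrow>
     (\<forall>x. f differentiable (at x)) \<and> (\<forall>w. C_upto k (\<lambda>x. frechet_derivative f (at x) w))"

definition smooth :: "('a::real_normed_vector \<Rightarrow> 'b::real_normed_vector) \<Rightarrow> bool" where
  "smooth f \<longleftrightarrow> (\<forall>k. C_upto k f)"

text \<open>
  The space of compactly supported smooth functions on \<open>[0,T) \<times> \<real>^d \<times> \<real>^d\<close>. Its elements need not
  vanish at time 0. As usual for a set with boundary, smoothness means being the restriction of a
  smooth function on the ambient space; the values at negative times are irrelevant otherwise.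
\<close>

definition test_functions :: "real \<Rightarrow> (real \<times> (real^'d) \<times> (real^'d) \<Rightarrow> real) set" where
  "test_functions T =
     {h. smooth h \<and> (\<exists>K. compact K \<and> K \<subseteq> {0..<T} \<times> UNIV \<and> (\<forall>z \<in> {0..} \<times> UNIV - K. h z = 0))}"


subsection \<open>The 2-Wasserstein space\<close>

definition P2 :: "'a::{second_countable_topology, real_normed_vector} measure set" where
  "P2 = {M. prob_space M \<and> sets M = sets borel \<and> integrable M (\<lambda>z. (norm z)\<^sup>2)}"

definition couplings ::
  "'a::{second_countable_topology, real_normed_vector} measure \<Rightarrow> 'a measure \<Rightarrow> ('a \<times> 'a) measure set"
where
  "couplings M N =
     {\<gamma>. prob_space \<gamma> \<and> sets \<gamma> = sets borel \<and> distr \<gamma> borel fst = M \<and> distr \<gamma> borel snd = N}"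

text \<open>Only used on \<^const>\<open>P2\<close>, where the cost is integrable for every coupling.\<close>

definition W2 :: "'a::{second_countable_topology, real_normed_vector} measure \<Rightarrow> 'a measure \<Rightarrow> real"
where
  "W2 M N = sqrt (INF \<gamma> \<in> couplings M N. \<integral>z. (dist (fst z) (snd z))\<^sup>2 \<partial>\<gamma>)"

definition P2_continuous_on ::
  "real set \<Rightarrow> (real \<Rightarrow> 'a::{second_countable_topology, real_normed_vector} measure) \<Rightarrow> bool"
where
  "P2_continuous_on I f \<longleftrightarrow>
     (\<forall>t\<in>I. f t \<in> P2) \<and> (\<forall>t\<in>I. ((\<lambda>s. W2 (f s) (f t)) \<longlongrightarrow> 0) (at t within I))"

definition measure_support :: "'a::topological_space measure \<Rightarrow> 'a set" where
  "measure_support M = - \<Union>{U. open U \<and> emeasure M U = 0}"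


subsection \<open>The particle forces and the standing assumptions\<close>

text \<open>
  Configurations of \<open>N\<close> points in \<open>\<real>^d\<close> are functions on \<open>{..<N}\<close> (extended by \<^const>\<open>undefined\<close>,
  as in \<^const>\<open>product_topology\<close>), with the Euclidean norm and distance of \<open>\<real>^(dN)\<close>.
\<close>

definition config_norm :: "nat \<Rightarrow> (nat \<Rightarrow> real^'d) \<Rightarrow> real" where
  "config_norm N x = L2_set (\<lambda>j. norm (x j)) {..<N}"

definition config_dist :: "nat \<Rightarrow> (nat \<Rightarrow> real^'d) \<Rightarrow> (nat \<Rightarrow> real^'d) \<Rightarrow> real" where
  "config_dist N x y = L2_set (\<lambda>j. dist (x j) (y j)) {..<N}"

definition phase_space :: "nat \<Rightarrow> ((nat \<Rightarrow> real^'d) \<times> (nat \<Rightarrow> real^'d)) topology" where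
  "phase_space N =
     prod_topology (product_topology (\<lambda>_. euclidean) {..<N}) (product_topology (\<lambda>_. euclidean) {..<N})"

text \<open>The forces do not depend on time, so the time argument is omitted.\<close>

definition force ::
  "(real \<Rightarrow> real) \<Rightarrow> (real^'d \<Rightarrow> real) \<Rightarrow> nat \<Rightarrow> nat \<Rightarrow> (nat \<Rightarrow> real^'d) \<Rightarrow> (nat \<Rightarrow> real^'d) \<Rightarrow> real^'d"
where
  "force \<psi> V N i x v =
     (1 / real N) *\<^sub>R (\<Sum>j<N. \<psi> (norm (x j - x i)) *\<^sub>R (v j - v i))
     - (1 / real N) *\<^sub>R (\<Sum>j<N. gradient V (x i - x j))"

definition standing_assumptions :: "(real \<Rightarrow> real) \<Rightarrow> (real^'d \<Rightarrow> real) \<Rightarrow> bool" where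
  "standing_assumptions \<psi> V \<longleftrightarrow>
     (\<forall>s. \<psi> s \<ge> 0) \<and>
     (\<forall>x. V differentiable (at x)) \<and> continuous_on UNIV (gradient V) \<and>
     (\<forall>x. gradient V (- x) = - gradient V x) \<and>
     (\<forall>N\<ge>2.
        (\<forall>i<N. continuous_map (phase_space N) euclidean (\<lambda>(x, v). force \<psi> V N i x v)) \<and>
        (\<exists>C>0. \<forall>i<N. \<forall>(x, v) \<in> topspace (phase_space N).
           norm (force \<psi> V N i x v) \<le> C * (1 + config_norm N x + config_norm N v)) \<and>
        (\<forall>K. compactin (phase_space N) K \<longrightarrow>
           (\<exists>L. \<forall>i<N. \<forall>(x, v) \<in> K. \<forall>(y, w) \<in> K.
              norm (force \<psi> V N i x v - force \<psi> V N i y w)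
                \<le> L * sqrt ((config_dist N x y)\<^sup>2 + (config_dist N v w)\<^sup>2))))"


subsection \<open>Weak measure solutions of the mean-field equation\<close>

text \<open>
  A family \<open>f t\<close> of measures on phase space is only considered at times in the given interval;
  its values at other times are arbitrary.
\<close>

definition weak_solution ::
  "(real \<Rightarrow> real) \<Rightarrow> (real^'d \<Rightarrow> real) \<Rightarrow> real \<Rightarrow> ((real^'d) \<times> (real^'d)) measure
   \<Rightarrow> (real \<Rightarrow> ((real^'d) \<times> (real^'d)) measure) \<Rightarrow> bool"
where
  "weak_solution \<psi> V T f0 f \<longleftrightarrow>
     P2_continuous_on {0..T} f \<and>
     (\<forall>h \<in> test_functions T.
        (LINT t:{0..T}|lborel.
           (\<integral>(r, v). deriv (\<lambda>s. h (s, r, v)) t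
              + (\<integral>(r', v'). v - v' \<partial>f t) \<bullet> gradient (\<lambda>r. h (t, r, v)) r \<partial>f t))
        + (\<integral>(r, v). h (0, r, v) \<partial>f0)
        = (LINT t:{0..T}|lborel.
             (\<integral>(r, v). (\<integral>(r', v'). \<psi> (norm (r - r')) *\<^sub>R (v - v') + gradient V (r - r') \<partial>f t)
                \<bullet> gradient (\<lambda>v. h (t, r, v)) v \<partial>f t)))"

definition global_weak_solution ::
  "(real \<Rightarrow> real) \<Rightarrow> (real^'d \<Rightarrow> real) \<Rightarrow> ((real^'d) \<times> (real^'d)) measure
   \<Rightarrow> (real \<Rightarrow> ((real^'d) \<times> (real^'d)) measure) \<Rightarrow> bool"
where
  "global_weak_solution \<psi> V f0 f \<longleftrightarrow>
     P2_continuous_on {0..} f \<and> (\<forall>T>0. weak_solution \<psi> V T f0 f)"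

definition mean_velocity :: "((real^'d) \<times> (real^'d)) measure \<Rightarrow> real^'d" where
  "mean_velocity M = (\<integral>(r, v). v \<partial>M)"

definition hamiltonian :: "(real^'d \<Rightarrow> real) \<Rightarrow> ((real^'d) \<times> (real^'d)) measure \<Rightarrow> real" where
  "hamiltonian V M =
     1 / 2 * (\<integral>(r, v). (norm (v - mean_velocity M))\<^sup>2 \<partial>M)
     + 1 / 2 * (\<integral>(r, v). (\<integral>(r', v'). V (r - r') \<partial>M) \<partial>M)"

end

theory Submission
  imports Defs
begin

text \<open>
  The equation is \<open>\<partial>\<^sub>t f + div (f (B * f)) = 0\<close> for the odd kernel \<open>B (r, v) = (v, - \<psi> |r| v - \<nabla>V r)\<close>,
  which the assumptions for two particles force to be locally Lipschitz with linear growth. A solution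
  is the image of \<open>f0\<close> under the flow of \<open>X' = \<integral> B (X - X w) df0 w\<close>, an ordinary differential equation in
  the Banach space of bounded continuous maps of phase space once \<open>B\<close> is truncated; Gronwall's
  inequality shows that the truncation is never felt.

  For uniqueness, linear growth first propagates compact support to every weak solution. Two solutions
  are then compared by duality with Lipschitz functions. Explicit Euler steps of the backward transport
  equation with mollified drift keep test functions smooth and are controlled by Lipschitz constants
  alone, so that a time step \<open>\<tau>\<close> multiplies the dual distance by at most \<open>1 + K \<tau>\<close> up to an error
  \<open>K \<tau>^2\<close>; hence the distance vanishes as \<open>\<tau> \<rightarrow> 0\<close>. No flow of the limiting drift is needed here.

  Momentum and energy are integrals over pairs of points; the odd parts cancel under exchange of the
  two points and only the friction term remains.
\<close>


section \<open>Calculus of smooth functions\<close>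

text \<open>The class of test functions shapes the uniqueness proof. The kernel is only locally
  Lipschitz, so the flow of a drift need not be smooth and a test function composed with it is in
  general no longer admissible. Convolution with a nonnegative kernel of unit mass repairs this
  without increasing the Lipschitz constant, so the accuracy of the mollification can be tied to the
  time step while every constant stays fixed. Compact support has to be propagated under weak
  information: a weak solution is only known to be continuous into \<open>P2\<close>. Hence the test
  functions there carry a spatial cutoff at radius \<open>\<rho>\<close>, whose error is of order
  \<open>1 / \<rho>\<close> by a bound on first moments. For existence, the law that drives the
  motion is the image of \<open>f0\<close> under the unknown map itself, so all points of phase
  space must move simultaneously. The truncation radius depends on the final time; flows for
  different final times are therefore unrelated as maps, and it is uniqueness that glues their image
  measures into one global solution.\<close>

lemma C_upto_SucI:
  assumes "\<And>x. (f has_derivative D x) (at x)" "\<And>w. C_upto k (\<lambda>x. D x w)"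
  shows "C_upto (Suc k) f"
proof -
  have "frechet_derivative f (at x) = D x" for x
    using frechet_derivative_at[OF assms(1)] by simp
  then show ?thesis
    using assms by (auto simp: differentiable_def)
qed

lemma C_upto_SucE:
  assumes "C_upto (Suc k) f"
  shows "(f has_derivative frechet_derivative f (at x)) (at x)"
    "C_upto k (\<lambda>x. frechet_derivative f (at x) w)"
  using assms frechet_derivative_works by auto

lemma C_upto_continuous: "C_upto k f \<Longrightarrow> continuous_on UNIV f"
proof (cases k)
  case (Suc j)
  moreover assume "C_upto k f"
  ultimately show ?thesis
    by (simp add: continuous_at_imp_continuous_on differentiable_imp_continuous_within)
qed simp

lemma C_upto_less: "C_upto (Suc k) f \<Longrightarrow> C_upto k f"
proof (induction k arbitrary: f)
  case 0
  then show ?case using C_upto_continuous by fastforce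
next
  case (Suc k)
  have "C_upto k (\<lambda>x. frechet_derivative f (at x) w)" for w
    by (rule Suc.IH[OF C_upto_SucE(2)[OF Suc.prems]])
  then show ?case
    by (rule C_upto_SucI[OF C_upto_SucE(1)[OF Suc.prems]])
qed

lemma C_upto_const: "C_upto k (\<lambda>_. c)"
proof (induction k arbitrary: c)
  case (Suc k)
  show ?case
    by (rule C_upto_SucI[where D = "\<lambda>_ _. 0"]) (simp_all add: Suc)
qed simp

lemma C_upto_bounded_linear_compose:
  assumes "bounded_linear L"
  shows "C_upto k f \<Longrightarrow> C_upto k (\<lambda>x. L (f x))"
proof (induction k arbitrary: f)
  case 0
  then show ?case
    using bounded_linear.continuous_on[OF assms] by simp
next
  case (Suc k)
  show ?case
  proof (rule C_upto_SucI)
    show "((\<lambda>x. L (f x)) has_derivative (\<lambda>w. L (frechet_derivative f (at x) w))) (at x)" for x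
      using bounded_linear.has_derivative[OF assms C_upto_SucE(1)[OF Suc.prems]] .
    show "C_upto k (\<lambda>x. L (frechet_derivative f (at x) w))" for w
      by (rule Suc.IH[OF C_upto_SucE(2)[OF Suc.prems]])
  qed
qed

lemma C_upto_ident: "C_upto k (\<lambda>x. x)"
proof (cases k)
  case (Suc j)
  show ?thesis
    unfolding Suc by (rule C_upto_SucI[where D = "\<lambda>_ w. w"]) (simp_all add: C_upto_const)
qed simp

lemma C_upto_add: "C_upto k f \<Longrightarrow> C_upto k g \<Longrightarrow> C_upto k (\<lambda>x. f x + g x)"
proof (induction k arbitrary: f g)
  case 0
  then show ?case by (simp add: continuous_on_add continuous_on_scaleR)
next
  case (Suc k)
  show ?case
  proof (rule C_upto_SucI)
    show "((\<lambda>x. f x + g x) has_derivative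
        (\<lambda>w. frechet_derivative f (at x) w + frechet_derivative g (at x) w)) (at x)" for x
      by (intro has_derivative_add C_upto_SucE(1)[OF Suc.prems(1)] C_upto_SucE(1)[OF Suc.prems(2)])
    show "C_upto k (\<lambda>x. frechet_derivative f (at x) w + frechet_derivative g (at x) w)" for w
      by (intro Suc.IH C_upto_SucE(2)[OF Suc.prems(1)] C_upto_SucE(2)[OF Suc.prems(2)])
  qed
qed

lemma C_upto_sum: "(\<And>i. i \<in> I \<Longrightarrow> C_upto k (f i)) \<Longrightarrow> C_upto k (\<lambda>x. \<Sum>i\<in>I. f i x)"
  by (induction I rule: infinite_finite_induct) (auto intro: C_upto_add C_upto_const)

lemma C_upto_scaleR:
  "C_upto k f \<Longrightarrow> C_upto k g \<Longrightarrow> C_upto k (\<lambda>x. f x *\<^sub>R g x)"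
proof (induction k arbitrary: f g)
  case 0
  then show ?case by (simp add: continuous_on_add continuous_on_scaleR)
next
  case (Suc k)
  show ?case
  proof (rule C_upto_SucI)
    show "((\<lambda>x. f x *\<^sub>R g x) has_derivative
        (\<lambda>w. f x *\<^sub>R frechet_derivative g (at x) w + frechet_derivative f (at x) w *\<^sub>R g x)) (at
            x)" for x
      by (intro has_derivative_scaleR C_upto_SucE(1)[OF Suc.prems(1)] C_upto_SucE(1)[OF
          Suc.prems(2)])
    show "C_upto k (\<lambda>x. f x *\<^sub>R frechet_derivative g (at x) w
        + frechet_derivative f (at x) w *\<^sub>R g x)" for w
      by (intro C_upto_add Suc.IH C_upto_SucE(2)[OF Suc.prems(1)] C_upto_SucE(2)[OF Suc.prems(2)]
          C_upto_less[OF Suc.prems(1)] C_upto_less[OF Suc.prems(2)])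
  qed
qed

lemma linear_sum_Basis:
  fixes L :: "'a::euclidean_space \<Rightarrow> 'b::real_vector"
  assumes "linear L"
  shows "L w = (\<Sum>i\<in>Basis. (w \<bullet> i) *\<^sub>R L i)"
  using linear_sum[OF assms, of "\<lambda>i. (w \<bullet> i) *\<^sub>R i" Basis] linear_scale[OF assms]
  by (simp add: euclidean_representation)

text \<open>\<open>C_upto\<close> differentiates in a fixed direction, but in the chain rule the
  derivative of \<open>g\<close> is applied to a direction that varies with \<open>x\<close>.
  Expanding that direction in the basis of the intermediate space returns to fixed directions, with
  coefficients covered by the product rule.\<close>

lemma C_upto_compose:
  fixes f :: "'a::real_normed_vector \<Rightarrow> 'b::euclidean_space"
  shows "C_upto k f \<Longrightarrow> C_upto k g \<Longrightarrow> C_upto k (\<lambda>x. g (f x))"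
proof (induction k arbitrary: f g)
  case 0
  then show ?case using continuous_on_compose2[of UNIV g UNIV f] by simp
next
  case (Suc k)
  note f = C_upto_SucE[OF Suc.prems(1)] and g = C_upto_SucE[OF Suc.prems(2)]
  show ?case
  proof (rule C_upto_SucI)
    show "((\<lambda>x. g (f x)) has_derivative
        (\<lambda>w. frechet_derivative g (at (f x)) (frechet_derivative f (at x) w))) (at x)" for x
      using has_derivative_compose[OF f(1) g(1)] .
    have "(\<lambda>x. frechet_derivative g (at (f x)) (frechet_derivative f (at x) w)) =
      (\<lambda>x. \<Sum>i\<in>Basis. (frechet_derivative f (at x) w \<bullet> i) *\<^sub>R frechet_derivative g (at (f x)) i)"
          for w
      using linear_sum_Basis[OF has_derivative_linear[OF g(1)]] by blast
    moreover have "C_upto k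
        (\<lambda>x. \<Sum>i\<in>Basis. (frechet_derivative f (at x) w \<bullet> i) *\<^sub>R frechet_derivative g (at (f x)) i)"
        for w
      by (intro C_upto_sum C_upto_scaleR Suc.IH[OF C_upto_less[OF Suc.prems(1)]] f(2) g(2)
          C_upto_bounded_linear_compose[OF bounded_linear_inner_left])
    ultimately show "C_upto k (\<lambda>x. frechet_derivative g (at (f x)) (frechet_derivative f (at x)
        w))" for w
      by simp
  qed
qed

lemma smoothD: "smooth f \<Longrightarrow> (f has_derivative frechet_derivative f (at x)) (at x)"
  using C_upto_SucE(1) smooth_def by blast

lemma smooth_continuous: "smooth f \<Longrightarrow> continuous_on S f"
  using C_upto_continuous continuous_on_subset smooth_def by blast

lemma smooth_frechet_derivative: "smooth f \<Longrightarrow> smooth (\<lambda>x. frechet_derivative f (at x) w)"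
  using C_upto_SucE(2) unfolding smooth_def by blast

lemma smooth_const: "smooth (\<lambda>_. c)"
  unfolding smooth_def using C_upto_const by blast

lemma smooth_ident: "smooth (\<lambda>x. x)"
  unfolding smooth_def using C_upto_ident by blast

lemma smooth_add: "smooth f \<Longrightarrow> smooth g \<Longrightarrow> smooth (\<lambda>x. f x + g x)"
  unfolding smooth_def by (intro allI C_upto_add) auto

lemma smooth_scaleR: "smooth a \<Longrightarrow> smooth g \<Longrightarrow> smooth (\<lambda>x. a x *\<^sub>R g x)"
  unfolding smooth_def by (intro allI C_upto_scaleR) auto

lemma smooth_sum: "(\<And>i. i \<in> I \<Longrightarrow> smooth (F i)) \<Longrightarrow> smooth (\<lambda>x. \<Sum>i\<in>I. F i x)"
  unfolding smooth_def by (intro allI C_upto_sum) auto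

lemma smooth_bounded_linear: "bounded_linear L \<Longrightarrow> smooth f \<Longrightarrow> smooth (\<lambda>x. L (f x))"
  unfolding smooth_def using C_upto_bounded_linear_compose by blast

lemma smooth_compose:
  fixes f :: "'a::real_normed_vector \<Rightarrow> 'b::euclidean_space"
  shows "smooth g \<Longrightarrow> smooth f \<Longrightarrow> smooth (\<lambda>x. g (f x))"
  unfolding smooth_def using C_upto_compose by blast

lemma smooth_mult:
  fixes f g :: "'a::real_normed_vector \<Rightarrow> real"
  shows "smooth f \<Longrightarrow> smooth g \<Longrightarrow> smooth (\<lambda>x. f x * g x)"
  using smooth_scaleR[of f g] by simp

lemma smooth_minus: "smooth f \<Longrightarrow> smooth (\<lambda>x. - f x)"
  by (rule smooth_bounded_linear[OF bounded_linear_minus[OF bounded_linear_ident]])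

lemma smooth_diff: "smooth f \<Longrightarrow> smooth g \<Longrightarrow> smooth (\<lambda>x. f x - g x)"
  using smooth_add[OF _ smooth_minus] by fastforce

lemma smooth_fst: "smooth f \<Longrightarrow> smooth (\<lambda>x. fst (f x))"
  and smooth_snd: "smooth f \<Longrightarrow> smooth (\<lambda>x. snd (f x))"
  by (erule smooth_bounded_linear[OF bounded_linear_fst] smooth_bounded_linear[OF
      bounded_linear_snd])+

lemma smooth_inner:
  fixes f g :: "'a::real_normed_vector \<Rightarrow> 'b::euclidean_space"
  assumes "smooth f" "smooth g"
  shows "smooth (\<lambda>x. f x \<bullet> g x)"
proof -
  have "smooth (\<lambda>x. \<Sum>i\<in>Basis. (f x \<bullet> i) * (g x \<bullet> i))"
    by (intro smooth_sum smooth_mult smooth_bounded_linear[OF bounded_linear_inner_left] assms)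
  then show ?thesis by (simp only: euclidean_inner[symmetric])
qed

lemma smooth_norm_power2:
  fixes f :: "'a::real_normed_vector \<Rightarrow> 'b::euclidean_space"
  shows "smooth f \<Longrightarrow> smooth (\<lambda>x. (norm (f x))\<^sup>2)"
  unfolding power2_norm_eq_inner by (intro smooth_inner)

section \<open>Smooth functions of one real variable\<close>

lemma smooth_realI:
  fixes f :: "real \<Rightarrow> real"
  assumes "\<And>x. (f has_real_derivative f' x) (at x)" "smooth f'"
  shows "smooth f"
  unfolding smooth_def
proof
  fix k
  have "C_upto (Suc k) f"
  proof (rule C_upto_SucI)
    show "(f has_derivative (\<lambda>w. f' x * w)) (at x)" for x
      using assms(1) by (simp add: has_field_derivative_def)
    show "C_upto k (\<lambda>x. f' x * w)" for w
      using assms(2) unfolding smooth_def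
      by (intro C_upto_bounded_linear_compose[OF bounded_linear_mult_left]) auto
  qed
  then show "C_upto k f" by (rule C_upto_less)
qed

lemma smooth_exp: "smooth (exp :: real \<Rightarrow> real)"
  unfolding smooth_def
proof
  fix k show "C_upto k (exp :: real \<Rightarrow> real)"
  proof (induction k)
    case (Suc k)
    show ?case
    proof (rule C_upto_SucI)
      show "(exp has_derivative (\<lambda>w. exp x * w)) (at x)" for x :: real
        using DERIV_exp[of x] by (simp add: has_field_derivative_def)
      show "C_upto k (\<lambda>x::real. exp x * w)" for w
        by (rule C_upto_bounded_linear_compose[OF bounded_linear_mult_left Suc])
    qed
  qed (simp add: continuous_on_exp)
qed

text \<open>The functions \<open>x \<mapsto> exp (- 1 / x) / x ^ k\<close>, extended by zero, span a space closed under
  differentiation.\<close>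

definition flat_exp :: "nat \<Rightarrow> real \<Rightarrow> real" where
  "flat_exp k x = (if x \<le> 0 then 0 else exp (- 1 / x) / x ^ k)"

lemma flat_exp_nonneg: "flat_exp k x \<ge> 0"
  by (simp add: flat_exp_def)

text \<open>With \<open>y = 1 / x\<close> the limit from the right is that of
  \<open>y ^ k / exp y\<close> at infinity. It serves for differentiability at 0, where the
  difference quotient of \<open>flat_exp k\<close> is \<open>flat_exp (Suc k)\<close>.\<close>

lemma flat_exp_tendsto_0: "(flat_exp k \<longlongrightarrow> 0) (at 0)"
proof -
  have "((\<lambda>y::real. y ^ k / exp y) \<longlongrightarrow> 0) at_top"
    by (rule tendsto_power_div_exp_0)
  then have "((\<lambda>x. inverse x ^ k / exp (inverse x)) \<longlongrightarrow> (0::real)) (at_right 0)"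
    by (rule filterlim_compose) (rule filterlim_inverse_at_top_right)
  then have "(flat_exp k \<longlongrightarrow> 0) (at_right 0)"
  proof (rule Lim_transform_eventually)
    show "\<forall>\<^sub>F x in at_right 0. inverse x ^ k / exp (inverse x) = flat_exp k x"
      using eventually_at_right_less[of "0::real"]
      by eventually_elim (simp add: flat_exp_def exp_minus field_simps)
  qed
  moreover have "(flat_exp k \<longlongrightarrow> 0) (at_left 0)"
    by (rule tendsto_eventually)
      (auto simp: eventually_at_filter flat_exp_def)
  ultimately show ?thesis
    by (simp add: filterlim_split_at_real)
qed

lemma DERIV_flat_exp:
  "(flat_exp k has_real_derivative (flat_exp (k + 2) x - real k * flat_exp (k + 1) x)) (at x)"
proof -
  consider "x < 0" | "x = 0" | "x > 0" by linarith
  then show ?thesis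
  proof cases
    case 1
    have "((\<lambda>_. 0) has_real_derivative 0) (at x)" by simp
    then have "(flat_exp k has_real_derivative 0) (at x)"
      by (rule DERIV_cong_ev[THEN iffD1, rotated -1, OF _ refl _ refl])
        (use 1 in \<open>auto simp: flat_exp_def eventually_nhds intro!: exI[of _ "{..<0}"]\<close>)
    then show ?thesis using 1 by (simp add: flat_exp_def)
  next
    case 2
    have "((\<lambda>h. (flat_exp k (0 + h) - flat_exp k 0) / h) \<longlongrightarrow> 0) (at 0)"
    proof (rule Lim_transform_eventually[OF flat_exp_tendsto_0[of "Suc k"]])
      show "\<forall>\<^sub>F h in at 0. flat_exp (Suc k) h = (flat_exp k (0 + h) - flat_exp k 0) / h"
        by (rule eventuallyI) (simp add: flat_exp_def)
    qed
    then show ?thesis using 2 by (simp add: DERIV_def flat_exp_def)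
  next
    case 3
    have p: "((\<lambda>x. x ^ k) has_real_derivative real k * x ^ k / x) (at x)"
      using DERIV_pow[of k x UNIV] 3 by (cases k) auto
    have e: "((\<lambda>x. exp (- 1 / x)) has_real_derivative exp (- 1 / x) / x\<^sup>2) (at x)"
      using 3 by (auto intro!: derivative_eq_intros simp: power2_eq_square)
    have "((\<lambda>x. exp (- 1 / x) / x ^ k) has_real_derivative
       (flat_exp (k + 2) x - real k * flat_exp (k + 1) x)) (at x)"
      by (rule DERIV_cong[OF DERIV_divide[OF e p]])
        (use 3 in \<open>auto simp: flat_exp_def power2_eq_square field_simps\<close>)
    then show ?thesis
      by (rule DERIV_cong_ev[THEN iffD1, rotated -1, OF _ refl _ refl])
        (use 3 in \<open>auto simp: flat_exp_def eventually_nhds intro!: exI[of _ "{0<..}"]\<close>)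
  qed
qed

lemma smooth_flat_exp: "smooth (flat_exp k)"
  unfolding smooth_def
proof
  fix n show "C_upto n (flat_exp k)"
  proof (induction n arbitrary: k)
    case 0
    show ?case using DERIV_isCont[OF DERIV_flat_exp] by (simp add: continuous_at_imp_continuous_on)
  next
    case (Suc n)
    show ?case
    proof (rule C_upto_SucI)
      show "(flat_exp k has_derivative (\<lambda>w. (flat_exp (k + 2) x - real k * flat_exp (k
          + 1) x) * w)) (at x)" for x
        using DERIV_flat_exp by (simp add: has_field_derivative_def)
      have "C_upto n (\<lambda>x. flat_exp (k + 2) x + (- real k) *\<^sub>R flat_exp (k + 1) x)"
        by (rule C_upto_add[OF Suc C_upto_scaleR[OF C_upto_const Suc]])
      then show "C_upto n (\<lambda>x. (flat_exp (k + 2) x - real k * flat_exp (k + 1) x) * w)" for w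
        by (intro C_upto_bounded_linear_compose[OF bounded_linear_mult_left]) simp
    qed
  qed
qed

section \<open>A smooth step from 0 to 1\<close>

definition step_density :: "real \<Rightarrow> real" where
  "step_density x = flat_exp 0 x * flat_exp 0 (1 - x)"

lemma smooth_step_density: "smooth step_density"
proof -
  have "smooth (\<lambda>x. flat_exp 0 (1 - x))"
    by (rule smooth_compose[OF smooth_flat_exp smooth_diff[OF smooth_const smooth_ident]])
  from smooth_mult[OF smooth_flat_exp this] show ?thesis
    by (simp add: step_density_def[abs_def])
qed

lemma step_density_nonneg: "step_density x \<ge> 0"
  by (simp add: step_density_def flat_exp_nonneg)

lemma step_density_pos: "0 < x \<Longrightarrow> x < 1 \<Longrightarrow> step_density x > 0"
  by (simp add: step_density_def flat_exp_def)

lemma step_density_eq_0: "x \<le> 0 \<or> 1 \<le> x \<Longrightarrow> step_density x = 0"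
  by (auto simp: step_density_def flat_exp_def)

text \<open>The normalised primitive of the bump. For negative \<open>x\<close> the interval
  \<open>{0..x}\<close> is empty and the value is 0, which is what the primitive takes there because
  the density vanishes.\<close>

definition smooth_step :: "real \<Rightarrow> real" where
  "smooth_step x = integral {0..x} step_density / integral {0..1} step_density"

definition smooth_step' :: "real \<Rightarrow> real" where
  "smooth_step' x = step_density x / integral {0..1} step_density"

lemma step_density_integrable: "step_density integrable_on {a..b}"
  by (intro integrable_continuous_real smooth_continuous smooth_step_density)

text \<open>The fundamental theorem is applied to the integral from a fixed point \<open>a\<close>
  to the left of both 0 and \<open>x\<close>. The two integrals agree near \<open>x\<close> because
  the density vanishes on negative arguments.\<close>

lemma step_density_integral_DERIV:
  "((\<lambda>x. integral {0..x} step_density) has_real_derivative step_density x) (at x)"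
proof -
  define a where "a = - \<bar>x\<bar> - 1"
  define b where "b = \<bar>x\<bar> + 1"
  have eq: "integral {a..y} step_density = integral {0..y} step_density" if "y \<in> {a<..<b}" for y
  proof (cases "y \<le> 0")
    case True
    have "integral {a..y} step_density = integral {a..y} (\<lambda>_. 0)"
      by (rule integral_cong) (use True in \<open>auto intro: step_density_eq_0\<close>)
    moreover have "integral {0..y} step_density = integral {0..y} (\<lambda>_. 0)"
      by (rule integral_cong) (use True in \<open>auto intro: step_density_eq_0\<close>)
    ultimately show ?thesis by simp
  next
    case False
    have "integral {a..0} step_density + integral {0..y} step_density
        = integral {a..y} step_density"
      by (rule Henstock_Kurzweil_Integration.integral_combine)
        (use False in \<open>auto simp: a_def step_density_integrable\<close>)
    moreover have "integral {a..0} step_density = integral {a..0} (\<lambda>_. 0)"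
      by (rule integral_cong) (auto intro: step_density_eq_0)
    ultimately show ?thesis by simp
  qed
  have "((\<lambda>x. integral {a..x} step_density) has_real_derivative step_density x)
      (at x within {a..b})"
    by (rule integral_has_real_derivative)
      (auto intro!: smooth_continuous smooth_step_density simp: a_def b_def)
  moreover have "at x within {a..b} = at x"
    by (rule at_within_interior) (auto simp: a_def b_def)
  ultimately have "((\<lambda>x. integral {a..x} step_density) has_real_derivative step_density x) (at x)"
    by simp
  then show ?thesis
    by (rule has_field_derivative_transform_within_open[of _ _ _ "{a<..<b}"])
        (use eq in \<open>auto simp: a_def b_def\<close>)
qed

lemma step_density_integral_pos: "integral {0..1} step_density > 0"
proof -
  have "integral {0..0} step_density < integral {0..1} step_density"
    by (rule DERIV_pos_imp_increasing_open[of 0 1])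
      (use step_density_integral_DERIV step_density_pos in
        \<open>auto intro!: continuous_at_imp_continuous_on DERIV_isCont step_density_integral_DERIV\<close>)
  then show ?thesis by simp
qed

lemma DERIV_smooth_step: "(smooth_step has_real_derivative smooth_step' x) (at x)"
  unfolding smooth_step_def[abs_def] smooth_step'_def
  by (rule DERIV_cdivide[OF step_density_integral_DERIV])

lemma smooth_smooth_step': "smooth smooth_step'"
  unfolding smooth_step'_def[abs_def] divide_inverse
  by (intro smooth_mult smooth_const smooth_step_density)

lemma smooth_smooth_step: "smooth smooth_step"
  by (rule smooth_realI[OF DERIV_smooth_step smooth_smooth_step'])

lemma smooth_step'_nonneg: "smooth_step' x \<ge> 0"
  using step_density_nonneg step_density_integral_pos by (simp add: smooth_step'_def)

lemma smooth_step'_eq_0: "x \<le> 0 \<or> 1 \<le> x \<Longrightarrow> smooth_step' x = 0"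
  using step_density_eq_0 by (simp add: smooth_step'_def)

lemma smooth_step_mono: "x \<le> y \<Longrightarrow> smooth_step x \<le> smooth_step y"
  using DERIV_nonneg_imp_nondecreasing[of x y smooth_step] DERIV_smooth_step smooth_step'_nonneg
      by blast

lemma smooth_step_eq_0: "x \<le> 0 \<Longrightarrow> smooth_step x = 0"
proof -
  assume "x \<le> 0"
  then have "integral {0..x} step_density = integral {0..x} (\<lambda>_. 0)"
    by (intro integral_cong) (auto intro: step_density_eq_0)
  then show ?thesis by (simp add: smooth_step_def)
qed

lemma smooth_step_eq_1:
  assumes "1 \<le> x" shows "smooth_step x = 1"
proof -
  have "integral {0..1} step_density + integral {1..x} step_density = integral {0..x} step_density"
    by (rule Henstock_Kurzweil_Integration.integral_combine)
      (use assms in \<open>auto simp: step_density_integrable\<close>)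
  moreover have "integral {1..x} step_density = integral {1..x} (\<lambda>_. 0)"
    by (rule integral_cong) (auto intro: step_density_eq_0)
  ultimately show ?thesis
    using step_density_integral_pos by (simp add: smooth_step_def)
qed

lemma smooth_step_bounds: "0 \<le> smooth_step x" "smooth_step x \<le> 1"
proof -
  show "0 \<le> smooth_step x"
    using smooth_step_mono[of "min x 0" x] smooth_step_eq_0[of "min x 0"] by simp
  show "smooth_step x \<le> 1"
    using smooth_step_mono[of x "max x 1"] smooth_step_eq_1[of "max x 1"] by simp
qed

text \<open>Strict positivity is what turns the statement that \<open>smooth_step\<close> of a
  quantity vanishes almost everywhere into an upper bound 0 for that quantity.\<close>

lemma smooth_step_pos:
  assumes "0 < x" shows "0 < smooth_step x"
proof -
  have "smooth_step 0 < smooth_step (min x 1)"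
    by (rule DERIV_pos_imp_increasing_open)
      (use assms DERIV_smooth_step step_density_pos step_density_integral_pos in
        \<open>auto intro!: continuous_at_imp_continuous_on DERIV_isCont DERIV_smooth_step exI simp:
            smooth_step'_def\<close>)
  also have "\<dots> \<le> smooth_step x" by (rule smooth_step_mono) simp
  finally show ?thesis by (simp add: smooth_step_eq_0)
qed

lemma smooth_step'_bounded: "\<exists>C\<ge>0. \<forall>x. smooth_step' x \<le> C"
proof -
  have "compact (smooth_step' ` {0..1})"
    by (intro compact_continuous_image smooth_continuous smooth_smooth_step') auto
  then obtain C where C: "\<And>y. y \<in> smooth_step' ` {0..1} \<Longrightarrow> norm y \<le> C"
    using compact_imp_bounded bounded_iff by metis
  have "smooth_step' x \<le> max C 0" for x
    using C[of "smooth_step' x"] smooth_step'_eq_0[of x]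
    by (cases "x \<in> {0..1}") (auto simp: max_def)
  then show ?thesis by (intro exI[of _ "max C 0"]) auto
qed


subsection \<open>Mollification\<close>

text \<open>Convolutions are Lebesgue integrals over the whole space, whereas the rules for
  integrals depending on a parameter concern integrals over a box; for continuous integrands
  supported in the box both agree.\<close>

lemma compact_support_integral:
  fixes f :: "'a::euclidean_space \<Rightarrow> 'b::euclidean_space"
  assumes "continuous_on UNIV f" "\<And>y. y \<notin> cbox a b \<Longrightarrow> f y = 0"
  shows "integrable lborel f" "integral\<^sup>L lborel f = integral (cbox a b) f"
proof -
  have eq: "f = (\<lambda>x. indicator (cbox a b) x *\<^sub>R f x)"
    using assms(2) by (auto simp: indicator_def)
  have *: "set_integrable lborel (cbox a b) f"
    unfolding set_integrable_def
    by (rule borel_integrable_compact[OF compact_cbox continuous_on_subset[OF assms(1)]]) auto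
  then show "integrable lborel f"
    unfolding set_integrable_def using eq by simp
  show "integral\<^sup>L lborel f = integral (cbox a b) f"
    using set_borel_integral_eq_integral(2)[OF *] eq unfolding set_lebesgue_integral_def by simp
qed

lemma compact_support_integrable:
  fixes f :: "'a::euclidean_space \<Rightarrow> 'b::euclidean_space"
  assumes "continuous_on UNIV f" "\<And>y. r \<le> norm (y - x) \<Longrightarrow> f y = 0"
  shows "integrable lborel f"
proof -
  obtain a where "cball x r \<subseteq> cbox (- a) a"
    using bounded_cball bounded_subset_cbox_symmetric by blast
  then show ?thesis
    using assms(2)
    by (intro compact_support_integral(1)[OF assms(1), of "-a" a])
      (force simp: dist_norm norm_minus_commute)
qed

text \<open>The variable \<open>x\<close> sits in the kernel, so all derivatives fall on
  \<open>k\<close>, and continuity of \<open>F\<close> suffices.\<close>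

definition convolve :: "('a::euclidean_space \<Rightarrow> real) \<Rightarrow> ('a \<Rightarrow> 'b::euclidean_space) \<Rightarrow> 'a \<Rightarrow> 'b" where
  "convolve k F x = (\<integral>y. k (x - y) *\<^sub>R F y \<partial>lborel)"

text \<open>Invariance of Lebesgue measure under \<open>y \<mapsto> x - y\<close>. In this form
  \<open>x\<close> sits in \<open>F\<close>, so that estimates for increments of \<open>F\<close>
  pass through the integral.\<close>

lemma convolve_eq:
  fixes F :: "'a::euclidean_space \<Rightarrow> 'b::euclidean_space"
  assumes "continuous_on UNIV k" "continuous_on UNIV F"
  shows "convolve k F x = (\<integral>y. k y *\<^sub>R F (x - y) \<partial>lborel)"
proof -
  have [measurable]: "k \<in> borel_measurable borel" "F \<in> borel_measurable borel"
    using assms by (auto intro: borel_measurable_continuous_onI)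
  have "distr lborel borel (\<lambda>y. x - y) = (lborel :: 'a measure)"
    using lborel_affine_euclidean[of "\<lambda>_. -1" x]
    by (subst lborel_affine[of "-1" x]) (auto simp: density_1)
  then have "(\<integral>y. k y *\<^sub>R F (x - y) \<partial>lborel)
      = (\<integral>y. k y *\<^sub>R F (x - y) \<partial>distr lborel borel (\<lambda>y. x - y))"
    by simp
  also have "\<dots> = (\<integral>y. k (x - y) *\<^sub>R F y \<partial>lborel)"
    by (subst integral_distr) auto
  finally show ?thesis by (simp add: convolve_def)
qed

text \<open>One box serves all \<open>x\<close> in the unit ball about \<open>x0\<close>, since the
  kernel reaches only \<open>r\<close> further. The domain of integration thus does not move with
  the parameter.\<close>

lemma convolve_eq_integral_cbox:
  fixes F :: "'a::euclidean_space \<Rightarrow> 'b::euclidean_space"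
  assumes F: "continuous_on UNIV F" and k: "continuous_on UNIV k" "\<And>y. r \<le> norm y \<Longrightarrow> k y = 0"
    and a: "cball x0 (r + 1) \<subseteq> cbox (- a) a" and x: "x \<in> ball x0 1"
  shows "convolve k F x = integral (cbox (- a) a) (\<lambda>y. k (x - y) *\<^sub>R F y)"
  unfolding convolve_def
proof (rule compact_support_integral(2))
  show "continuous_on UNIV (\<lambda>y. k (x - y) *\<^sub>R F y)"
    by (intro continuous_on_scaleR F continuous_on_compose2[OF k(1)] continuous_intros) auto
  fix y assume "y \<notin> cbox (- a) a"
  then have "y \<notin> cball x0 (r + 1)" using a by blast
  then have "r \<le> norm (x - y)"
    using x dist_triangle[of x0 y x] by (simp add: dist_norm)
  then show "k (x - y) *\<^sub>R F y = 0" using k(2) by simp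
qed

lemma C_upto_convolve:
  fixes F :: "'a::euclidean_space \<Rightarrow> 'b::euclidean_space"
  assumes F: "continuous_on UNIV F"
  shows "C_upto n k \<Longrightarrow> (\<And>y. r \<le> norm y \<Longrightarrow> k y = 0) \<Longrightarrow> C_upto n (convolve k F)"
proof (induction n arbitrary: k r)
  case (0 k)
  then have k: "continuous_on UNIV k" by simp
  have "isCont (convolve k F) x0" for x0
  proof -
    obtain a where a: "cball x0 (r + 1) \<subseteq> cbox (- a) a"
      using bounded_cball bounded_subset_cbox_symmetric by blast
    have eq: "convolve k F x = integral (cbox (- a) a) (\<lambda>y. k (x - y) *\<^sub>R F y)" if "x \<in> ball x0 1"
        for x
      by (rule convolve_eq_integral_cbox[OF F k 0(2) a that])
    have "continuous_on (ball x0 1) (\<lambda>x. integral (cbox (- a) a) (\<lambda>y. k (x - y) *\<^sub>R F y))"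
      by (rule integral_continuous_on_param)
        (auto simp: split_beta intro!: continuous_on_scaleR continuous_on_compose2[OF k]
            continuous_on_compose2[OF F] continuous_intros)
    then have "continuous_on (ball x0 1) (convolve k F)"
      by (rule continuous_on_eq) (simp add: eq)
    then show ?thesis by (simp add: continuous_on_eq_continuous_at)
  qed
  then show ?case by (simp add: continuous_at_imp_continuous_on)
next
  case (Suc n)
  note kD = C_upto_SucE[OF Suc.prems(1)]
  have k: "continuous_on UNIV k" using C_upto_continuous[OF Suc.prems(1)] .
  let ?Dk = "\<lambda>x w. frechet_derivative k (at x) w"
  have Dk_cont: "continuous_on UNIV (\<lambda>x. ?Dk x w)" for w
    using C_upto_continuous[OF kD(2)] .
  \<comment> \<open>A derivative vanishes where the function vanishes on a neighbourhood. Passing to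
    \<open>r + 1\<close> puts \<open>y\<close> into the open complement of the ball; this loss is
    the reason why \<open>r\<close> is arbitrary in the induction.\<close>
  have Dk_0: "?Dk y w = 0" if "r + 1 \<le> norm y" for y w
  proof -
    have "(k has_derivative (\<lambda>_. 0)) (at y)"
    proof (rule has_derivative_transform_within_open[of "\<lambda>_. 0" _ _ _ "- cball 0 r"])
      show "y \<in> - cball 0 r" using that by auto
    qed (use Suc.prems(2) in auto)
    from frechet_derivative_at[OF this] show ?thesis by metis
  qed
  show ?case
  proof (rule C_upto_SucI)
    show "C_upto n (\<lambda>x. convolve (\<lambda>y. ?Dk y w) F x)" for w
      using Suc.IH[OF kD(2) Dk_0] .
    show "(convolve k F has_derivative (\<lambda>w. convolve (\<lambda>y. ?Dk y w) F x0)) (at x0)" for x0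
    proof -
      obtain a where a: "cball x0 (r + 1 + 1) \<subseteq> cbox (- a) a"
        using bounded_cball bounded_subset_cbox_symmetric by blast
      note eq = convolve_eq_integral_cbox[OF F _ _ a]
      \<comment> \<open>The Leibniz rule asks for a derivative that is continuous as a map into the
        bounded linear functions; in finite dimension it is enough to check this on each basis
        vector.\<close>
      define fx where "fx x t = Blinfun (\<lambda>w. ?Dk (x - t) w *\<^sub>R F t)" for x t
      have fx: "blinfun_apply (fx x t) = (\<lambda>w. ?Dk (x - t) w *\<^sub>R F t)" for x t
        unfolding fx_def
        by (rule bounded_linear_Blinfun_apply)
          (rule bounded_linear_compose[OF bounded_linear_scaleR_left
              has_derivative_bounded_linear[OF kD(1)]])
      have D: "((\<lambda>x. integral (cbox (- a) a) (\<lambda>y. k (x - y) *\<^sub>R F y)) has_derivative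
          integral (cbox (- a) a) (fx x0)) (at x0 within ball x0 1)"
      proof (rule leibniz_rule)
        show "((\<lambda>x. k (x - t) *\<^sub>R F t) has_derivative fx x t) (at x within ball x0 1)" for x t
          unfolding fx
          by (rule has_derivative_scaleR_left, rule has_derivative_compose[OF _ kD(1),
              where f="\<lambda>x. x - t", THEN has_derivative_eq_rhs])
           (auto intro!: derivative_eq_intros)
        show "(\<lambda>y. k (x - y) *\<^sub>R F y) integrable_on cbox (- a) a" for x
          by (intro integrable_continuous continuous_on_scaleR continuous_on_subset[OF F]
              continuous_on_compose2[OF k] continuous_intros) auto
        show "continuous_on (ball x0 1 \<times> cbox (- a) a) (\<lambda>(x, t). fx x t)"
          unfolding split_beta
        proof (rule continuous_on_blinfun_componentwise)
          fix i :: 'a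
          show "continuous_on (ball x0 1 \<times> cbox (- a) a) (\<lambda>x. blinfun_apply (fx (fst x) (snd x)) i)"
            unfolding fx
            by (intro continuous_on_scaleR continuous_on_compose2[OF F] continuous_on_compose2[OF
                Dk_cont] continuous_intros) auto
        qed
      qed auto
      have int: "fx x0 integrable_on cbox (- a) a"
      proof (intro integrable_continuous continuous_on_blinfun_componentwise)
        show "continuous_on (cbox (- a) a) (\<lambda>x. blinfun_apply (fx x0 x) i)" for i
          unfolding fx
          by (intro continuous_on_scaleR continuous_on_subset[OF F] continuous_on_compose2[OF
              Dk_cont] continuous_intros) auto
      qed
      have "blinfun_apply (integral (cbox (- a) a) (fx x0)) w = convolve (\<lambda>y. ?Dk y w) F x0" for w
      proof -
        have "blinfun_apply (integral (cbox (- a) a) (fx x0)) w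
            = integral (cbox (- a) a) (\<lambda>t. blinfun_apply (fx x0 t) w)"
          by (rule blinfun_apply_integral[OF int])
        then show ?thesis
          by (subst eq) (auto simp: fx Dk_cont Dk_0)
      qed
      then have "blinfun_apply (integral (cbox (- a) a) (fx x0))
          = (\<lambda>w. convolve (\<lambda>y. ?Dk y w) F x0)"
        by (rule ext)
      then have "((\<lambda>x. integral (cbox (- a) a) (\<lambda>y. k (x - y) *\<^sub>R F y)) has_derivative
          (\<lambda>w. convolve (\<lambda>y. ?Dk y w) F x0)) (at x0)"
        using D by (simp only: at_within_open[of x0 "ball x0 1"] centre_in_ball zero_less_one
            open_ball)
      then show ?thesis
      proof (rule has_derivative_transform_within_open[of _ _ _ _ "ball x0 1"])
        show "integral (cbox (- a) a) (\<lambda>y. k (x - y) *\<^sub>R F y) = convolve k F x" if "x \<in> ball x0 1"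
            for x
          using eq[OF k _ that] Suc.prems(2) by force
      qed auto
    qed
  qed
qed

text \<open>An average of translates of \<open>F\<close> with total weight 1 has the same Lipschitz
  constant, and it moves values by at most \<open>L * r\<close> if the weight lives in the ball of
  radius \<open>r\<close>.\<close>

lemma smooth_lipschitz_approx:
  fixes F :: "'a::euclidean_space \<Rightarrow> 'b::euclidean_space"
  assumes L: "\<And>x y. norm (F x - F y) \<le> L * norm (x - y)" and "\<delta> > 0"
  obtains G where "smooth G" "\<And>x y. norm (G x - G y) \<le> L * norm (x - y)" "\<And>x. norm (G x - F x) \<le> \<delta>"
proof -
  \<comment> \<open>Two distinct points exist, so the Lipschitz bound itself forces \<open>L\<close>
    to be nonnegative.\<close>
  have "L * norm (SOME i::'a. i \<in> Basis) \<ge> 0"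
    using order_trans[OF norm_ge_zero L[of "SOME i. i \<in> Basis" 0]] by simp
  then have "L \<ge> 0" by (simp add: some_in_eq)
  \<comment> \<open>The summand 1 keeps the quotient meaningful for \<open>L = 0\<close>, and
    \<open>L * r \<le> \<delta>\<close> still holds.\<close>
  define r where "r = \<delta> / (L + 1)"
  have r: "r > 0" "L * r \<le> \<delta>"
    using \<open>\<delta> > 0\<close> \<open>L \<ge> 0\<close> by (auto simp: r_def field_simps)
  have contF: "continuous_on UNIV F"
    by (rule Lipschitz.lipschitz_on_continuous_on[of L])
      (auto simp: lipschitz_on_def dist_norm L \<open>L \<ge> 0\<close>)
  define k where "k y = flat_exp 0 (r\<^sup>2 - (norm y)\<^sup>2)" for y :: 'a
  have "smooth k"
    unfolding k_def[abs_def]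
    by (rule smooth_compose[OF smooth_flat_exp smooth_diff[OF smooth_const smooth_norm_power2[OF
        smooth_ident]]])
  then have contk: "continuous_on UNIV k" by (rule smooth_continuous)
  have k_ge: "k y \<ge> 0" for y by (simp add: k_def flat_exp_nonneg)
  have k0: "k y = 0" if "r \<le> norm y" for y
    using power_mono[OF that, of 2] r by (simp add: k_def flat_exp_def)
  have kint: "integrable lborel k"
    by (rule compact_support_integrable[OF contk, of r 0]) (simp add: k0)
  define c where "c = integral\<^sup>L lborel k"
  \<comment> \<open>With zero mass the open set where \<open>k\<close> does not vanish would be a
    null set, but it contains 0.\<close>
  have "c \<noteq> 0"
  proof
    assume "c = 0"
    then have "AE y in lborel. k y = 0"
      using integral_nonneg_eq_0_iff_AE[OF kint] k_ge by (simp add: c_def)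
    moreover have "open {y. k y \<noteq> 0}"
      by (rule open_Collect_neq[OF contk continuous_on_const])
    ultimately have "{y. k y \<noteq> 0} \<in> null_sets lborel"
      using AE_iff_null_sets[of "{y. k y \<noteq> 0}" lborel] by simp
    then have "negligible {y. k y \<noteq> 0}"
      by (simp add: negligible_iff_null_sets null_sets_completionI)
    moreover have "0 \<in> {y. k y \<noteq> 0}"
      using r by (simp add: k_def flat_exp_def)
    ultimately show False
      using open_not_negligible[OF \<open>open _\<close>] by blast
  qed
  then have c: "c > 0"
    using k_ge by (simp add: c_def less_le)
  define G where "G x = (1 / c) *\<^sub>R convolve k F x" for x
  have Geq: "G x = (1 / c) *\<^sub>R (\<integral>y. k y *\<^sub>R F (x - y) \<partial>lborel)" for x
    using convolve_eq[OF contk contF] by (simp add: G_def)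
  have int: "integrable lborel (\<lambda>y. k y *\<^sub>R F (x - y))" for x
  proof (rule compact_support_integrable[of _ r 0])
    show "continuous_on UNIV (\<lambda>y. k y *\<^sub>R F (x - y))"
      by (intro continuous_on_scaleR contk continuous_on_compose2[OF contF] continuous_intros) auto
  qed (simp add: k0)
  \<comment> \<open>A weighted average is bounded by the supremum over the support of the weight.
    Both remaining properties are instances: \<open>H\<close> is a difference of two translates of
    \<open>F\<close>, or of a translate and a constant value.\<close>
  have est: "norm ((1 / c) *\<^sub>R (\<integral>y. k y *\<^sub>R H y \<partial>lborel)) \<le> M"
    if H: "integrable lborel (\<lambda>y. k y *\<^sub>R H y)" "\<And>y. norm y \<le> r \<Longrightarrow> norm (H y) \<le> M"
        for H :: "'a \<Rightarrow> 'b" and M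
  proof -
    have "norm (\<integral>y. k y *\<^sub>R H y \<partial>lborel) \<le> (\<integral>y. M * k y \<partial>lborel)"
    proof (rule Bochner_Integration.integral_norm_bound_integral[OF H(1)])
      show "norm (k y *\<^sub>R H y) \<le> M * k y" for y
        using mult_right_mono[OF H(2)[of y] k_ge[of y]] k_ge[of y] k0[of y]
        by (cases "norm y \<le> r") (auto simp: mult.commute)
    qed (use kint in simp)
    then show ?thesis using c kint by (simp add: c_def field_simps)
  qed
  show thesis
  proof
    show "smooth G"
      unfolding G_def[abs_def]
    proof (rule smooth_bounded_linear[OF bounded_linear_scaleR_right])
      show "smooth (convolve k F)"
        unfolding smooth_def
      proof
        show "C_upto n (convolve k F)" for n
          by (rule C_upto_convolve[OF contF _ k0]) (use \<open>smooth k\<close> in \<open>simp_all add: smooth_def\<close>)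
      qed
    qed
    show "norm (G x - G y) \<le> L * norm (x - y)" for x y
    proof -
      have "(\<integral>u. k u *\<^sub>R (F (x - u) - F (y - u)) \<partial>lborel) =
          (\<integral>u. k u *\<^sub>R F (x - u) \<partial>lborel) - (\<integral>u. k u *\<^sub>R F (y - u) \<partial>lborel)"
        by (simp add: scaleR_diff_right int)
      then have "G x - G y = (1 / c) *\<^sub>R (\<integral>u. k u *\<^sub>R (F (x - u) - F (y - u)) \<partial>lborel)"
        unfolding Geq by (simp only: scaleR_diff_right)
      moreover have "norm \<dots> \<le> L * norm (x - y)"
        by (rule est) (use int L[of "x - u" "y - u" for u] in \<open>auto simp: scaleR_diff_right\<close>)
      ultimately show ?thesis by simp
    qed
    show "norm (G x - F x) \<le> \<delta>" for x
    proof -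
      have "F x = (1 / c) *\<^sub>R (\<integral>u. k u *\<^sub>R F x \<partial>lborel)"
        using kint c by (simp add: c_def)
      then have "G x - F x = (1 / c) *\<^sub>R (\<integral>u. k u *\<^sub>R (F (x - u) - F x) \<partial>lborel)"
        unfolding Geq using int kint by (simp add: scaleR_diff_right)
      moreover have "norm \<dots> \<le> \<delta>"
      proof (rule est)
        show "norm (F (x - u) - F x) \<le> \<delta>" if "norm u \<le> r" for u
          using L[of "x - u" x] mult_left_mono[OF that \<open>L \<ge> 0\<close>] r by simp
      qed (use int kint in \<open>auto simp: scaleR_diff_right\<close>)
      ultimately show ?thesis by simp
    qed
  qed
qed

text \<open>Pairing the difference quotient with the vector \<open>D w\<close> makes it real; the
  limit is then \<open>norm (D w)\<close> squared and is bounded by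
  \<open>L * norm w * norm (D w)\<close>.\<close>

lemma lipschitz_derivative_bound:
  fixes G :: "'a::real_normed_vector \<Rightarrow> 'b::real_inner"
  assumes L: "\<And>x y. norm (G x - G y) \<le> L * norm (x - y)" and D: "(G has_derivative D) (at x)"
  shows "norm (D w) \<le> L * norm w"
proof -
  have "((\<lambda>t. G (x + t *\<^sub>R w)) has_derivative (\<lambda>t. D (t *\<^sub>R w))) (at 0)"
    by (rule has_derivative_compose[of "\<lambda>t. x + t *\<^sub>R w" _ _ _ G])
      (auto intro!: derivative_eq_intros D)
  then have "((\<lambda>t. G (x + t *\<^sub>R w) \<bullet> D w) has_derivative (\<lambda>t. D (t *\<^sub>R w) \<bullet> D w)) (at 0)"
    by (rule has_derivative_inner_left)
  then have "((\<lambda>t. G (x + t *\<^sub>R w) \<bullet> D w) has_real_derivative (norm (D w))\<^sup>2) (at 0)"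
    by (simp add: has_field_derivative_def linear_scale[OF has_derivative_linear[OF D]]
        power2_norm_eq_inner mult_commute_abs)
  from DERIV_D[OF this]
  have lim: "((\<lambda>t. (G (x + t *\<^sub>R w) \<bullet> D w - G x \<bullet> D w) / t) \<longlongrightarrow> (norm (D w))\<^sup>2) (at 0)"
    by simp
  have "(norm (D w))\<^sup>2 \<le> L * norm w * norm (D w)"
  proof (rule tendsto_upperbound[OF lim])
    show "\<forall>\<^sub>F t in at 0. (G (x + t *\<^sub>R w) \<bullet> D w - G x \<bullet> D w) / t \<le> L * norm w * norm (D w)"
    proof (rule eventually_at_filter[THEN iffD2], rule always_eventually, intro allI impI)
      fix t :: real assume "t \<noteq> 0"
      have "(G (x + t *\<^sub>R w) \<bullet> D w - G x \<bullet> D w) / t \<le> \<bar>(G (x + t *\<^sub>R w) - G x) \<bullet> D w\<bar> / \<bar>t\<bar>"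
        by (metis abs_divide abs_ge_self inner_diff_left)
      also have "\<dots> \<le> norm (G (x + t *\<^sub>R w) - G x) * norm (D w) / \<bar>t\<bar>"
        by (intro divide_right_mono Cauchy_Schwarz_ineq2) simp
      also have "\<dots> \<le> L * norm (t *\<^sub>R w) * norm (D w) / \<bar>t\<bar>"
        using L[of "x + t *\<^sub>R w" x] by (intro divide_right_mono mult_right_mono) auto
      also have "\<dots> = L * norm w * norm (D w)"
        using \<open>t \<noteq> 0\<close> by simp
      finally show "(G (x + t *\<^sub>R w) \<bullet> D w - G x \<bullet> D w) / t \<le> L * norm w * norm (D w)" .
    qed
  qed simp
  then show ?thesis
    using order_trans[OF norm_ge_zero L[of "x + w" x]]
    by (cases "D w = 0") (simp_all add: power2_eq_square)
qed


section \<open>Continuity in the Wasserstein space\<close>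

lemma P2D:
  assumes "M \<in> P2"
  shows "prob_space M" "sets M = sets borel" "space M = UNIV" "integrable M (\<lambda>z. (norm z)\<^sup>2)"
  using assms sets_eq_imp_space_eq[of M borel] by (auto simp: P2_def)

lemma P2_integrable:
  fixes \<phi> :: "'a::euclidean_space \<Rightarrow> 'b::euclidean_space"
  assumes M: "M \<in> P2" and [measurable]: "\<phi> \<in> borel_measurable borel"
    and bound: "\<And>z. norm (\<phi> z) \<le> C * (1 + norm z)"
  shows "integrable M \<phi>"
proof -
  interpret prob_space M by (rule P2D[OF M])
  note [measurable_cong] = P2D(2)[OF M]
  have le: "norm (\<phi> z) \<le> \<bar>C\<bar> * (2 + (norm z)\<^sup>2)" for z
  proof -
    have "1 + norm z \<le> 2 + (norm z)\<^sup>2"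
      using sum_squares_bound[of "norm z" 1] norm_ge_zero[of z] unfolding one_power2 by linarith
    then have "C * (1 + norm z) \<le> \<bar>C\<bar> * (2 + (norm z)\<^sup>2)"
      by (intro mult_mono) auto
    with bound[of z] show ?thesis by linarith
  qed
  show ?thesis
  proof (rule Bochner_Integration.integrable_bound)
    show "integrable M (\<lambda>z. \<bar>C\<bar> * (2 + (norm z)\<^sup>2))"
      using P2D(4)[OF M] by (intro integrable_mult_right Bochner_Integration.integrable_add) auto
    show "AE z in M. norm (\<phi> z) \<le> norm (\<bar>C\<bar> * (2 + (norm z)\<^sup>2))"
      using le by (auto simp: abs_mult)
  qed simp
qed

text \<open>Linear growth survives integrating out one variable, the first moment of
  \<open>M\<close> becoming part of the constant; hence second moments are enough for both
  integrations.\<close>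

lemma P2_iterated_integrable:
  fixes \<Phi> :: "'a::euclidean_space \<Rightarrow> 'a \<Rightarrow> 'b::euclidean_space"
  assumes M: "M \<in> P2" and meas: "case_prod \<Phi> \<in> borel_measurable borel"
    and bound: "\<And>z w. norm (\<Phi> z w) \<le> C * (1 + norm z + norm w)"
  shows "integrable M (\<Phi> z)" "integrable M (\<lambda>z. \<integral>w. \<Phi> z w \<partial>M)"
    "norm (\<integral>w. \<Phi> z w \<partial>M) \<le> \<bar>C\<bar> * (1 + norm z + (\<integral>w. norm w \<partial>M))"
    "(\<lambda>z. \<integral>w. \<Phi> z w \<partial>M) \<in> borel_measurable borel"
proof -
  interpret prob_space M by (rule P2D[OF M])
  note [measurable_cong] = P2D(2)[OF M]
  have [measurable]: "case_prod \<Phi> \<in> borel_measurable (borel \<Otimes>\<^sub>M borel)"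
    using meas by (simp add: borel_prod)
  have bound': "norm (\<Phi> z w) \<le> \<bar>C\<bar> * (1 + norm z + norm w)" for z w
    by (rule order_trans[OF bound]) (intro mult_right_mono, auto)
  have int: "integrable M (\<Phi> z)" for z
  proof (rule P2_integrable[OF M])
    have "1 + norm z + norm w \<le> (1 + norm z) * (1 + norm w)" for w :: 'a
      by (simp add: algebra_simps)
    then show "norm (\<Phi> z w) \<le> \<bar>C\<bar> * (1 + norm z) * (1 + norm w)" for w
      using order_trans[OF bound'[of z w] mult_left_mono] by (simp add: mult.assoc)
    show "\<Phi> z \<in> borel_measurable borel" by measurable
  qed
  then show "integrable M (\<Phi> z)" .
  have int1: "integrable M (norm :: 'a \<Rightarrow> real)"
    by (rule P2_integrable[OF M, where C = 1]) auto
  have le: "norm (\<integral>w. \<Phi> z w \<partial>M) \<le> \<bar>C\<bar> * (1 + norm z + (\<integral>w. norm w \<partial>M))" for z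
  proof -
    have "norm (\<integral>w. \<Phi> z w \<partial>M) \<le> (\<integral>w. \<bar>C\<bar> * (1 + norm z + norm w) \<partial>M)"
      by (rule Bochner_Integration.integral_norm_bound_integral[OF int])
       (use bound' int1 in auto)
    also have "\<dots> = \<bar>C\<bar> * (1 + norm z + (\<integral>w. norm w \<partial>M))"
      using int1 by (simp add: prob_space)
    finally show ?thesis .
  qed
  then show "norm (\<integral>w. \<Phi> z w \<partial>M) \<le> \<bar>C\<bar> * (1 + norm z + (\<integral>w. norm w \<partial>M))" .
  show meas': "(\<lambda>z. \<integral>w. \<Phi> z w \<partial>M) \<in> borel_measurable borel"
    by measurable
  show "integrable M (\<lambda>z. \<integral>w. \<Phi> z w \<partial>M)"
  proof (rule P2_integrable[OF M meas'])
    fix z :: 'a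
    have nn: "(\<integral>w. norm w \<partial>M) \<ge> 0" by (rule integral_nonneg_AE) auto
    then have "1 + norm z + (\<integral>w. norm w \<partial>M) \<le> (1 + (\<integral>w. norm w \<partial>M)) * (1 + norm z)"
      by (simp add: algebra_simps)
    then show "norm (\<integral>w. \<Phi> z w \<partial>M) \<le> \<bar>C\<bar> * (1 + (\<integral>w. norm w \<partial>M)) * (1 + norm z)"
      using order_trans[OF le[of z] mult_left_mono] by (simp add: mult.assoc)
  qed
qed

section \<open>Couplings and transport cost\<close>

lemma borel_measurable_fst: "fst
    \<in> borel_measurable (borel :: ('a::euclidean_space \<times> 'b::euclidean_space) measure)"
  and borel_measurable_snd: "snd \<in> borel_measurable (borel :: ('a \<times> 'b) measure)"
  by (intro borel_measurable_continuous_onI continuous_on_fst[OF continuous_on_id])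
    (intro borel_measurable_continuous_onI continuous_on_snd[OF continuous_on_id])

lemma couplingsD:
  assumes "\<gamma> \<in> couplings M N"
  shows "prob_space \<gamma>" "sets \<gamma> = sets borel" "space \<gamma> = UNIV" "M = distr \<gamma> borel fst" "N
      = distr \<gamma> borel snd"
  using assms sets_eq_imp_space_eq[of \<gamma> borel] by (auto simp: couplings_def)

lemma couplings_integrable:
  fixes M :: "'a::euclidean_space measure"
  assumes \<gamma>: "\<gamma> \<in> couplings M N" and M: "M \<in> P2" and N: "N \<in> P2"
  shows "integrable \<gamma> (\<lambda>p. (norm (fst p))\<^sup>2)" "(\<integral>p. (norm (fst p))\<^sup>2 \<partial>\<gamma>) = (\<integral>z. (norm z)\<^sup>2 \<partial>M)"
    "integrable \<gamma> (\<lambda>p. (norm (snd p))\<^sup>2)" "(\<integral>p. (norm (snd p))\<^sup>2 \<partial>\<gamma>) = (\<integral>z. (norm z)\<^sup>2 \<partial>N)"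
    "integrable \<gamma> (\<lambda>p. (dist (fst p) (snd p))\<^sup>2)"
proof -
  note [measurable_cong] = couplingsD(2)[OF \<gamma>]
  note [measurable] = borel_measurable_fst[where 'a='a and 'b='a] borel_measurable_snd[where 'a='a
      and 'b='a]
  show 1: "integrable \<gamma> (\<lambda>p. (norm (fst p))\<^sup>2)"
    using P2D(4)[OF M] unfolding couplingsD(4)[OF \<gamma>] by (subst (asm) integrable_distr_eq) auto
  show 2: "integrable \<gamma> (\<lambda>p. (norm (snd p))\<^sup>2)"
    using P2D(4)[OF N] unfolding couplingsD(5)[OF \<gamma>] by (subst (asm) integrable_distr_eq) auto
  show "(\<integral>p. (norm (fst p))\<^sup>2 \<partial>\<gamma>) = (\<integral>z. (norm z)\<^sup>2 \<partial>M)"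
    unfolding couplingsD(4)[OF \<gamma>] by (subst integral_distr) auto
  show "(\<integral>p. (norm (snd p))\<^sup>2 \<partial>\<gamma>) = (\<integral>z. (norm z)\<^sup>2 \<partial>N)"
    unfolding couplingsD(5)[OF \<gamma>] by (subst integral_distr) auto
  show "integrable \<gamma> (\<lambda>p. (dist (fst p) (snd p))\<^sup>2)"
  proof (rule Bochner_Integration.integrable_bound)
    show "integrable \<gamma> (\<lambda>p. 2 * (norm (fst p))\<^sup>2 + 2 * (norm (snd p))\<^sup>2)"
      using 1 2 by simp
    have "(dist x y)\<^sup>2 \<le> 2 * (norm x)\<^sup>2 + 2 * (norm y)\<^sup>2" for x y :: 'a
    proof -
      have "(dist x y)\<^sup>2 \<le> (norm x + norm y)\<^sup>2"
        by (rule power_mono) (auto simp: dist_norm norm_triangle_ineq4)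
      also have "\<dots> \<le> 2 * (norm x)\<^sup>2 + 2 * (norm y)\<^sup>2"
        using sum_squares_bound[of "norm x" "norm y"] by (simp add: power2_sum)
      finally show ?thesis .
    qed
    then show "AE p in \<gamma>. norm ((dist (fst p) (snd p))\<^sup>2)
        \<le> norm (2 * (norm (fst p))\<^sup>2 + 2 * (norm (snd p))\<^sup>2)"
      by auto
  qed simp
qed

text \<open>Provides a member of \<open>couplings M N\<close>, so that the infimum in
  \<open>W2\<close> runs over a nonempty set and behaves as a genuine infimum.\<close>

lemma pair_measure_coupling:
  fixes M N :: "'a::euclidean_space measure"
  assumes M: "M \<in> P2" and N: "N \<in> P2"
  shows "M \<Otimes>\<^sub>M N \<in> couplings M N"
proof -
  interpret M: prob_space M by (rule P2D[OF M])
  interpret N: prob_space N by (rule P2D[OF N])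
  interpret pair_prob_space M N ..
  have s: "sets (M \<Otimes>\<^sub>M N) = sets borel"
    using sets_pair_measure_cong[OF P2D(2)[OF M] P2D(2)[OF N]] by (simp only: borel_prod)
  have "distr (M \<Otimes>\<^sub>M N) borel fst = distr (M \<Otimes>\<^sub>M N) M fst"
    by (rule distr_cong) (auto simp: P2D(2)[OF M])
  moreover have "distr (M \<Otimes>\<^sub>M N) M fst = M"
    using N.distr_pair_fst .
  moreover have "distr (M \<Otimes>\<^sub>M N) borel snd = N"
  proof (rule measure_eqI)
    show "sets (distr (M \<Otimes>\<^sub>M N) borel snd) = sets N" by (simp add: P2D(2)[OF N])
    fix A assume "A \<in> sets (distr (M \<Otimes>\<^sub>M N) borel snd)"
    then have A: "A \<in> sets N" by (simp add: P2D(2)[OF N])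
    have "snd \<in> measurable (M \<Otimes>\<^sub>M N) borel"
      using measurable_snd[of M N] measurable_cong_sets[OF refl P2D(2)[OF N]] by auto
    then have "emeasure (distr (M \<Otimes>\<^sub>M N) borel snd) A = emeasure (M \<Otimes>\<^sub>M N) (space M \<times> A)"
      using A sets.sets_into_space[OF A]
      by (subst emeasure_distr) (auto simp: P2D(2)[OF N] space_pair_measure intro!: arg_cong[where
          f="emeasure _"])
    also have "\<dots> = emeasure N A"
      by (subst N.emeasure_pair_measure_Times) (auto simp: A M.emeasure_space_1)
    finally show "emeasure (distr (M \<Otimes>\<^sub>M N) borel snd) A = emeasure N A" .
  qed
  ultimately show ?thesis
    using s prob_space_axioms by (simp add: couplings_def)
qed

lemma W2_less_coupling:
  fixes M N :: "'a::euclidean_space measure"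
  assumes M: "M \<in> P2" and N: "N \<in> P2" and "W2 M N < d"
  obtains \<gamma> where "\<gamma> \<in> couplings M N" "(\<integral>z. (dist (fst z) (snd z))\<^sup>2 \<partial>\<gamma>) < d\<^sup>2"
proof -
  let ?c = "\<lambda>\<gamma>. \<integral>z. (dist (fst z) (snd z))\<^sup>2 \<partial>\<gamma>"
  have bdd: "bdd_below (?c ` couplings M N)"
    by (rule bdd_belowI2[of _ 0]) simp
  have ne: "couplings M N \<noteq> {}" using pair_measure_coupling[OF M N] by auto
  have "(INF \<gamma>\<in>couplings M N. ?c \<gamma>) \<ge> 0"
    by (rule cINF_greatest[OF ne]) simp
  moreover have "sqrt (INF \<gamma>\<in>couplings M N. ?c \<gamma>) < d"
    using assms(3) by (simp add: W2_def)
  ultimately have "(INF \<gamma>\<in>couplings M N. ?c \<gamma>) < d\<^sup>2"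
    using real_less_lsqrt real_sqrt_less_iff
        by (smt (verit) real_sqrt_ge_zero real_sqrt_pow2 power2_less_imp_less power_strict_mono
        zero_less_numeral)
  then show thesis
    using cINF_less_iff[OF ne bdd] that by blast
qed

lemma W2_le_coupling:
  fixes M N :: "'a::euclidean_space measure"
  assumes "\<gamma> \<in> couplings M N" "(\<integral>z. (dist (fst z) (snd z))\<^sup>2 \<partial>\<gamma>) \<le> d\<^sup>2" "d \<ge> 0"
  shows "W2 M N \<le> d"
proof -
  have bdd: "bdd_below ((\<lambda>\<gamma>. \<integral>z. (dist (fst z) (snd z))\<^sup>2 \<partial>\<gamma>) ` couplings M N)"
    by (rule bdd_belowI2[of _ 0]) simp
  have "W2 M N \<le> sqrt (d\<^sup>2)"
    unfolding W2_def using cINF_lower2[OF bdd assms(1,2)] real_sqrt_le_mono by blast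
  then show ?thesis using assms(3) by simp
qed

lemma W2_nonneg:
  fixes M N :: "'a::euclidean_space measure"
  assumes "M \<in> P2" "N \<in> P2"
  shows "W2 M N \<ge> 0"
  unfolding W2_def using pair_measure_coupling[OF assms]
      by (intro real_sqrt_ge_zero cINF_greatest) auto

text \<open>Both marginals of a coupling are images of one measure. After this change of variables,
  iterated integrals against \<open>M\<close> and against \<open>N\<close> run over the same space
  and can be subtracted under the integral sign.\<close>

lemma marginal_iterated_integral:
  fixes M :: "'a::euclidean_space measure" and \<Phi> :: "'a \<Rightarrow> 'a \<Rightarrow> real"
    and \<gamma> :: "'b::euclidean_space measure"
  assumes \<gamma>: "sets \<gamma> = sets borel" and M: "M \<in> P2" "M = distr \<gamma> borel \<pi>"
    and \<pi>: "\<pi> \<in> borel_measurable borel" and meas: "case_prod \<Phi> \<in> borel_measurable borel"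
    and growth: "\<And>z w. \<bar>\<Phi> z w\<bar> \<le> C * (1 + norm z + norm w)"
  shows "integrable \<gamma> (\<lambda>q. \<Phi> z (\<pi> q))" "integrable \<gamma> (\<lambda>p. \<integral>q. \<Phi> (\<pi> p) (\<pi> q) \<partial>\<gamma>)"
    "(\<integral>z. \<integral>w. \<Phi> z w \<partial>M \<partial>M) = (\<integral>p. \<integral>q. \<Phi> (\<pi> p) (\<pi> q) \<partial>\<gamma> \<partial>\<gamma>)"
proof -
  note [measurable_cong] = \<gamma> and [measurable] = \<pi>
  have [measurable]: "case_prod \<Phi> \<in> borel_measurable (borel \<Otimes>\<^sub>M borel)"
    using meas by (simp add: borel_prod)
  have growth': "norm (\<Phi> z w) \<le> C * (1 + norm z + norm w)" for z w using growth by simp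
  note I = P2_iterated_integrable[OF M(1) meas growth']
  note [measurable] = I(4)
  have inner: "integrable \<gamma> (\<lambda>q. \<Phi> z (\<pi> q))" "(\<integral>w. \<Phi> z w \<partial>M) = (\<integral>q. \<Phi> z (\<pi> q) \<partial>\<gamma>)" for z
    using I(1)[of z] unfolding M(2) by (auto simp: integrable_distr_eq integral_distr)
  then show "integrable \<gamma> (\<lambda>q. \<Phi> z (\<pi> q))" by blast
  have "integrable (distr \<gamma> borel \<pi>) (\<lambda>z. \<integral>w. \<Phi> z w \<partial>M)" using I(2) M(2) by simp
  then have "integrable \<gamma> (\<lambda>p. \<integral>w. \<Phi> (\<pi> p) w \<partial>M)" by (subst (asm) integrable_distr_eq) auto
  then show "integrable \<gamma> (\<lambda>p. \<integral>q. \<Phi> (\<pi> p) (\<pi> q) \<partial>\<gamma>)" by (simp add: inner(2))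
  have "(\<integral>z. \<integral>w. \<Phi> z w \<partial>M \<partial>M) = (\<integral>z. \<integral>w. \<Phi> z w \<partial>M \<partial>distr \<gamma> borel \<pi>)" using M(2) by simp
  also have "\<dots> = (\<integral>p. \<integral>w. \<Phi> (\<pi> p) w \<partial>M \<partial>\<gamma>)" by (subst integral_distr) auto
  finally show "(\<integral>z. \<integral>w. \<Phi> z w \<partial>M \<partial>M) = (\<integral>p. \<integral>q. \<Phi> (\<pi> p) (\<pi> q) \<partial>\<gamma> \<partial>\<gamma>)"
    by (simp add: inner(2))
qed

text \<open>Each of the two integrations against \<open>\<gamma>\<close> contributes one copy of the
  integral of \<open>a\<close>. Two integrands are allowed because one integrand frozen at two
  different times will be compared.\<close>

lemma coupling_iterated_bound:
  fixes M N :: "'a::euclidean_space measure" and \<Phi>1 \<Phi>2 :: "'a \<Rightarrow> 'a \<Rightarrow> real"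
  assumes \<gamma>: "\<gamma> \<in> couplings M N" and M: "M \<in> P2" and N: "N \<in> P2"
    and meas: "case_prod \<Phi>1 \<in> borel_measurable borel" "case_prod \<Phi>2 \<in> borel_measurable borel"
    and growth: "\<And>z w. \<bar>\<Phi>1 z w\<bar> \<le> C * (1 + norm z + norm w)" "\<And>z w. \<bar>\<Phi>2 z w\<bar>
        \<le> C * (1 + norm z + norm w)"
    and close: "\<And>z z' w w'. \<bar>\<Phi>1 z w - \<Phi>2 z' w'\<bar> \<le> c + a (z, z') + a (w, w')"
    and a: "integrable \<gamma> a"
  shows "\<bar>(\<integral>z. \<integral>w. \<Phi>1 z w \<partial>M \<partial>M) - (\<integral>z. \<integral>w. \<Phi>2 z w \<partial>N \<partial>N)\<bar> \<le> c + 2 * (\<integral>p. a p \<partial>\<gamma>)"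
proof -
  interpret prob_space \<gamma> by (rule couplingsD[OF \<gamma>])
  note J1 = marginal_iterated_integral[OF couplingsD(2)[OF \<gamma>] M couplingsD(4)[OF \<gamma>]
      borel_measurable_fst meas(1) growth(1)]
    and J2 = marginal_iterated_integral[OF couplingsD(2)[OF \<gamma>] N couplingsD(5)[OF \<gamma>]
        borel_measurable_snd meas(2) growth(2)]
  define A where "A = (\<integral>p. a p \<partial>\<gamma>)"
  have inner: "\<bar>(\<integral>q. \<Phi>1 (fst p) (fst q) \<partial>\<gamma>) - (\<integral>q. \<Phi>2 (snd p) (snd q) \<partial>\<gamma>)\<bar> \<le> c + a p + A" for p
  proof -
    have "\<bar>(\<integral>q. \<Phi>1 (fst p) (fst q) \<partial>\<gamma>) - (\<integral>q. \<Phi>2 (snd p) (snd q) \<partial>\<gamma>)\<bar> =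
        norm (\<integral>q. \<Phi>1 (fst p) (fst q) - \<Phi>2 (snd p) (snd q) \<partial>\<gamma>)"
      by (simp add: J1(1) J2(1))
    also have "\<dots> \<le> (\<integral>q. c + a p + a q \<partial>\<gamma>)"
    proof (rule Bochner_Integration.integral_norm_bound_integral)
      show "norm (\<Phi>1 (fst p) (fst q) - \<Phi>2 (snd p) (snd q)) \<le> c + a p + a q" for q
        using close[of "fst p" "fst q" "snd p" "snd q"] by simp
    qed (use a J1(1) J2(1) in auto)
    also have "\<dots> = c + a p + A" using a by (simp add: A_def prob_space)
    finally show ?thesis .
  qed
  have "\<bar>(\<integral>z. \<integral>w. \<Phi>1 z w \<partial>M \<partial>M) - (\<integral>z. \<integral>w. \<Phi>2 z w \<partial>N \<partial>N)\<bar> =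
     norm (\<integral>p. (\<integral>q. \<Phi>1 (fst p) (fst q) \<partial>\<gamma>) - (\<integral>q. \<Phi>2 (snd p) (snd q) \<partial>\<gamma>) \<partial>\<gamma>)"
    using J1(2,3) J2(2,3) by simp
  also have "\<dots> \<le> (\<integral>p. c + a p + A \<partial>\<gamma>)"
    by (rule Bochner_Integration.integral_norm_bound_integral) (use a inner J1(2) J2(2) in auto)
  also have "\<dots> = c + 2 * A" using a by (simp add: A_def prob_space)
  finally show ?thesis by (simp add: A_def)
qed

text \<open>The right-hand side contains exactly what a coupling controls: second moments with a
  small factor and the squared distance with a large one. Far out, linear growth is absorbed by
  \<open>\<epsilon>\<close> times a square; in a ball, either uniform continuity applies or the
  points are at least \<open>\<delta>\<close> apart and the squared distance pays.\<close>

lemma continuous_linear_growth_modulus: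
  fixes \<Psi> :: "'a::euclidean_space \<Rightarrow> real"
  assumes cont: "continuous_on UNIV \<Psi>" and growth: "\<And>x. \<bar>\<Psi> x\<bar> \<le> C * (1 + norm x)" and "\<epsilon> > 0"
  obtains K where "K \<ge> 0" "\<And>x y. \<bar>\<Psi> x - \<Psi> y\<bar> \<le> \<epsilon> * (1 + (norm x)\<^sup>2 + (norm y)\<^sup>2)
      + K * (norm (x - y))\<^sup>2"
proof -
  have C: "C \<ge> 0" using growth[of 0] by simp
  \<comment> \<open>Beyond this radius \<open>4 * C * m \<le> \<epsilon> * m * m\<close>, and
    \<open>4 * C * m\<close> bounds the increment if \<open>m\<close> is the larger norm.\<close>
  define R where "R = max 1 (4 * C / \<epsilon>)"
  have "uniformly_continuous_on (cball 0 R) \<Psi>"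
    by (rule compact_uniformly_continuous[OF continuous_on_subset[OF cont]]) auto
  then obtain \<delta> where \<delta>: "\<delta> > 0"
    "\<And>x y. norm x \<le> R \<Longrightarrow> norm y \<le> R \<Longrightarrow> dist y x < \<delta> \<Longrightarrow> dist (\<Psi> y) (\<Psi> x) < \<epsilon>"
    unfolding uniformly_continuous_on_def using \<open>\<epsilon> > 0\<close> by (metis mem_cball_0)
  \<comment> \<open>Chosen so that \<open>K\<close> times the square of \<open>\<delta>\<close>
    equals the largest increment \<open>2 * C * (1 + R)\<close> inside the ball.\<close>
  define K where "K = 2 * C * (1 + R) / \<delta>\<^sup>2"
  have R: "R \<ge> 1" by (simp add: R_def)
  have K: "K \<ge> 0" using C R by (simp add: K_def)
  have sq: "0 \<le> \<epsilon> * (norm x)\<^sup>2" for x :: 'a using \<open>\<epsilon> > 0\<close> by simp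
  have "\<bar>\<Psi> x - \<Psi> y\<bar> \<le> \<epsilon> * (1 + (norm x)\<^sup>2 + (norm y)\<^sup>2) + K * (norm (x - y))\<^sup>2" for x y
  proof (cases "norm x \<le> R \<and> norm y \<le> R")
    case True
    show ?thesis
    proof (cases "dist x y < \<delta>")
      case near: True
      then have "\<bar>\<Psi> x - \<Psi> y\<bar> < \<epsilon>"
        using \<delta>(2)[of y x] True by (simp add: dist_real_def)
      moreover have "0 \<le> K * (norm (x - y))\<^sup>2" using K by simp
      ultimately show ?thesis using sq[of x] sq[of y] unfolding distrib_left by linarith
    next
      case False
      have "\<bar>\<Psi> x - \<Psi> y\<bar> \<le> C * (1 + R) + C * (1 + R)"
      proof -
        have "C * (1 + norm x) \<le> C * (1 + R)" "C * (1 + norm y) \<le> C * (1 + R)"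
          using True C by (auto intro: mult_left_mono)
        then show ?thesis using growth[of x] growth[of y] by linarith
      qed
      also have "\<dots> = K * \<delta>\<^sup>2" using \<delta>(1) by (simp add: K_def)
      also have "\<dots> \<le> K * (norm (x - y))\<^sup>2"
        using False \<delta>(1) K by (intro mult_left_mono power_mono) (auto simp: dist_norm)
      finally show ?thesis using sq[of x] sq[of y] \<open>\<epsilon> > 0\<close> unfolding distrib_left by linarith
    qed
  next
    case False
    define m where "m = max (norm x) (norm y)"
    have m: "m > R" using False by (auto simp: m_def)
    then have m1: "m \<ge> 1" "4 * C \<le> \<epsilon> * m"
      using \<open>\<epsilon> > 0\<close> by (auto simp: R_def divide_less_eq mult.commute)
    have "C * (1 + norm x) \<le> C * (2 * m)" "C * (1 + norm y) \<le> C * (2 * m)"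
      using m1 C by (auto intro!: mult_left_mono simp: m_def max_def split: if_splits)
    then have "\<bar>\<Psi> x - \<Psi> y\<bar> \<le> 4 * C * m" using growth[of x] growth[of y] by linarith
    also have "\<dots> \<le> \<epsilon> * m * m" using m1 by (intro mult_right_mono) auto
    also have "\<dots> \<le> \<epsilon> * (1 + (norm x)\<^sup>2 + (norm y)\<^sup>2)"
      using sq[of x] sq[of y] \<open>\<epsilon> > 0\<close> by (auto simp: m_def max_def algebra_simps power2_eq_square)
    also have "\<dots> \<le> \<epsilon> * (1 + (norm x)\<^sup>2 + (norm y)\<^sup>2) + K * (norm (x - y))\<^sup>2" using K by simp
    finally show ?thesis .
  qed
  with K show thesis using that by blast
qed

lemma norm_triple_power2: "(norm (t, z, w))\<^sup>2 = (norm t)\<^sup>2 + (norm z)\<^sup>2 + (norm w)\<^sup>2"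
  by (simp add: norm_Pair)

text \<open>Time is treated as one more coordinate of the modulus of continuity, so a moving
  integrand and a moving measure are handled by the same estimate with an almost optimal
  coupling.\<close>

theorem P2_continuous_iterated_integral:
  fixes g :: "real \<Rightarrow> 'a::euclidean_space measure" and \<Psi> :: "real \<times> 'a \<times> 'a \<Rightarrow> real"
  assumes g: "P2_continuous_on I g" and cont: "continuous_on UNIV \<Psi>"
    and growth: "\<And>t z w. \<bar>\<Psi> (t, z, w)\<bar> \<le> C * (1 + norm z + norm w)"
  shows "continuous_on I (\<lambda>t. \<integral>z. \<integral>w. \<Psi> (t, z, w) \<partial>g t \<partial>g t)"
  unfolding continuous_on_def
proof
  fix t assume t: "t \<in> I"
  let ?F = "\<lambda>t. \<integral>z. \<integral>w. \<Psi> (t, z, w) \<partial>g t \<partial>g t"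
  have gP: "g s \<in> P2" if "s \<in> I" for s using g that by (simp add: P2_continuous_on_def)
  have C: "C \<ge> 0" using growth[of 0 0 0] by simp
  have growth': "\<bar>\<Psi> x\<bar> \<le> (2 * C) * (1 + norm x)" for x
  proof (cases x)
    case (fields s z w)
    have "norm z \<le> norm x" "norm w \<le> norm x"
      unfolding fields by (metis norm_fst_le norm_snd_le order_trans fst_conv snd_conv)+
    then have "C * (1 + norm z + norm w) \<le> C * (2 * (1 + norm x))"
      by (intro mult_left_mono C) auto
    then show ?thesis using growth[of s z w] unfolding fields
        by (simp add: mult.assoc mult.left_commute)
  qed
  define m where "m s = (\<integral>z. (norm z)\<^sup>2 \<partial>g s)" for s
  have m0: "m s \<ge> 0" for s by (simp add: m_def)
  have [measurable]: "(\<lambda>(z, w). \<Psi> (s, z, w)) \<in> borel_measurable borel" for s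
    unfolding split_beta by (intro borel_measurable_continuous_onI continuous_on_compose2[OF cont]
        continuous_intros) auto
  show "(?F \<longlongrightarrow> ?F t) (at t within I)"
  proof (rule tendstoI)
    fix e :: real assume "e > 0"
    \<comment> \<open>Everything that is multiplied by \<open>\<epsilon>\<close>: the squares of the
      two times when they differ by at most 1, and twice the sum of the two second moments, where
      \<open>m s \<le> 2 * m t + 2\<close> for nearby \<open>s\<close>.\<close>
    define B where "B = 1 + (\<bar>t\<bar> + 1)\<^sup>2 + t\<^sup>2 + 2 * (3 * m t + 2)"
    have B: "B > 0" using m0[of t] by (simp add: B_def add_pos_nonneg)
    define \<epsilon> where "\<epsilon> = e / (2 * B)"
    have "\<epsilon> > 0" using \<open>e > 0\<close> B by (simp add: \<epsilon>_def)
    obtain K where K: "K \<ge> 0" "\<And>x y. \<bar>\<Psi> x - \<Psi> y\<bar> \<le> \<epsilon> * (1 + (norm x)\<^sup>2 + (norm y)\<^sup>2)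
        + K * (norm (x - y))\<^sup>2"
      using continuous_linear_growth_modulus[OF cont growth' \<open>\<epsilon> > 0\<close>] by blast
    \<comment> \<open>Three terms of size \<open>K * d\<close> have to fit into
      \<open>e / 2\<close>: one from the difference in time and two from the transport cost.\<close>
    define d where "d = min 1 (e / (8 * (K + 1)))"
    have d: "d > 0" "d \<le> 1" "K * (3 * d) < e / 2"
    proof -
      have "K * (3 * d) \<le> K * (3 * (e / (8 * (K + 1))))"
        using K by (intro mult_left_mono) (auto simp: d_def)
      also have "\<dots> = (3 / 8) * e * (K / (K + 1))" by (simp add: field_simps)
      also have "\<dots> \<le> (3 / 8) * e * 1" using K \<open>e > 0\<close> by (intro mult_left_mono) auto
      also have "\<dots> < e / 2" using \<open>e > 0\<close> by simp
      finally show "K * (3 * d) < e / 2" .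
    qed (use \<open>e > 0\<close> K in \<open>auto simp: d_def\<close>)
    have d2: "d\<^sup>2 \<le> d" using d by (simp add: power2_eq_square mult_left_le)
    have "((\<lambda>s. W2 (g s) (g t)) \<longlongrightarrow> 0) (at t within I)"
      using g t by (simp add: P2_continuous_on_def)
    from order_tendstoD(2)[OF this d(1)]
    have ev: "\<forall>\<^sub>F s in at t within I. W2 (g s) (g t) < d" .
    have ev2: "\<forall>\<^sub>F s in at t within I. \<bar>s - t\<bar> < d"
      using tendstoD[OF tendsto_ident_at d(1), of t I] by (simp add: dist_real_def)
    have ev3: "\<forall>\<^sub>F s in at t within I. s \<in> I" by (simp add: eventually_at_filter)
    show "\<forall>\<^sub>F s in at t within I. dist (?F s) (?F t) < e"
      using ev ev2 ev3
    proof eventually_elim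
      case (elim s)
      obtain \<gamma> where \<gamma>: "\<gamma> \<in> couplings (g s) (g t)" "(\<integral>z. (dist (fst z) (snd z))\<^sup>2 \<partial>\<gamma>) < d\<^sup>2"
        using W2_less_coupling[OF gP gP] elim t by blast
      note ci = couplings_integrable[OF \<gamma>(1) gP[OF elim(3)] gP[OF t]]
      define a where "a p = \<epsilon> * ((norm (fst p))\<^sup>2 + (norm (snd p))\<^sup>2)
          + K * (dist (fst p) (snd p))\<^sup>2" for p :: "'a \<times> 'a"
      have a: "integrable \<gamma> a" unfolding a_def[abs_def]
        by (intro Bochner_Integration.integrable_add integrable_mult_right ci)
      have ms: "m s \<le> 2 * m t + 2"
      proof -
        have "m s = (\<integral>p. (norm (fst p))\<^sup>2 \<partial>\<gamma>)" using ci(2) by (simp add: m_def)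
        also have "\<dots> \<le> (\<integral>p. 2 * (norm (snd p))\<^sup>2 + 2 * (dist (fst p) (snd p))\<^sup>2 \<partial>\<gamma>)"
        proof (rule integral_mono)
          fix p :: "'a \<times> 'a"
          have "norm (fst p) \<le> norm (snd p) + dist (fst p) (snd p)"
            using norm_triangle_ineq[of "snd p" "fst p - snd p"] by (simp add: dist_norm)
          then have "(norm (fst p))\<^sup>2 \<le> (norm (snd p) + dist (fst p) (snd p))\<^sup>2"
            by (rule power_mono) simp
          also have "\<dots> \<le> 2 * (norm (snd p))\<^sup>2 + 2 * (dist (fst p) (snd p))\<^sup>2"
            using sum_squares_bound[of "norm (snd p)" "dist (fst p) (snd p)"]
                by (simp add: power2_sum)
          finally show "(norm (fst p))\<^sup>2 \<le> 2 * (norm (snd p))\<^sup>2 + 2 * (dist (fst p) (snd p))\<^sup>2" .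
        qed (use ci in auto)
        also have "\<dots> = 2 * m t + 2 * (\<integral>p. (dist (fst p) (snd p))\<^sup>2 \<partial>\<gamma>)"
          using ci by (simp add: m_def)
        finally show ?thesis using \<gamma>(2) d d2 by linarith
      qed
      have A: "(\<integral>p. a p \<partial>\<gamma>) \<le> \<epsilon> * (3 * m t + 2) + K * d"
      proof -
        have "(\<integral>p. a p \<partial>\<gamma>) = \<epsilon> * (m s + m t) + K * (\<integral>p. (dist (fst p) (snd p))\<^sup>2 \<partial>\<gamma>)"
          unfolding a_def[abs_def] using ci by (simp add: m_def)
        also have "\<dots> \<le> \<epsilon> * (3 * m t + 2) + K * d"
          by (rule add_mono[OF mult_left_mono mult_left_mono]) (use ms \<gamma>(2) d2 \<open>\<epsilon> > 0\<close> K in auto)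
        finally show ?thesis .
      qed
      have "\<bar>?F s - ?F t\<bar> \<le> (\<epsilon> * (1 + s\<^sup>2 + t\<^sup>2) + K * (s - t)\<^sup>2) + 2 * (\<integral>p. a p \<partial>\<gamma>)"
      proof (rule coupling_iterated_bound[OF \<gamma>(1) gP[OF elim(3)] gP[OF t] _ _ growth growth _ a])
        fix z z' w w'
        show "\<bar>\<Psi> (s, z, w) - \<Psi> (t, z', w')\<bar> \<le> (\<epsilon> * (1 + s\<^sup>2 + t\<^sup>2) + K * (s - t)\<^sup>2) + a (z, z')
            + a (w, w')"
          using K(2)[of "(s, z, w)" "(t, z', w')"]
          by (simp add: norm_triple_power2 a_def dist_norm algebra_simps)
      qed auto
      also have "\<dots> \<le> \<epsilon> * B + K * (3 * d)"
      proof -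
        have "\<bar>s\<bar> \<le> \<bar>t\<bar> + 1" using elim(2) d by linarith
        then have "s\<^sup>2 \<le> (\<bar>t\<bar> + 1)\<^sup>2" using abs_le_square_iff[of s "\<bar>t\<bar> + 1"] by simp
        then have "\<epsilon> * (1 + s\<^sup>2 + t\<^sup>2) \<le> \<epsilon> * (1 + (\<bar>t\<bar> + 1)\<^sup>2 + t\<^sup>2)"
          using \<open>\<epsilon> > 0\<close> by simp
        moreover have "(s - t)\<^sup>2 \<le> d\<^sup>2"
          using elim(2) abs_le_square_iff[of "s - t" d] by simp
        then have "K * (s - t)\<^sup>2 \<le> K * d" using K d2 by (intro mult_left_mono) auto
        ultimately show ?thesis using A by (simp add: B_def algebra_simps)
      qed
      also have "\<epsilon> * B = e / 2" using B by (simp add: \<epsilon>_def)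
      finally show ?case using d by (simp add: dist_real_def)
    qed
  qed
qed

corollary P2_continuous_integral:
  fixes g :: "real \<Rightarrow> 'a::euclidean_space measure" and \<Psi> :: "real \<times> 'a \<Rightarrow> real"
  assumes g: "P2_continuous_on I g" and cont: "continuous_on UNIV \<Psi>"
    and growth: "\<And>t z. \<bar>\<Psi> (t, z)\<bar> \<le> C * (1 + norm z)"
  shows "continuous_on I (\<lambda>t. \<integral>z. \<Psi> (t, z) \<partial>g t)"
proof -
  have C: "C \<ge> 0" using growth[of 0 0] by simp
  have "continuous_on I (\<lambda>t. \<integral>z. \<integral>w. (\<lambda>(t, z, w::'a). \<Psi> (t, z)) (t, z, w) \<partial>g t \<partial>g t)"
  proof (rule P2_continuous_iterated_integral[OF g])
    show "continuous_on UNIV (\<lambda>(t, z, w::'a). \<Psi> (t, z))"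
      unfolding split_beta by (intro continuous_on_compose2[OF cont] continuous_intros) auto
    show "\<bar>(\<lambda>(t, z, w::'a). \<Psi> (t, z)) (t, z, w)\<bar> \<le> C * (1 + norm z + norm w)" for t z w
    proof -
      have "C * (1 + norm z) \<le> C * (1 + norm z + norm w)" using C by (intro mult_left_mono) auto
      then show ?thesis using growth[of t z] by simp
    qed
  qed
  moreover have "(\<integral>z. \<integral>w. \<Psi> (t, z) \<partial>g t \<partial>g t) = (\<integral>z. \<Psi> (t, z) \<partial>g t)" if "t \<in> I" for t
  proof -
    interpret prob_space "g t" using g that P2D(1) by (auto simp: P2_continuous_on_def)
    show ?thesis by (simp add: prob_space)
  qed
  ultimately show ?thesis
    by (elim continuous_on_eq) (simp del: lebesgue_integral_const)
qed


section \<open>Weak solutions for a general interaction kernel\<close>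

lemma smooth_derivative_bound:
  fixes h :: "'a::euclidean_space \<Rightarrow> real"
  assumes h: "smooth h" and K: "compact K"
  obtains M where "M \<ge> 0" "\<And>x u. x \<in> K \<Longrightarrow> \<bar>frechet_derivative h (at x) u\<bar> \<le> M * norm u"
proof -
  have "\<exists>m. \<forall>x\<in>K. \<bar>frechet_derivative h (at x) i\<bar> \<le> m" for i
  proof -
    have "compact ((\<lambda>x. frechet_derivative h (at x) i) ` K)"
      by (intro compact_continuous_image K smooth_continuous smooth_frechet_derivative h)
    from compact_imp_bounded[OF this] show ?thesis
      unfolding bounded_iff by auto
  qed
  then obtain m where m: "\<And>i x. x \<in> K \<Longrightarrow> \<bar>frechet_derivative h (at x) i\<bar> \<le> m i"
    by metis
  define M where "M = (\<Sum>i\<in>Basis. \<bar>m i\<bar>)"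
  have "\<bar>frechet_derivative h (at x) u\<bar> \<le> M * norm u" if "x \<in> K" for x u
  proof -
    have "frechet_derivative h (at x) u = (\<Sum>i\<in>Basis. (u \<bullet> i) *\<^sub>R frechet_derivative h (at x) i)"
      by (rule linear_sum_Basis[OF has_derivative_linear[OF smoothD[OF h]]])
    then have "\<bar>frechet_derivative h (at x) u\<bar>
        \<le> (\<Sum>i\<in>Basis. \<bar>(u \<bullet> i) *\<^sub>R frechet_derivative h (at x) i\<bar>)"
      by simp
    also have "\<dots> \<le> (\<Sum>i\<in>Basis. \<bar>m i\<bar> * norm u)"
    proof (rule sum_mono)
      fix i :: 'a assume "i \<in> Basis"
      then have "\<bar>u \<bullet> i\<bar> \<le> norm u" by (rule Basis_le_norm)
      moreover have "\<bar>frechet_derivative h (at x) i\<bar> \<le> \<bar>m i\<bar>" using m[OF that, of i] by linarith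
      ultimately show "\<bar>(u \<bullet> i) *\<^sub>R frechet_derivative h (at x) i\<bar> \<le> \<bar>m i\<bar> * norm u"
        using mult_mono[of "\<bar>u \<bullet> i\<bar>" "norm u" "\<bar>frechet_derivative h (at x) i\<bar>" "\<bar>m i\<bar>"]
        by (simp add: abs_mult mult.commute)
    qed
    also have "\<dots> = M * norm u" by (simp add: M_def sum_distrib_right)
    finally show ?thesis .
  qed
  moreover have "M \<ge> 0" by (simp add: M_def sum_nonneg)
  ultimately show thesis using that by blast
qed

lemma smooth_derivative_continuous:
  fixes h :: "'a::euclidean_space \<Rightarrow> real"
  assumes h: "smooth h" and f: "continuous_on S f" and u: "continuous_on S u"
  shows "continuous_on S (\<lambda>x. frechet_derivative h (at (f x)) (u x))"
proof -
  have "continuous_on S (\<lambda>x. \<Sum>i\<in>Basis. (u x \<bullet> i) *\<^sub>R frechet_derivative h (at (f x)) i)"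
    by (intro continuous_on_sum continuous_on_scaleR continuous_on_inner u continuous_on_const
        continuous_on_compose2[OF smooth_continuous[OF smooth_frechet_derivative[OF h], of UNIV]
            f]) auto
  then show ?thesis
    by (simp only: linear_sum_Basis[OF has_derivative_linear[OF smoothD[OF h]], symmetric])
qed

section \<open>The equation for an abstract kernel\<close>

definition test_space :: "real \<Rightarrow> (real \<times> 'a::euclidean_space \<Rightarrow> real) set" where
  "test_space T = {h. smooth h \<and> (\<exists>K. compact K \<and> K \<subseteq> {0..<T} \<times> UNIV \<and> (\<forall>x \<in> {0..} \<times> UNIV - K. h x
      = 0))}"

text \<open>Positions and velocities are not distinguished at this level. The Lipschitz constant may
  depend on the radius, while the growth constant is global; the latter excludes escape to infinity
  in finite time.\<close>

locale mean_field =
  fixes B :: "'a::euclidean_space \<Rightarrow> 'a" and C :: real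
  assumes B_growth: "norm (B z) \<le> C * (1 + norm z)"
    and B_lipschitz: "\<exists>L\<ge>0. \<forall>x y. norm x \<le> R \<longrightarrow> norm y \<le> R \<longrightarrow> norm (B x - B y) \<le> L * norm (x - y)"
begin

definition drift :: "'a measure \<Rightarrow> 'a \<Rightarrow> 'a" where
  "drift M z = (\<integral>w. B (z - w) \<partial>M)"

text \<open>The derivative of \<open>h\<close> along a trajectory in space-time with velocity
  \<open>(1, drift M z)\<close>. Time derivative, transport term and force term of the weak
  formulation are thereby collected in one integral.\<close>

definition rate :: "(real \<times> 'a \<Rightarrow> real) \<Rightarrow> 'a measure \<Rightarrow> real \<Rightarrow> real" where
  "rate h M t = (\<integral>z. frechet_derivative h (at (t, z)) (1, drift M z) \<partial>M)"

definition weak_sol :: "real \<Rightarrow> 'a measure \<Rightarrow> (real \<Rightarrow> 'a measure) \<Rightarrow> bool" where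
  "weak_sol T f0 g \<longleftrightarrow> P2_continuous_on {0..T} g \<and>
     (\<forall>h\<in>test_space T. (LINT t:{0..T}|lborel. rate h (g t) t) + (\<integral>z. h (0, z) \<partial>f0) = 0)"

lemma C_nonneg: "C \<ge> 0"
  using order_trans[OF norm_ge_zero B_growth[of 0]] by simp

lemma B_continuous: "continuous_on S B"
proof -
  have "isCont B x" for x
  proof -
    obtain L where L: "L \<ge> 0" "\<And>y y'. norm y \<le> norm x + 1 \<Longrightarrow> norm y' \<le> norm x + 1
        \<Longrightarrow> norm (B y - B y') \<le> L * norm (y - y')"
      using B_lipschitz[of "norm x + 1"] by blast
    have le: "norm y \<le> norm x + 1" if "y \<in> ball x 1" for y
      using that norm_triangle_ineq2[of y x] by (simp add: dist_norm norm_minus_commute)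
    have "L-lipschitz_on (ball x 1) B"
      using L le by (auto simp: lipschitz_on_def dist_norm)
    then have "continuous_on (ball x 1) B" by (rule lipschitz_on_continuous_on)
    then show ?thesis by (simp add: continuous_on_eq_continuous_at)
  qed
  then show ?thesis by (simp add: continuous_at_imp_continuous_on)
qed

lemma B_diff_measurable: "(\<lambda>(z, w). B (z - w)) \<in> borel_measurable borel"
  unfolding split_beta by (intro borel_measurable_continuous_onI continuous_on_compose2[OF
      B_continuous[of UNIV]] continuous_intros) auto

lemma B_diff_growth: "norm (B (z - w)) \<le> C * (1 + norm z + norm w)"
proof -
  have "C * (1 + norm (z - w)) \<le> C * (1 + norm z + norm w)"
    using norm_triangle_ineq4[of z w] by (intro mult_left_mono C_nonneg) simp
  then show ?thesis using B_growth[of "z - w"] by linarith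
qed

lemma drift_integrable: "M \<in> P2 \<Longrightarrow> integrable M (\<lambda>w. B (z - w))"
  using P2_iterated_integrable(1)[OF _ B_diff_measurable B_diff_growth] by simp

lemma drift_growth: "M \<in> P2 \<Longrightarrow> norm (drift M z) \<le> C * (1 + norm z + (\<integral>w. norm w \<partial>M))"
  using P2_iterated_integrable(3)[OF _ B_diff_measurable B_diff_growth] C_nonneg
  unfolding drift_def by simp

lemma drift_measurable: "M \<in> P2 \<Longrightarrow> drift M \<in> borel_measurable borel"
  using P2_iterated_integrable(4)[OF _ B_diff_measurable B_diff_growth]
  unfolding drift_def[abs_def] by simp

text \<open>A derivative is linear and commutes with the integral that defines the drift. The rate
  thus becomes an iterated integral of a continuous function, for which continuity in time is
  available.\<close>

lemma derivative_drift:
  fixes h :: "real \<times> 'a \<Rightarrow> real" and P :: "real \<times> 'a \<Rightarrow> real \<times> 'a"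
  assumes M: "M \<in> P2" and h: "smooth h" and P: "bounded_linear P"
  shows "frechet_derivative h (at (t, z)) (P (1, drift M z))
      = (\<integral>w. frechet_derivative h (at (t, z)) (P (1, B (z - w))) \<partial>M)"
proof -
  interpret prob_space M by (rule P2D[OF M])
  have "integrable M (\<lambda>w. (0::real, B (z - w)))"
    by (rule integrable_bounded_linear[OF bounded_linear_Pair[OF bounded_linear_zero
        bounded_linear_ident]
          drift_integrable[OF M]])
  then have "integrable M (\<lambda>w. (1, 0) + (0::real, B (z - w)))"
    by (intro Bochner_Integration.integrable_add) auto
  then have int: "integrable M (\<lambda>w. (1::real, B (z - w)))" by simp
  have "(1, drift M z) = (\<integral>w. (1::real, B (z - w)) \<partial>M)"
  proof -
    have "fst (\<integral>w. (1::real, B (z - w)) \<partial>M) = (\<integral>w. fst (1::real, B (z - w)) \<partial>M)"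
      using integral_bounded_linear[OF bounded_linear_fst int] by simp
    moreover have "snd (\<integral>w. (1::real, B (z - w)) \<partial>M) = (\<integral>w. snd (1::real, B (z - w)) \<partial>M)"
      using integral_bounded_linear[OF bounded_linear_snd int] by simp
    ultimately show ?thesis by (simp add: drift_def prob_space prod_eq_iff)
  qed
  then show ?thesis
    using integral_bounded_linear[OF bounded_linear_compose[OF
        has_derivative_bounded_linear[OF smoothD[OF h, of "(t, z)"]] P] int] by simp
qed

lemma norm_time_B_diff: "norm (1::real, B (z - w)) \<le> (1 + C) * (1 + norm z + norm w)"
proof -
  have "norm (1::real, B (z - w)) \<le> 1 + norm (B (z - w))"
    using norm_Pair_le[of "1::real" "B (z - w)"] by simp
  also have "\<dots> \<le> 1 + C * (1 + norm z + norm w)"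
    using B_diff_growth[of z w] by simp
  also have "\<dots> \<le> (1 + C) * (1 + norm z + norm w)"
    by (simp add: algebra_simps)
  finally show ?thesis .
qed

lemma spatial_support_derivative:
  fixes h :: "real \<times> 'a \<Rightarrow> real"
  assumes h: "smooth h" and supp: "\<And>t z. R \<le> norm z \<Longrightarrow> h (t, z) = 0"
  obtains M where "M \<ge> 0" "\<And>t z u. t \<in> {0..T} \<Longrightarrow> \<bar>frechet_derivative h (at (t, z)) u\<bar> \<le> M * norm u"
proof -
  obtain M where M: "M \<ge> 0" "\<And>x u. x \<in> {0..T} \<times> cball 0 R \<Longrightarrow> \<bar>frechet_derivative h (at x) u\<bar>
      \<le> M * norm u"
    using smooth_derivative_bound[OF h compact_Times[OF compact_Icc compact_cball]] by blast
  have "\<bar>frechet_derivative h (at (t, z)) u\<bar> \<le> M * norm u" if "t \<in> {0..T}" for t z u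
  proof (cases "norm z \<le> R")
    case True
    then show ?thesis using M(2)[of "(t, z)" u] that by simp
  next
    case False
    have "(h has_derivative (\<lambda>_. 0)) (at (t, z))"
    proof (rule has_derivative_transform_within_open[of "\<lambda>_. 0" _ _ _ "UNIV \<times> (- cball 0 R)"])
      show "open (UNIV \<times> - cball 0 R :: (real \<times> 'a) set)" by (intro open_Times) auto
    qed (use False supp in auto)
    then have "frechet_derivative h (at (t, z)) = (\<lambda>_. 0)" using frechet_derivative_at by metis
    then show ?thesis using M(1) by simp
  qed
  then show thesis using that M(1) by blast
qed

text \<open>Clamping the time to \<open>{0..T}\<close> turns a growth bound known only there into a
  global one and changes nothing on the interval.\<close>

lemma P2_continuous_iterated_integral_interval:
  fixes \<Psi> :: "real \<times> 'a \<times> 'a \<Rightarrow> real"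
  assumes g: "P2_continuous_on {0..T} g" and "0 \<le> T" and cont: "continuous_on UNIV \<Psi>"
    and growth: "\<And>t z w. t \<in> {0..T} \<Longrightarrow> \<bar>\<Psi> (t, z, w)\<bar> \<le> D * (1 + norm z + norm w)"
  shows "continuous_on {0..T} (\<lambda>t. \<integral>z. \<integral>w. \<Psi> (t, z, w) \<partial>g t \<partial>g t)"
proof -
  let ?\<Psi> = "\<lambda>(t, z, w). \<Psi> (max 0 (min T t), z, w)"
  have "continuous_on {0..T} (\<lambda>t. \<integral>z. \<integral>w. ?\<Psi> (t, z, w) \<partial>g t \<partial>g t)"
  proof (rule P2_continuous_iterated_integral[OF g])
    show "continuous_on UNIV ?\<Psi>"
      unfolding split_beta by (intro continuous_on_compose2[OF cont] continuous_intros) auto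
    show "\<bar>?\<Psi> (t, z, w)\<bar> \<le> D * (1 + norm z + norm w)" for t z w
      using growth[of "max 0 (min T t)"] \<open>0 \<le> T\<close> by auto
  qed
  then show ?thesis by (rule continuous_on_eq) (auto simp: max_def min_def)
qed

lemma P2_continuous_integral_interval:
  fixes \<Psi> :: "real \<times> 'a \<Rightarrow> real"
  assumes g: "P2_continuous_on {0..T} g" and "0 \<le> T" and cont: "continuous_on UNIV \<Psi>"
    and growth: "\<And>t z. t \<in> {0..T} \<Longrightarrow> \<bar>\<Psi> (t, z)\<bar> \<le> D * (1 + norm z)"
  shows "continuous_on {0..T} (\<lambda>t. \<integral>z. \<Psi> (t, z) \<partial>g t)"
proof -
  let ?\<Psi> = "\<lambda>(t, z). \<Psi> (max 0 (min T t), z)"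
  have "continuous_on {0..T} (\<lambda>t. \<integral>z. ?\<Psi> (t, z) \<partial>g t)"
  proof (rule P2_continuous_integral[OF g])
    show "continuous_on UNIV ?\<Psi>"
      unfolding split_beta by (intro continuous_on_compose2[OF cont] continuous_intros) auto
    show "\<bar>?\<Psi> (t, z)\<bar> \<le> D * (1 + norm z)" for t z
      using growth[of "max 0 (min T t)"] \<open>0 \<le> T\<close> by auto
  qed
  then show ?thesis by (rule continuous_on_eq) (auto simp: max_def min_def)
qed

text \<open>\<open>P\<close> is the identity for the full rate. It becomes a coordinate projection
  when the rate has to be split into the two sides of the original weak formulation.\<close>

lemma partial_rate_bound:
  fixes h :: "real \<times> 'a \<Rightarrow> real" and P :: "real \<times> 'a \<Rightarrow> real \<times> 'a"
  assumes D: "D \<ge> 0" "\<And>u. \<bar>frechet_derivative h (at (t, z)) u\<bar> \<le> D * norm u"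
    and P: "\<And>u. norm (P u) \<le> norm u"
  shows "\<bar>frechet_derivative h (at (t, z)) (P (1, B (z - w)))\<bar>
      \<le> D * (1 + C) * (1 + norm z + norm w)"
proof -
  have "norm (P (1, B (z - w))) \<le> (1 + C) * (1 + norm z + norm w)"
    using order_trans[OF P norm_time_B_diff] .
  from mult_left_mono[OF this D(1)] D(2)[of "P (1, B (z - w))"]
  show ?thesis by (simp add: mult.assoc)
qed

lemma partial_rate_integrable:
  fixes h :: "real \<times> 'a \<Rightarrow> real" and P :: "real \<times> 'a \<Rightarrow> real \<times> 'a"
  assumes M: "M \<in> P2" and h: "smooth h"
    and D: "D \<ge> 0" "\<And>z u. \<bar>frechet_derivative h (at (t, z)) u\<bar> \<le> D * norm u"
    and P: "bounded_linear P" "\<And>u. norm (P u) \<le> norm u"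
  shows "integrable M (\<lambda>z. frechet_derivative h (at (t, z)) (P (1, drift M z)))"
  unfolding derivative_drift[OF M h P(1)]
proof (rule P2_iterated_integrable(2)[OF M])
  show "(\<lambda>(z, w). frechet_derivative h (at (t, z)) (P (1, B (z - w)))) \<in> borel_measurable borel"
    unfolding split_beta
    by (intro borel_measurable_continuous_onI smooth_derivative_continuous[OF h]
        bounded_linear.continuous_on[OF P(1)] continuous_intros
            continuous_on_compose2[OF B_continuous[of UNIV]]) auto
  show "norm (frechet_derivative h (at (t, z)) (P (1, B (z - w))))
      \<le> D * (1 + C) * (1 + norm z + norm w)" for z w
    using partial_rate_bound[OF D P(2)] by simp
qed

lemma partial_rate_continuous:
  fixes P :: "real \<times> 'a \<Rightarrow> real \<times> 'a"
  assumes g: "P2_continuous_on {0..T} g" and "0 \<le> T" and h: "smooth (h :: real \<times> 'a \<Rightarrow> real)"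
    and D: "D \<ge> 0" "\<And>t z u. t \<in> {0..T} \<Longrightarrow> \<bar>frechet_derivative h (at (t, z)) u\<bar> \<le> D * norm u"
    and P: "bounded_linear P" "\<And>u. norm (P u) \<le> norm u"
  shows "continuous_on {0..T} (\<lambda>t. \<integral>z. frechet_derivative h (at (t, z)) (P (1, drift (g t) z)) \<partial>g
      t)"
proof -
  let ?\<Psi> = "\<lambda>(t, z, w). frechet_derivative h (at (t, z)) (P (1, B (z - w)))"
  have "continuous_on {0..T} (\<lambda>t. \<integral>z. \<integral>w. ?\<Psi> (t, z, w) \<partial>g t \<partial>g t)"
  proof (rule P2_continuous_iterated_integral_interval[OF g \<open>0 \<le> T\<close>])
    show "continuous_on UNIV ?\<Psi>"
      unfolding split_beta
      by (intro smooth_derivative_continuous[OF h] bounded_linear.continuous_on[OF P(1)]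
          continuous_intros
          continuous_on_compose2[OF B_continuous[of UNIV]]) auto
    show "\<bar>?\<Psi> (t, z, w)\<bar> \<le> D * (1 + C) * (1 + norm z + norm w)" if "t \<in> {0..T}" for t z w
      using partial_rate_bound[OF D(1) D(2)[OF that] P(2)] by simp
  qed
  then show ?thesis
    by (rule continuous_on_eq)
        (use g derivative_drift[OF _ h P(1)] in \<open>auto simp: P2_continuous_on_def\<close>)
qed

lemma rate_continuous:
  assumes g: "P2_continuous_on {0..T} g" and "0 \<le> T" and h: "smooth h"
    and D: "D \<ge> 0" "\<And>t z u. t \<in> {0..T} \<Longrightarrow> \<bar>frechet_derivative h (at (t, z)) u\<bar> \<le> D * norm u"
  shows "continuous_on {0..T} (\<lambda>t. rate h (g t) t)"
  unfolding rate_def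
  by (rule partial_rate_continuous[OF assms bounded_linear_ident]) auto

text \<open>Testing with \<open>\<theta> h\<close>, where the cutoff \<open>\<theta>\<close> decreases from 1 to 0 just before the time \<open>t\<close>,
  turns the weak formulation into its pointwise-in-time form.\<close>

lemma weak_sol_pointwise_compact:
  assumes g: "weak_sol T f0 g" and "0 < T" and h: "smooth h"
    and supp: "\<And>t z. R \<le> norm z \<Longrightarrow> h (t, z) = 0" and t: "t \<in> {0..T}"
  shows "(\<integral>z. h (t, z) \<partial>g t) = (\<integral>z. h (0, z) \<partial>f0) + integral {0..t} (\<lambda>s. rate h (g s) s)"
    "continuous_on {0..T} (\<lambda>s. rate h (g s) s)"
proof -
  have gc: "P2_continuous_on {0..T} g"
    and eq: "\<And>h. h \<in> test_space T \<Longrightarrow> (LINT t:{0..T}|lborel. rate h (g t) t) + (\<integral>z. h (0, z) \<partial>f0) = 0"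
    using g by (auto simp: weak_sol_def)
  have gP: "g s \<in> P2" if "s \<in> {0..T}" for s using gc that by (simp add: P2_continuous_on_def)
  obtain D where D: "D \<ge> 0" "\<And>t z u. t \<in> {0..T} \<Longrightarrow> \<bar>frechet_derivative h (at (t, z)) u\<bar> \<le> D * norm u"
    using spatial_support_derivative[OF h supp] by blast
  define \<Lambda> where "\<Lambda> = (\<lambda>s. rate h (g s) s)"
  show rc: "continuous_on {0..T} (\<lambda>s. rate h (g s) s)"
    by (rule rate_continuous[OF gc _ h D]) (use \<open>0 < T\<close> in auto)
  then have \<Lambda>c: "continuous_on {0..T} \<Lambda>" by (simp add: \<Lambda>_def)
  have "compact (h ` ({0..T} \<times> cball 0 R))"
    by (intro compact_continuous_image smooth_continuous h compact_Times) auto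
  from compact_imp_bounded[OF this] obtain H where H: "\<And>x. x \<in> {0..T} \<times> cball 0 R \<Longrightarrow> \<bar>h x\<bar> \<le> H"
    unfolding bounded_iff by auto
  have Hb: "\<bar>h (s, z)\<bar> \<le> \<bar>H\<bar> * (1 + norm z)" if "s \<in> {0..T}" for s z
  proof -
    have "\<bar>h (s, z)\<bar> \<le> \<bar>H\<bar>"
      using H[of "(s, z)"] that supp[of z s] by (cases "norm z \<le> R") auto
    also have "\<dots> \<le> \<bar>H\<bar> * (1 + norm z)" by (simp add: mult_le_cancel_left1)
    finally show ?thesis .
  qed
  define u where "u = (\<lambda>s. \<integral>z. h (s, z) \<partial>g s)"
  have uc: "continuous_on {0..T} u" unfolding u_def
    by (rule P2_continuous_integral_interval[OF gc _ smooth_continuous[OF h] Hb])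
        (use \<open>0 < T\<close> in auto)
  define u0 where "u0 = (\<integral>z. h (0, z) \<partial>f0)"
  \<comment> \<open>\<open>W\<close> is the value that the claim predicts for \<open>u\<close>; the
    difference \<open>E\<close> is the defect to be shown to vanish.\<close>
  define W where "W = (\<lambda>s. u0 + integral {0..s} \<Lambda>)"
  have W': "(W has_real_derivative \<Lambda> s) (at s within {0..T})" if "s \<in> {0..T}" for s
    unfolding W_def using integral_has_real_derivative[OF \<Lambda>c that]
        by (auto intro!: derivative_eq_intros)
  have Wc: "continuous_on {0..T} W"
    using W' by (meson DERIV_continuous continuous_on_eq_continuous_within)
  define E where "E = (\<lambda>s. u s - W s)"
  have Ec: "continuous_on {0..T} E" unfolding E_def by (intro continuous_intros uc Wc)
  \<comment> \<open>Testing with \<open>\<theta> h\<close> gives an identity for \<open>u\<close>;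
    integrating the derivative of \<open>\<theta> * W\<close> gives the same identity for
    \<open>W\<close>. On subtraction \<open>\<Lambda>\<close> and the initial value cancel.\<close>
  have zero: "integral {0..T} (\<lambda>s. \<theta>' s * E s) = 0"
    if \<theta>: "\<And>s. (\<theta> has_real_derivative \<theta>' s) (at s)" "smooth \<theta>'" "\<And>s. s \<ge> t0 \<Longrightarrow> \<theta> s = 0" "t0 < T"
        for \<theta> \<theta>' :: "real \<Rightarrow> real" and t0
  proof -
    have \<theta>s: "smooth \<theta>" by (rule smooth_realI[OF \<theta>(1,2)])
    have \<theta>c: "continuous_on S \<theta>" "continuous_on S \<theta>'" for S
      using smooth_continuous[OF \<theta>s] smooth_continuous[OF \<theta>(2)] by auto
    define k where "k x = \<theta> (fst x) * h x" for x
    have ks: "smooth k" unfolding k_def[abs_def]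
      by (intro smooth_mult h smooth_compose[OF \<theta>s] smooth_fst smooth_ident)
    have "k \<in> test_space T"
      unfolding test_space_def
    proof (intro CollectI conjI ks exI)
      show "compact ({0..t0} \<times> cball (0::'a) R)" by (intro compact_Times) auto
      show "{0..t0} \<times> cball 0 R \<subseteq> {0..<T} \<times> UNIV" using \<theta>(4) by auto
      show "\<forall>x\<in>{0..} \<times> UNIV - {0..t0} \<times> cball 0 R. k x = 0"
        using \<theta>(3) supp by (auto simp: k_def) (meson linear)+
    qed
    note eqk = eq[OF this]
    have Dk: "frechet_derivative k (at (s, z)) (1, b) = \<theta>' s * h (s, z)
        + \<theta> s * frechet_derivative h (at (s, z)) (1, b)" for s z b
    proof -
      have "((\<lambda>x. \<theta> (fst x)) has_derivative (\<lambda>x. \<theta>' s * fst x)) (at (s, z))"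
        by (rule has_derivative_compose[of fst fst "(s, z)" UNIV \<theta> "\<lambda>x. \<theta>' s * x"])
         (use \<theta>(1)[of s] in \<open>auto intro!: has_derivative_fst[OF has_derivative_ident] simp:
             has_field_derivative_def\<close>)
      from has_derivative_mult[OF this smoothD[OF h, of "(s, z)"]]
      have "(k has_derivative (\<lambda>x. \<theta> (fst (s, z)) * frechet_derivative h (at (s, z)) x
          + \<theta>' s * fst x * h (s, z))) (at (s, z))"
        unfolding k_def[abs_def] .
      from frechet_derivative_at[OF this] show ?thesis
          by (metis (no_types, lifting) add.commute fst_conv mult.right_neutral)
    qed
    have rk: "rate k (g s) s = \<theta>' s * u s + \<theta> s * \<Lambda> s" if "s \<in> {0..T}" for s
    proof -
      have i1: "integrable (g s) (\<lambda>z. h (s, z))"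
      proof (rule P2_integrable[OF gP[OF that]])
        show "(\<lambda>z. h (s, z)) \<in> borel_measurable borel"
          by (intro borel_measurable_continuous_onI continuous_on_compose2[OF smooth_continuous[OF
              h, of UNIV]] continuous_intros) auto
      qed (use Hb[OF that] in auto)
      have i2: "integrable (g s) (\<lambda>z. frechet_derivative h (at (s, z)) (1, drift (g s) z))"
        by (rule partial_rate_integrable[OF gP[OF that] h D(1) D(2)[OF that]
            bounded_linear_ident]) auto
      show ?thesis
        unfolding rate_def Dk u_def \<Lambda>_def using i1 i2 by simp
    qed
    have "set_integrable lborel {0..T} (\<lambda>s. rate k (g s) s)"
    proof -
      have "continuous_on {0..T} (\<lambda>s. rate k (g s) s)"
        by (rule continuous_on_eq[of _ "\<lambda>s. \<theta>' s * u s + \<theta> s * \<Lambda> s"])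
          (auto intro!: continuous_intros uc \<Lambda>c \<theta>c simp: rk)
      then show ?thesis
        unfolding set_integrable_def by (intro borel_integrable_compact) auto
    qed
    from set_borel_integral_eq_integral(2)[OF this] eqk
    have "integral {0..T} (\<lambda>s. rate k (g s) s) + (\<integral>z. k (0, z) \<partial>f0) = 0" by simp
    moreover have "integral {0..T} (\<lambda>s. rate k (g s) s)
        = integral {0..T} (\<lambda>s. \<theta>' s * u s + \<theta> s * \<Lambda> s)"
      by (rule integral_cong) (simp add: rk)
    ultimately have e1: "integral {0..T} (\<lambda>s. \<theta>' s * u s + \<theta> s * \<Lambda> s) + \<theta> 0 * u0 = 0"
      by (simp add: k_def u0_def)
    have "((\<lambda>s. \<theta>' s * W s + \<theta> s * \<Lambda> s) has_integral (\<theta> T * W T - \<theta> 0 * W 0)) {0..T}"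
    proof (rule fundamental_theorem_of_calculus)
      fix s assume s: "s \<in> {0..T}"
      from DERIV_mult[OF DERIV_subset[OF \<theta>(1)[of s] subset_UNIV] W'[OF s]]
      have "((\<lambda>s. \<theta> s * W s) has_real_derivative (\<theta>' s * W s + \<theta> s * \<Lambda> s)) (at s within {0..T})"
        by (simp add: mult.commute)
      then show "((\<lambda>s. \<theta> s * W s) has_vector_derivative \<theta>' s * W s + \<theta> s * \<Lambda> s)
          (at s within {0..T})"
        by (simp add: has_real_derivative_iff_has_vector_derivative)
    qed (use \<open>0 < T\<close> in simp)
    then have "integral {0..T} (\<lambda>s. \<theta>' s * W s + \<theta> s * \<Lambda> s) = - \<theta> 0 * u0"
      using \<theta>(3)[of T] \<theta>(4) by (simp add: integral_unique W_def)
    with e1 have "integral {0..T} (\<lambda>s. \<theta>' s * u s + \<theta> s * \<Lambda> s) - integral {0..T} (\<lambda>s. \<theta>' s * W s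
        + \<theta> s * \<Lambda> s) = 0"
      by simp
    moreover have "integral {0..T} (\<lambda>s. \<theta>' s * u s + \<theta> s * \<Lambda> s) - integral {0..T} (\<lambda>s. \<theta>' s * W s
        + \<theta> s * \<Lambda> s)
       = integral {0..T} (\<lambda>s. (\<theta>' s * u s + \<theta> s * \<Lambda> s) - (\<theta>' s * W s + \<theta> s * \<Lambda> s))"
      by (rule integral_diff[symmetric])
          (intro integrable_continuous_real continuous_intros uc \<Lambda>c \<theta>c Wc)+
    ultimately show ?thesis by (simp add: E_def algebra_simps)
  qed
  \<comment> \<open>A nonzero defect keeps its sign on a short interval ending at \<open>t0\<close>.
    A cutoff that decreases exactly there makes the integrand of \<open>zero\<close> one-signed, so
    this continuous integrand would have to vanish identically.\<close>
  have E0: "E t0 = 0" if "0 < t0" "t0 < T" for t0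
  proof (rule ccontr)
    assume ne: "E t0 \<noteq> 0"
    define \<sigma> where "\<sigma> = sgn (E t0)"
    have \<sigma>: "\<sigma> * E t0 > 0" using ne by (auto simp: \<sigma>_def sgn_if)
    have "continuous_on {0..T} (\<lambda>s. \<sigma> * E s)" by (intro continuous_intros Ec)
    then have "((\<lambda>s. \<sigma> * E s) \<longlongrightarrow> \<sigma> * E t0) (at t0 within {0..T})"
      using that by (simp add: continuous_on_def)
    from order_tendstoD(1)[OF this \<sigma>] obtain d where d: "d > 0"
      "\<And>s. s \<in> {0..T} \<Longrightarrow> s \<noteq> t0 \<Longrightarrow> dist s t0 < d \<Longrightarrow> 0 < \<sigma> * E s"
      unfolding eventually_at by blast
    define \<epsilon> where "\<epsilon> = min (d / 2) (t0 / 2)"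
    have \<epsilon>: "\<epsilon> > 0" "\<epsilon> < d" "\<epsilon> < t0" using d that by (auto simp: \<epsilon>_def)
    have pos: "\<sigma> * E s > 0" if "s \<in> {t0 - \<epsilon>..t0}" for s
    proof (cases "s = t0")
      case False
      then show ?thesis using d(2)[of s] that \<epsilon> \<open>t0 < T\<close> by (auto simp: dist_real_def)
    qed (use \<sigma> in simp)
    define \<theta> where "\<theta> s = smooth_step ((t0 - s) / \<epsilon>)" for s
    define \<theta>' where "\<theta>' s = smooth_step' ((t0 - s) / \<epsilon>) * (- 1 / \<epsilon>)" for s
    have "((\<lambda>s. (t0 - s) / \<epsilon>) has_real_derivative (- 1 / \<epsilon>)) (at s)" for s
      using \<epsilon> by (auto intro!: derivative_eq_intros)
    from DERIV_chain2[OF DERIV_smooth_step this]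
    have \<theta>1: "(\<theta> has_real_derivative \<theta>' s) (at s)" for s
      by (simp add: \<theta>_def[abs_def] \<theta>'_def)
    have "smooth (\<lambda>s. (1 / \<epsilon>) *\<^sub>R (t0 - s))"
      by (intro smooth_scaleR smooth_const smooth_diff smooth_ident)
    then have \<theta>2: "smooth \<theta>'" unfolding \<theta>'_def[abs_def]
      by (intro smooth_mult smooth_const smooth_compose[OF smooth_smooth_step']) simp
    have "integral {0..T} (\<lambda>s. \<theta>' s * E s) = 0"
      by (rule zero[OF \<theta>1 \<theta>2 _ \<open>t0 < T\<close>])
          (use \<epsilon> in \<open>auto simp: \<theta>_def intro!: smooth_step_eq_0 divide_nonpos_pos\<close>)
    moreover have "integral {0..T} (\<lambda>s. (- \<sigma>) * (\<theta>' s * E s))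
        = (- \<sigma>) * integral {0..T} (\<lambda>s. \<theta>' s * E s)"
      by (rule integral_mult_right)
    ultimately have i0: "integral {0..T} (\<lambda>s. (- \<sigma>) * (\<theta>' s * E s)) = 0" by simp
    have nn: "(- \<sigma>) * (\<theta>' s * E s) \<ge> 0" if "s \<in> {0..T}" for s
    proof (cases "s \<in> {t0 - \<epsilon>..t0}")
      case True
      have "(- \<sigma>) * (\<theta>' s * E s) = smooth_step' ((t0 - s) / \<epsilon>) * (\<sigma> * E s) / \<epsilon>"
        by (simp add: \<theta>'_def)
      also have "\<dots> \<ge> 0"
        by (rule divide_nonneg_pos[OF mult_nonneg_nonneg[OF smooth_step'_nonneg less_imp_le[OF
            pos[OF True]]] \<epsilon>(1)])
      finally show ?thesis .
    next
      case False
      then have "(t0 - s) / \<epsilon> \<le> 0 \<or> 1 \<le> (t0 - s) / \<epsilon>"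
        using \<epsilon>(1) by (auto simp: field_simps)
      then show ?thesis by (simp add: \<theta>'_def smooth_step'_eq_0)
    qed
    have "continuous_on {0..T} (\<lambda>s. (- \<sigma>) * (\<theta>' s * E s))"
      by (intro continuous_intros Ec smooth_continuous[OF \<theta>2])
    from integral_eq_0_iff[OF this _ nn] i0 \<open>0 < T\<close>
    have all0: "\<And>s. s \<in> {0..T} \<Longrightarrow> (- \<sigma>) * (\<theta>' s * E s) = 0" by auto
    \<comment> \<open>The midpoint of the layer corresponds to the argument \<open>1 / 2\<close>,
      where the slope of the step is strictly positive.\<close>
    have "smooth_step' (1 / 2) > 0"
      using step_density_pos[of "1/2"] step_density_integral_pos by (simp add: smooth_step'_def)
    moreover have "(t0 - (t0 - \<epsilon> / 2)) / \<epsilon> = 1 / 2" using \<epsilon>(1) by simp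
    ultimately have "(- \<sigma>) * (\<theta>' (t0 - \<epsilon> / 2) * E (t0 - \<epsilon> / 2)) \<noteq> 0"
      using pos[of "t0 - \<epsilon> / 2"] \<epsilon>(1) by (auto simp: \<theta>'_def)
    moreover have "t0 - \<epsilon> / 2 \<in> {0..T}" using \<epsilon> that by auto
    ultimately show False using all0 by blast
  qed
  \<comment> \<open>The endpoints 0 and \<open>T\<close>, out of reach of the cutoffs above, follow
    by continuity.\<close>
  have "E t = 0"
  proof (rule continuous_constant_on_closure[of "{0<..<T}" E 0 t])
    show "continuous_on (closure {0<..<T}) E" using Ec \<open>0 < T\<close> by simp
  qed (use E0 t \<open>0 < T\<close> in auto)
  then show "(\<integral>z. h (t, z) \<partial>g t) = (\<integral>z. h (0, z) \<partial>f0) + integral {0..t} (\<lambda>s. rate h (g s) s)"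
    by (simp add: E_def u_def W_def u0_def \<Lambda>_def)
qed

end

section \<open>Propagation of compact support\<close>

lemma (in prob_space) integral_abs_le_const:
  fixes F :: "'a \<Rightarrow> real"
  assumes "F \<in> borel_measurable M" "AE z in M. \<bar>F z\<bar> \<le> c"
  shows "\<bar>integral\<^sup>L M F\<bar> \<le> c"
proof -
  have int: "integrable M F"
    by (rule integrable_const_bound[of _ c]) (use assms in auto)
  have "\<bar>integral\<^sup>L M F\<bar> \<le> (\<integral>z. \<bar>F z\<bar> \<partial>M)" by (rule integral_abs_bound)
  also have "\<dots> \<le> (\<integral>z. c \<partial>M)" by (rule integral_mono_AE) (use int assms in auto)
  finally show ?thesis by (simp add: prob_space)
qed

lemma inner_self_ge_double:
  fixes z :: "'a::real_inner"
  assumes "2 * \<rho> \<le> norm z" "\<rho> > 0"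
  shows "2 * \<rho>\<^sup>2 \<le> z \<bullet> z"
proof -
  have "(2 * \<rho>)\<^sup>2 \<le> (norm z)\<^sup>2" by (rule power_mono) (use assms in auto)
  then have "4 * \<rho>\<^sup>2 \<le> z \<bullet> z" by (simp add: power2_norm_eq_inner power_mult_distrib)
  moreover have "\<rho>\<^sup>2 \<ge> 0" by simp
  ultimately show ?thesis by linarith
qed

context mean_field
begin

text \<open>The drift enters only through its measurability, so the derivative is expanded in the
  basis into products of measurable coefficients and continuous functions.\<close>

lemma rate_integrand_measurable:
  assumes "M \<in> P2" "smooth (h :: real \<times> 'a \<Rightarrow> real)"
  shows "(\<lambda>z. frechet_derivative h (at (t, z)) (1, drift M z)) \<in> borel_measurable borel"
proof -
  note [measurable] = drift_measurable[OF assms(1)]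
  have [measurable]: "(\<lambda>z. frechet_derivative h (at (t, z)) i) \<in> borel_measurable borel" for i
    by (intro borel_measurable_continuous_onI smooth_derivative_continuous[OF assms(2)]
        continuous_intros)
  have "(\<lambda>z. \<Sum>i\<in>Basis. (fst i + drift M z \<bullet> snd i) *\<^sub>R frechet_derivative h (at (t, z)) i)
      \<in> borel_measurable borel"
    by measurable
  then have "(\<lambda>z. \<Sum>i\<in>Basis. ((1, drift M z) \<bullet> i) *\<^sub>R frechet_derivative h (at (t, z)) i)
      \<in> borel_measurable borel"
    by (simp add: inner_prod_def)
  then show ?thesis
    by (simp only: linear_sum_Basis[OF has_derivative_linear[OF smoothD[OF assms(2)]], symmetric])
qed

lemma weak_sol_P2: "weak_sol T f0 g \<Longrightarrow> t \<in> {0..T} \<Longrightarrow> g t \<in> P2"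
  by (auto simp: weak_sol_def P2_continuous_on_def)

lemma weak_sol_first_moment:
  assumes g: "weak_sol T f0 g" and "0 \<le> T"
  obtains m where "m \<ge> 0" "\<And>t. t \<in> {0..T} \<Longrightarrow> (\<integral>z. norm z \<partial>g t) \<le> m"
proof -
  have "continuous_on {0..T} (\<lambda>t. \<integral>z. (\<lambda>(t, z). norm z) (t, z) \<partial>g t)"
    by (rule P2_continuous_integral_interval[of T g _ 1])
      (use assms in \<open>auto simp: weak_sol_def split_beta intro!: continuous_intros\<close>)
  from compact_imp_bounded[OF compact_continuous_image[OF this compact_Icc]]
  obtain m where m: "\<forall>t\<in>{0..T}. \<bar>\<integral>z. norm z \<partial>g t\<bar> \<le> m" unfolding bounded_iff by auto
  have "(\<integral>z. norm z \<partial>g t) \<le> max m 0" if "t \<in> {0..T}" for t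
    using m that by fastforce
  then show thesis using that[of "max m 0"] by simp
qed

text \<open>Linear growth of the drift makes \<open>(1 + |z|^2) exp (- K t)\<close> decrease along the flow, so a test
  function increasing in this quantity detects mass that escapes from the initial ball.\<close>

lemma weak_sol_support:
  assumes g: "weak_sol T f0 g" and T: "0 < T" and f0: "AE z in f0. norm z \<le> R0"
  obtains R where "R \<ge> 0" "\<And>t. t \<in> {0..T} \<Longrightarrow> AE z in g t. norm z \<le> R"
proof -
  obtain m where m: "m \<ge> 0" "\<And>t. t \<in> {0..T} \<Longrightarrow> (\<integral>z. norm z \<partial>g t) \<le> m"
    using weak_sol_first_moment[OF g less_imp_le[OF T]] by blast
  define C1 where "C1 = C * (1 + m)"
  have C1: "C1 \<ge> 0" using C_nonneg m by (simp add: C1_def)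
  have dg: "norm (drift (g t) z) \<le> C1 * (1 + norm z)" if "t \<in> {0..T}" for t z
  proof -
    have "norm (drift (g t) z) \<le> C * (1 + norm z + (\<integral>w. norm w \<partial>g t))"
      by (rule drift_growth[OF weak_sol_P2[OF g that]])
    also have "\<dots> \<le> C * ((1 + m) * (1 + norm z))"
      using m(2)[OF that] mult_nonneg_nonneg[OF m(1) norm_ge_zero[of z]]
      by (intro mult_left_mono C_nonneg) (simp add: algebra_simps)
    finally show ?thesis by (simp add: C1_def mult.assoc)
  qed
  \<comment> \<open>One factor 2 stems from differentiating the square of the norm, the other from
    \<open>norm z + (norm z)^2 \<le> 2 * (1 + (norm z)^2)\<close>.\<close>
  define K where "K = 4 * C1"
  have K: "K \<ge> 0" using C1 by (simp add: K_def)
  have zb: "2 * (z \<bullet> drift (g t) z) \<le> K * (1 + z \<bullet> z)" if "t \<in> {0..T}" for t z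
  proof -
    have "z \<bullet> drift (g t) z \<le> norm z * (C1 * (1 + norm z))"
      by (rule order_trans[OF norm_cauchy_schwarz]) (intro mult_left_mono dg that, simp)
    also have "\<dots> = C1 * (norm z + (norm z)\<^sup>2)" by (simp add: power2_eq_square algebra_simps)
    also have "\<dots> \<le> C1 * (2 * (1 + (norm z)\<^sup>2))"
    proof (rule mult_left_mono[OF _ C1])
      have "2 * norm z \<le> (norm z)\<^sup>2 + 1" using sum_squares_bound[of "norm z" 1] by simp
      moreover have "(norm z)\<^sup>2 \<ge> 0" by simp
      ultimately show "norm z + (norm z)\<^sup>2 \<le> 2 * (1 + (norm z)\<^sup>2)" using norm_ge_zero[of z] by argo
    qed
    finally show ?thesis by (simp add: K_def power2_norm_eq_inner algebra_simps)
  qed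
  obtain \<omega> where \<omega>: "\<omega> \<ge> 0" "\<And>x. smooth_step' x \<le> \<omega>" using smooth_step'_bounded by blast
  \<comment> \<open>\<open>a\<close> gives the spatial cutoff: at least 1 on the ball of radius
    \<open>\<rho>\<close>, at most 0 outside radius \<open>2 * \<rho>\<close>. \<open>b\<close> is
    positive exactly where the decreasing quantity exceeds its largest value on the initial ball, so
    \<open>h \<rho>\<close> starts with integral 0.\<close>
  define s0 where "s0 = 1 + R0\<^sup>2"
  define a where "a \<rho> x = 2 - (snd x \<bullet> snd x) / \<rho>\<^sup>2" for \<rho> and x :: "real \<times> 'a"
  define b where "b x = (1 + snd x \<bullet> snd x) * exp (- K * fst x) - s0" for x :: "real \<times> 'a"
  define h where "h \<rho> x = smooth_step (a \<rho> x) * smooth_step (b x)" for \<rho> x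
  have sa: "smooth (a \<rho>)" for \<rho>
    unfolding a_def[abs_def] divide_inverse
    by (intro smooth_diff smooth_mult smooth_inner smooth_const smooth_snd smooth_ident)
  have sb: "smooth b"
    unfolding b_def[abs_def]
    by (intro smooth_diff smooth_mult smooth_add smooth_inner smooth_const smooth_snd smooth_fst
        smooth_ident
        smooth_compose[OF smooth_exp])
  have sh: "smooth (h \<rho>)" for \<rho>
    unfolding h_def[abs_def]
    by (intro smooth_mult smooth_compose[OF smooth_smooth_step] sa sb)
  have Dh: "frechet_derivative (h \<rho>) (at (t, z)) (1, d) =
      smooth_step (a \<rho> (t, z)) * (smooth_step' (b (t, z)) * ((2 * (z \<bullet> d) - K * (1 + z \<bullet> z)) * exp
          (- K * t)))
      + smooth_step' (a \<rho> (t, z)) * (- 2 * (z \<bullet> d) / \<rho>\<^sup>2) * smooth_step (b (t, z))" for \<rho> t z d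
  proof -
    have 1: "(a \<rho> has_derivative (\<lambda>u. - 2 * (z \<bullet> snd u) / \<rho>\<^sup>2)) (at (t, z))"
      unfolding a_def[abs_def] divide_inverse
      by (auto intro!: derivative_eq_intros simp: inner_commute algebra_simps)
    have 2: "(b has_derivative (\<lambda>u. (2 * (z \<bullet> snd u) - K * (1 + z \<bullet> z) * fst u) * exp (- K * t)))
        (at (t, z))"
      unfolding b_def[abs_def]
      by (auto intro!: derivative_eq_intros simp: inner_commute algebra_simps)
    have "(h \<rho> has_derivative (\<lambda>u. smooth_step (a \<rho> (t, z)) * ((2 * (z \<bullet> snd u) - K * (1
        + z \<bullet> z) * fst u) * exp (- K * t) * smooth_step' (b (t, z)))
        + (- 2 * (z \<bullet> snd u) / \<rho>\<^sup>2) * smooth_step' (a \<rho> (t, z)) * smooth_step (b (t, z)))) (at (t,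
            z))"
      unfolding h_def[abs_def]
      by (rule has_derivative_mult[OF DERIV_compose_FDERIV[OF DERIV_smooth_step 1]
          DERIV_compose_FDERIV[OF DERIV_smooth_step 2]])
    from frechet_derivative_at[OF this, symmetric] show ?thesis
      by (simp add: mult_ac)
  qed
  have supp: "h \<rho> (t, z) = 0" if "2 * \<rho> \<le> norm z" "\<rho> > 0" for \<rho> t z
  proof -
    have "a \<rho> (t, z) \<le> 0" using inner_self_ge_double[OF that] that by (simp add: a_def field_simps)
    then show ?thesis by (simp add: h_def smooth_step_eq_0)
  qed
  \<comment> \<open>The derivative of \<open>b\<close> contributes with a favourable sign. In the
    cutoff term, \<open>norm z \<le> 2 * \<rho>\<close> against the square of \<open>\<rho>\<close>
    leaves \<open>1 / \<rho>\<close>, and the linear growth of the drift is paid by the first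
    moment.\<close>
  have rate_le: "rate (h \<rho>) (g t) t \<le> 4 * \<omega> * C1 * (1 + m) / \<rho>" if t: "t \<in> {0..T}" and \<rho>: "\<rho> > 0"
      for \<rho> t
  proof -
    note gP = weak_sol_P2[OF g t]
    interpret prob_space "g t" by (rule P2D[OF gP])
    have int: "integrable (g t) (norm :: 'a \<Rightarrow> real)"
      by (rule P2_integrable[OF gP, where C = 1]) auto
    have ptw: "frechet_derivative (h \<rho>) (at (t, z)) (1, drift (g t) z)
        \<le> 4 * \<omega> * C1 * (1 + norm z) / \<rho>" for z
    proof -
      let ?d = "drift (g t) z"
      have "smooth_step (a \<rho> (t, z)) * (smooth_step' (b (t, z)) * ((2 * (z \<bullet> ?d) - K * (1
          + z \<bullet> z)) * exp (- K * t))) \<le> 0"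
        using zb[OF t, of z]
        by (intro mult_nonneg_nonpos smooth_step_bounds smooth_step'_nonneg mult_nonpos_nonneg) auto
      moreover have "smooth_step' (a \<rho> (t, z)) * (- 2 * (z \<bullet> ?d) / \<rho>\<^sup>2) * smooth_step (b (t, z))
          \<le> 4 * \<omega> * C1 * (1 + norm z) / \<rho>"
      proof (cases "norm z \<le> 2 * \<rho>")
        case True
        have "- 2 * (z \<bullet> ?d) / \<rho>\<^sup>2 \<le> 2 * (2 * \<rho> * (C1 * (1 + norm z))) / \<rho>\<^sup>2"
        proof (rule divide_right_mono)
          have "- (z \<bullet> ?d) \<le> norm z * norm ?d"
            using norm_cauchy_schwarz[of "- z" ?d] by simp
          also have "\<dots> \<le> 2 * \<rho> * (C1 * (1 + norm z))"
            by (rule mult_mono[OF True dg[OF t]]) (use \<rho> in auto)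
          finally have "2 * (- (z \<bullet> ?d)) \<le> 2 * (2 * \<rho> * (C1 * (1 + norm z)))"
            by (rule mult_left_mono) (rule zero_le_numeral)
          then show "- 2 * (z \<bullet> ?d) \<le> 2 * (2 * \<rho> * (C1 * (1 + norm z)))"
            by (simp only: mult_minus_left mult_minus_right)
        qed simp
        also have "\<dots> = 4 * C1 * (1 + norm z) / \<rho>" using \<rho> by (simp add: power2_eq_square)
        finally have le: "- 2 * (z \<bullet> ?d) / \<rho>\<^sup>2 \<le> 4 * C1 * (1 + norm z) / \<rho>" .
        have nn: "4 * C1 * (1 + norm z) / \<rho> \<ge> 0" using C1 \<rho> by simp
        have "smooth_step' (a \<rho> (t, z)) * (- 2 * (z \<bullet> ?d) / \<rho>\<^sup>2) * smooth_step (b (t, z))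
            \<le> smooth_step' (a \<rho> (t, z)) * (4 * C1 * (1 + norm z) / \<rho>) * smooth_step (b (t, z))"
          by (intro mult_right_mono mult_left_mono le smooth_step'_nonneg smooth_step_bounds)
        also have "\<dots> \<le> \<omega> * (4 * C1 * (1 + norm z) / \<rho>) * 1"
          by (intro mult_mono \<omega> nn smooth_step_bounds mult_nonneg_nonneg smooth_step'_nonneg
              order_refl)
        finally show ?thesis by (simp add: mult_ac)
      next
        case False
        then have "2 * \<rho>\<^sup>2 \<le> z \<bullet> z" by (intro inner_self_ge_double \<rho>) simp
        then have "a \<rho> (t, z) \<le> 0" using \<rho> by (simp add: a_def field_simps)
        then show ?thesis using \<omega>(1) C1 \<rho> by (simp add: smooth_step'_eq_0)
      qed
      ultimately show ?thesis unfolding Dh by linarith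
    qed
    have "rate (h \<rho>) (g t) t \<le> (\<integral>z. 4 * \<omega> * C1 * (1 + norm z) / \<rho> \<partial>g t)"
      unfolding rate_def
      by (rule integral_mono') (use int ptw \<omega>(1) C1 \<rho> in auto)
    also have "\<dots> = 4 * \<omega> * C1 * (1 + (\<integral>z. norm z \<partial>g t)) / \<rho>"
      using int by (simp add: prob_space)
    also have "\<dots> \<le> 4 * \<omega> * C1 * (1 + m) / \<rho>"
      using m(2)[OF t] \<omega>(1) C1 \<rho> by (intro divide_right_mono mult_left_mono) auto
    finally show ?thesis .
  qed
  have u_le: "(\<integral>z. h \<rho> (t, z) \<partial>g t) \<le> 4 * \<omega> * C1 * (1 + m) * T / \<rho>" if t: "t \<in> {0..T}"
      and \<rho>: "\<rho> > 0" for \<rho> t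
  proof -
    have eq: "(\<integral>z. h \<rho> (t, z) \<partial>g t) = (\<integral>z. h \<rho> (0, z) \<partial>f0)
        + integral {0..t} (\<lambda>s. rate (h \<rho>) (g s) s)"
      "continuous_on {0..T} (\<lambda>s. rate (h \<rho>) (g s) s)"
      by (rule weak_sol_pointwise_compact[OF g T sh _ t, of "2 * \<rho>"]; rule supp[OF _ \<rho>];
          assumption)+
    have int: "(\<lambda>s. rate (h \<rho>) (g s) s) integrable_on {0..t}"
      by (rule integrable_continuous_real[OF continuous_on_subset[OF eq(2)]]) (use t in auto)
    have "(\<integral>z. h \<rho> (0, z) \<partial>f0) = 0"
    proof (rule integral_eq_zero_AE)
      show "AE z in f0. h \<rho> (0, z) = 0"
        using f0
      proof eventually_elim
        case (elim z)
        then have "(norm z)\<^sup>2 \<le> R0\<^sup>2" by (intro power_mono) auto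
        then have "b (0, z) \<le> 0" by (simp add: b_def s0_def power2_norm_eq_inner)
        then show ?case by (simp add: h_def smooth_step_eq_0)
      qed
    qed
    with eq(1) have "(\<integral>z. h \<rho> (t, z) \<partial>g t) = integral {0..t} (\<lambda>s. rate (h \<rho>) (g s) s)" by simp
    also have "\<dots> \<le> integral {0..t} (\<lambda>s. 4 * \<omega> * C1 * (1 + m) / \<rho>)"
      by (rule integral_le[OF int]) (use t rate_le \<rho> in auto)
    also have "\<dots> = 4 * \<omega> * C1 * (1 + m) / \<rho> * t" using t by simp
    also have "\<dots> \<le> 4 * \<omega> * C1 * (1 + m) / \<rho> * T"
      using t \<omega>(1) C1 m \<rho> by (intro mult_left_mono) auto
    finally show ?thesis by simp
  qed
  have ae: "AE z in g t. b (t, z) \<le> 0" if t: "t \<in> {0..T}" for t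
  proof -
    note gP = weak_sol_P2[OF g t]
    interpret prob_space "g t" by (rule P2D[OF gP])
    note [measurable_cong] = P2D(2)[OF gP]
    have [measurable]: "(\<lambda>z. smooth_step (b (t, z))) \<in> borel_measurable borel" "(\<lambda>z. h \<rho> (t, z))
        \<in> borel_measurable borel" for \<rho>
      by (intro borel_measurable_continuous_onI continuous_on_compose2[OF smooth_continuous[OF
          smooth_smooth_step, of UNIV]]
        continuous_on_compose2[OF smooth_continuous[OF sb, of UNIV]]
            continuous_on_compose2[OF smooth_continuous[OF sh, of UNIV]] continuous_intros, auto)+
    \<comment> \<open>For a fixed ball of radius \<open>n\<close> the cutoff is 1 as soon as
      \<open>\<rho> > n\<close>, so \<open>\<rho>\<close> can be sent to infinity with
      \<open>n\<close> kept. Afterwards the countably many balls are combined.\<close>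
    have "AE z in g t. indicator (cball 0 (real n)) z * smooth_step (b (t, z)) = 0" for n
    proof -
      let ?q = "\<lambda>z. indicator (cball 0 (real n)) z * smooth_step (b (t, z))"
      have qint: "integrable (g t) ?q"
        by (rule integrable_const_bound[of _ 1])
          (auto simp: indicator_def smooth_step_bounds abs_of_nonneg)
      have hint: "integrable (g t) (\<lambda>z. h \<rho> (t, z))" for \<rho>
      proof (rule integrable_const_bound[of _ 1])
        show "AE z in g t. norm (h \<rho> (t, z)) \<le> 1"
          by (auto simp: h_def abs_mult smooth_step_bounds abs_of_nonneg intro!: mult_le_one)
      qed measurable
      have qle: "integral\<^sup>L (g t) ?q \<le> 4 * \<omega> * C1 * (1 + m) * T / \<rho>" if \<rho>: "\<rho> > real n" for \<rho>
      proof -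
        have "integral\<^sup>L (g t) ?q \<le> (\<integral>z. h \<rho> (t, z) \<partial>g t)"
        proof (rule integral_mono[OF qint hint])
          fix z
          show "?q z \<le> h \<rho> (t, z)"
          proof (cases "norm z \<le> real n")
            case True
            then have "(norm z)\<^sup>2 \<le> \<rho>\<^sup>2" using \<rho> by (intro power_mono) auto
            moreover have "\<rho> > 0" using \<rho> by linarith
            ultimately have "1 \<le> a \<rho> (t, z)" by (simp add: a_def power2_norm_eq_inner)
            then show ?thesis using True by (simp add: h_def smooth_step_eq_1)
          next
            case False
            then show ?thesis by (simp add: h_def smooth_step_bounds)
          qed
        qed
        also have "\<dots> \<le> 4 * \<omega> * C1 * (1 + m) * T / \<rho>" by (rule u_le[OF t]) (use \<rho> in linarith)
        finally show ?thesis .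
      qed
      have "((\<lambda>\<rho>. 4 * \<omega> * C1 * (1 + m) * T / \<rho>) \<longlongrightarrow> 0) at_top"
        by (rule tendsto_divide_0[OF tendsto_const])
            (simp add: filterlim_at_top_imp_at_infinity filterlim_ident)
      moreover have "\<forall>\<^sub>F \<rho> in at_top. integral\<^sup>L (g t) ?q \<le> 4 * \<omega> * C1 * (1 + m) * T / \<rho>"
        using eventually_gt_at_top[of "real n"] by eventually_elim (rule qle)
      ultimately have "integral\<^sup>L (g t) ?q \<le> 0"
        by (rule tendsto_lowerbound) simp
      then show ?thesis
        using integral_nonneg_eq_0_iff_AE[OF qint] smooth_step_bounds
        by (metis (no_types, lifting) AE_I2 antisym integral_nonneg_AE mult_nonneg_nonneg
            indicator_pos_le)
    qed
    then have "AE z in g t. \<forall>n::nat. indicator (cball 0 (real n)) z * smooth_step (b (t, z)) = 0"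
      by (subst AE_all_countable) blast
    then show ?thesis
    proof eventually_elim
      case (elim z)
      obtain n :: nat where "norm z \<le> real n" using real_arch_simple by blast
      then have "smooth_step (b (t, z)) = 0" using elim[rule_format, of n] by simp
      then show ?case using smooth_step_pos[of "b (t, z)"] by (cases "b (t, z) \<le> 0") auto
    qed
  qed
  define R where "R = sqrt (s0 * exp (K * T))"
  have "AE z in g t. norm z \<le> R" if t: "t \<in> {0..T}" for t
    using ae[OF t]
  proof eventually_elim
    case (elim z)
    then have "(1 + z \<bullet> z) * exp (- K * t) \<le> s0" by (simp add: b_def)
    then have "1 + z \<bullet> z \<le> s0 * exp (K * t)"
      by (simp add: exp_minus divide_inverse[symmetric] divide_le_eq)
    also have "\<dots> \<le> s0 * exp (K * T)"
      using K t by (intro mult_left_mono) (auto simp: s0_def intro: mult_left_mono)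
    finally have "(norm z)\<^sup>2 \<le> s0 * exp (K * T)" by (simp add: power2_norm_eq_inner)
    then show ?case by (simp add: R_def real_le_rsqrt)
  qed
  moreover have "R \<ge> 0" by (simp add: R_def s0_def)
  ultimately show thesis using that by blast
qed

text \<open>Once all measures live in a fixed ball, multiplying \<open>h\<close> by a cutoff that
  equals 1 on it affects neither the integrals nor the rates, so arbitrary smooth functions become
  admissible.\<close>

lemma weak_sol_pointwise:
  assumes g: "weak_sol T f0 g" and T: "0 < T" and h: "smooth h"
    and f0: "AE z in f0. norm z \<le> R" "sets f0 = sets borel"
    and gR: "\<And>t. t \<in> {0..T} \<Longrightarrow> AE z in g t. norm z \<le> R" and t: "t \<in> {0..T}"
  shows "(\<integral>z. h (t, z) \<partial>g t) = (\<integral>z. h (0, z) \<partial>f0) + integral {0..t} (\<lambda>s. rate h (g s) s)"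
    "continuous_on {0..T} (\<lambda>s. rate h (g s) s)"
proof -
  define \<rho> where "\<rho> = \<bar>R\<bar> + 1"
  have \<rho>: "\<rho> > 0" "R \<le> \<rho>" by (auto simp: \<rho>_def)
  define a where "a x = 2 - (snd x \<bullet> snd x) / \<rho>\<^sup>2" for x :: "real \<times> 'a"
  define k where "k x = smooth_step (a x) * h x" for x
  have sa: "smooth a"
    unfolding a_def[abs_def] divide_inverse
    by (intro smooth_diff smooth_mult smooth_inner smooth_const smooth_snd smooth_ident)
  have sk: "smooth k"
    unfolding k_def[abs_def] by (intro smooth_mult smooth_compose[OF smooth_smooth_step] sa h)
  have supp: "k (t, z) = 0" if "2 * \<rho> \<le> norm z" for t z
  proof -
    have "2 * \<rho>\<^sup>2 \<le> z \<bullet> z" by (rule inner_self_ge_double[OF that \<rho>(1)])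
    then have "a (t, z) \<le> 0" using \<rho> by (simp add: a_def field_simps)
    then show ?thesis by (simp add: k_def smooth_step_eq_0)
  qed
  have inside: "1 \<le> a (t, z)" if "norm z \<le> R" for t z
  proof -
    have "(norm z)\<^sup>2 \<le> \<rho>\<^sup>2" using that \<rho> by (intro power_mono) auto
    then show ?thesis using \<rho> by (simp add: a_def power2_norm_eq_inner)
  qed
  have kh: "k (t, z) = h (t, z)" if "norm z \<le> R" for t z
    using inside[OF that] by (simp add: k_def smooth_step_eq_1)
  \<comment> \<open>Where \<open>1 \<le> a\<close> holds, the step has value 1 and slope 0, so the
    product rule leaves only the derivative of \<open>h\<close>.\<close>
  have Dk: "frechet_derivative k (at (t, z)) u = frechet_derivative h (at (t, z)) u"
      if "norm z \<le> R" for t z u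
  proof -
    have "(k has_derivative (\<lambda>u. smooth_step (a (t, z)) * frechet_derivative h (at (t, z)) u
        + frechet_derivative a (at (t, z)) u * smooth_step' (a (t, z)) * h (t, z))) (at (t, z))"
      unfolding k_def[abs_def]
      by (rule has_derivative_mult[OF DERIV_compose_FDERIV[OF DERIV_smooth_step smoothD[OF sa]]
          smoothD[OF h]])
    from frechet_derivative_at[OF this, symmetric] show ?thesis
      using inside[OF that] by (simp add: smooth_step_eq_1 smooth_step'_eq_0)
  qed
  have meas: "(\<lambda>z. q (s, z)) \<in> borel_measurable borel" if "smooth q" for q :: "real \<times> 'a \<Rightarrow> real"
      and s
    by (intro borel_measurable_continuous_onI continuous_on_compose2[OF smooth_continuous[OF that,
        of UNIV]] continuous_intros) auto
  have r: "rate k (g s) s = rate h (g s) s" if s: "s \<in> {0..T}" for s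
  proof -
    note gP = weak_sol_P2[OF g s]
    show ?thesis
      unfolding rate_def
    proof (rule integral_cong_AE)
      show "AE z in g s. frechet_derivative k (at (s, z)) (1, drift (g s) z)
          = frechet_derivative h (at (s, z)) (1, drift (g s) z)"
        using gR[OF s] by eventually_elim (simp add: Dk)
    qed (use rate_integrand_measurable[OF gP sk] rate_integrand_measurable[OF gP h] in
          \<open>simp_all add: measurable_cong_sets[OF P2D(2)[OF gP] refl]\<close>)
  qed
  have eq: "(\<integral>z. k (t, z) \<partial>g t) = (\<integral>z. k (0, z) \<partial>f0) + integral {0..t} (\<lambda>s. rate k (g s) s)"
    "continuous_on {0..T} (\<lambda>s. rate k (g s) s)"
    by (rule weak_sol_pointwise_compact[OF g T sk _ t, of "2 * \<rho>"]; rule supp; assumption)+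
  show "continuous_on {0..T} (\<lambda>s. rate h (g s) s)"
    by (rule continuous_on_eq[OF eq(2)]) (rule r)
  have 1: "(\<integral>z. k (t, z) \<partial>g t) = (\<integral>z. h (t, z) \<partial>g t)"
    by (rule integral_cong_AE) (use gR[OF t] meas[OF sk] meas[OF h] in
       \<open>auto simp: kh measurable_cong_sets[OF P2D(2)[OF weak_sol_P2[OF g t]] refl] elim!:
           eventually_mono\<close>)
  have 2: "(\<integral>z. k (0, z) \<partial>f0) = (\<integral>z. h (0, z) \<partial>f0)"
    by (rule integral_cong_AE) (use f0 meas[OF sk] meas[OF h] in
       \<open>auto simp: kh measurable_cong_sets[OF f0(2) refl] elim!: eventually_mono\<close>)
  have 3: "integral {0..t} (\<lambda>s. rate k (g s) s) = integral {0..t} (\<lambda>s. rate h (g s) s)"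
    by (rule integral_cong) (use t in \<open>simp add: r\<close>)
  show "(\<integral>z. h (t, z) \<partial>g t) = (\<integral>z. h (0, z) \<partial>f0) + integral {0..t} (\<lambda>s. rate h (g s) s)"
    using eq(1) by (simp add: 1 2 3)
qed

text \<open>This is the form in which the equation enters all uniqueness estimates: the transport
  derivative of the test function has to be small only on the ball that carries the
  measures.\<close>

lemma weak_sol_increment:
  assumes g: "weak_sol T f0 g" and T: "0 < T" and h: "smooth h"
    and f0: "AE z in f0. norm z \<le> R" "sets f0 = sets borel"
    and gR: "\<And>t. t \<in> {0..T} \<Longrightarrow> AE z in g t. norm z \<le> R" and st: "0 \<le> s" "s \<le> t" "t \<le> T"
    and bound: "\<And>r z. s \<le> r \<Longrightarrow> r \<le> t \<Longrightarrow> norm z \<le> R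
        \<Longrightarrow> \<bar>frechet_derivative h (at (r, z)) (1, drift (g r) z)\<bar> \<le> c"
  shows "\<bar>(\<integral>z. h (t, z) \<partial>g t) - (\<integral>z. h (s, z) \<partial>g s)\<bar> \<le> c * (t - s)"
proof -
  have tT: "t \<in> {0..T}" and sT: "s \<in> {0..T}" using st by auto
  note et = weak_sol_pointwise[OF g T h f0 gR tT] and es = weak_sol_pointwise[OF g T h f0 gR sT]
  have "integral {0..s} (\<lambda>r. rate h (g r) r) + integral {s..t} (\<lambda>r. rate h (g r) r)
      = integral {0..t} (\<lambda>r. rate h (g r) r)"
    by (rule Henstock_Kurzweil_Integration.integral_combine)
      (use st et(2) in \<open>auto intro!: integrable_continuous_real intro: continuous_on_subset\<close>)
  then have "(\<integral>z. h (t, z) \<partial>g t) - (\<integral>z. h (s, z) \<partial>g s) = integral {s..t} (\<lambda>r. rate h (g r) r)"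
    using et(1) es(1) by linarith
  moreover have "norm (integral {s..t} (\<lambda>r. rate h (g r) r)) \<le> c * (t - s)"
  proof (rule integral_bound)
    show "continuous_on {s..t} (\<lambda>r. rate h (g r) r)"
      using et(2) by (rule continuous_on_subset) (use st in auto)
    fix r assume r: "r \<in> {s..t}"
    then have rT: "r \<in> {0..T}" using st by auto
    note gP = weak_sol_P2[OF g rT]
    interpret prob_space "g r" by (rule P2D[OF gP])
    show "norm (rate h (g r) r) \<le> c"
      unfolding rate_def real_norm_def
    proof (rule integral_abs_le_const)
      show "(\<lambda>z. frechet_derivative h (at (r, z)) (1, drift (g r) z)) \<in> borel_measurable (g r)"
        using rate_integrand_measurable[OF gP h]
            by (simp add: measurable_cong_sets[OF P2D(2)[OF gP] refl])
      show "AE z in g r. \<bar>frechet_derivative h (at (r, z)) (1, drift (g r) z)\<bar> \<le> c"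
        using gR[OF rT] by eventually_elim (use bound r in auto)
    qed
  qed (use st in simp)
  ultimately show ?thesis by simp
qed

end


section \<open>Uniqueness\<close>

text \<open>A bound \<open>A\<close> for the Kantorovich-Rubinstein (dual 1-Wasserstein) distance.
  Only smooth functions are tested because only these can be inserted into the weak formulation; a
  predicate avoids forming the supremum.\<close>

definition lip_close :: "'a::euclidean_space measure \<Rightarrow> 'a measure \<Rightarrow> real \<Rightarrow> bool" where
  "lip_close M N A \<longleftrightarrow> (\<forall>\<phi> \<Lambda>. smooth \<phi> \<longrightarrow> (\<forall>x y. \<bar>\<phi> x - \<phi> y\<bar> \<le> \<Lambda> * norm (x - y)) \<longrightarrow>
     \<bar>(\<integral>z. \<phi> z \<partial>M) - (\<integral>z. \<phi> z \<partial>N)\<bar> \<le> \<Lambda> * A)"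

lemma lipschitz_constant_nonneg:
  fixes \<phi> :: "'a::euclidean_space \<Rightarrow> 'b::real_normed_vector"
  assumes "\<And>x y. norm (\<phi> x - \<phi> y) \<le> \<Lambda> * norm (x - y)"
  shows "\<Lambda> \<ge> 0"
proof -
  obtain i :: 'a where "i \<in> Basis" using nonempty_Basis by blast
  then show ?thesis using order_trans[OF norm_ge_zero assms[of i 0]] by simp
qed

lemma lip_close_mono:
  assumes "lip_close M N A" "A \<le> A'"
  shows "lip_close M N A'"
  unfolding lip_close_def
proof (intro allI impI)
  fix \<phi> :: "'a \<Rightarrow> real" and \<Lambda>
  assume \<phi>: "smooth \<phi>" "\<forall>x y. \<bar>\<phi> x - \<phi> y\<bar> \<le> \<Lambda> * norm (x - y)"
  then have "\<Lambda> \<ge> 0" by (intro lipschitz_constant_nonneg[of \<phi>]) simp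
  then show "\<bar>(\<integral>z. \<phi> z \<partial>M) - (\<integral>z. \<phi> z \<partial>N)\<bar> \<le> \<Lambda> * A'"
    using assms \<phi> mult_left_mono[OF assms(2)] unfolding lip_close_def by (meson order_trans)
qed

lemma lip_close_sym: "lip_close M N A \<Longrightarrow> lip_close N M A"
  by (simp add: lip_close_def abs_minus_commute)

lemma lipschitz_continuous:
  fixes \<phi> :: "'a::euclidean_space \<Rightarrow> 'b::real_normed_vector"
  assumes "\<And>x y. norm (\<phi> x - \<phi> y) \<le> \<Lambda> * norm (x - y)"
  shows "continuous_on S \<phi>"
  by (rule lipschitz_on_continuous_on[of \<Lambda>])
    (use assms lipschitz_constant_nonneg[of \<phi>] in \<open>auto simp: lipschitz_on_def dist_norm\<close>)

lemma P2_lipschitz_integrable: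
  fixes \<phi> :: "'a::euclidean_space \<Rightarrow> 'b::euclidean_space"
  assumes M: "M \<in> P2" and \<phi>: "\<And>x y. norm (\<phi> x - \<phi> y) \<le> \<Lambda> * norm (x - y)"
  shows "integrable M \<phi>"
proof (rule P2_integrable[OF M])
  have "continuous_on UNIV \<phi>" by (rule lipschitz_continuous[OF \<phi>])
  then show "\<phi> \<in> borel_measurable borel" by (rule borel_measurable_continuous_onI)
  show "norm (\<phi> z) \<le> (norm (\<phi> 0) + \<Lambda>) * (1 + norm z)" for z
  proof -
    have "norm (\<phi> z) \<le> norm (\<phi> 0) + \<Lambda> * norm z"
      using \<phi>[of z 0] norm_triangle_ineq2[of "\<phi> z" "\<phi> 0"] by simp
    also have "\<dots> \<le> (norm (\<phi> 0) + \<Lambda>) * (1 + norm z)"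
      using lipschitz_constant_nonneg[OF \<phi>] by (simp add: algebra_simps)
    finally show ?thesis .
  qed
qed

lemma lip_close_lipschitz:
  fixes \<phi> :: "'a::euclidean_space \<Rightarrow> real"
  assumes M: "M \<in> P2" and N: "N \<in> P2" and close: "lip_close M N A"
    and \<phi>: "\<And>x y. \<bar>\<phi> x - \<phi> y\<bar> \<le> \<Lambda> * norm (x - y)"
  shows "\<bar>(\<integral>z. \<phi> z \<partial>M) - (\<integral>z. \<phi> z \<partial>N)\<bar> \<le> \<Lambda> * A"
proof (rule field_le_epsilon)
  fix e :: real assume "e > 0"
  have \<phi>': "norm (\<phi> x - \<phi> y) \<le> \<Lambda> * norm (x - y)" for x y using \<phi>[of x y] by simp
  obtain G where G: "smooth G" "\<And>x y. norm (G x - G y) \<le> \<Lambda> * norm (x - y)" "\<And>x. norm (G x - \<phi> x)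
      \<le> e / 2"
    using smooth_lipschitz_approx[of \<phi> \<Lambda> "e / 2"] \<phi>' \<open>e > 0\<close> by auto
  have near: "\<bar>(\<integral>z. \<phi> z \<partial>P) - (\<integral>z. G z \<partial>P)\<bar> \<le> e / 2" if P: "P \<in> P2" for P
  proof -
    interpret prob_space P by (rule P2D[OF P])
    note i = P2_lipschitz_integrable[OF P \<phi>'] P2_lipschitz_integrable[OF P G(2)]
    have "\<bar>\<integral>z. \<phi> z - G z \<partial>P\<bar> \<le> e / 2"
      by (rule integral_abs_le_const)
        (use G(3) i in \<open>auto simp: abs_minus_commute intro: borel_measurable_integrable\<close>)
    then show ?thesis using i by simp
  qed
  have "\<bar>(\<integral>z. G z \<partial>M) - (\<integral>z. G z \<partial>N)\<bar> \<le> \<Lambda> * A"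
    using close G(1,2) unfolding lip_close_def by auto
  with near[OF M] near[OF N] show "\<bar>(\<integral>z. \<phi> z \<partial>M) - (\<integral>z. \<phi> z \<partial>N)\<bar> \<le> \<Lambda> * A + e"
    by linarith
qed

text \<open>The indicator of an open set is the pointwise limit of the Lipschitz functions
  \<open>min 1 (n * infdist z (- U))\<close>, and open sets are an intersection-stable generator of
  the Borel sets.\<close>

lemma lip_close_0_imp_eq:
  fixes M N :: "'a::euclidean_space measure"
  assumes M: "M \<in> P2" and N: "N \<in> P2" and close: "lip_close M N 0"
  shows "M = N"
proof -
  interpret M: prob_space M by (rule P2D[OF M])
  interpret N: prob_space N by (rule P2D[OF N])
  \<comment> \<open>The whole space is treated apart because \<open>infdist\<close> to the empty set
    is 0 by convention.\<close>
  have U: "measure M U = measure N U" if U: "open U" for U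
  proof (cases "U = UNIV")
    case True
    then show ?thesis
      using M.prob_space N.prob_space by (simp add: P2D(3)[OF M] P2D(3)[OF N])
  next
    case False
    define \<phi> where "\<phi> n z = min 1 (real n * infdist z (- U))" for n z
    have lip: "norm (\<phi> n x - \<phi> n y) \<le> real n * norm (x - y)" for n x y
    proof -
      have "\<bar>infdist x (- U) - infdist y (- U)\<bar> \<le> norm (x - y)"
        using infdist_triangle_abs[of x "- U" y] by (simp add: dist_norm)
      then have "real n * \<bar>infdist x (- U) - infdist y (- U)\<bar> \<le> real n * norm (x - y)"
        by (intro mult_left_mono) auto
      then have "\<bar>real n * infdist x (- U) - real n * infdist y (- U)\<bar> \<le> real n * norm (x - y)"
        by (simp add: abs_mult right_diff_distrib[symmetric])
      then show ?thesis by (auto simp: \<phi>_def min_def)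
    qed
    have lim: "(\<lambda>n. \<phi> n z) \<longlonglongrightarrow> indicator U z" for z
    proof (cases "z \<in> U")
      case True
      then have "infdist z (- U) \<noteq> 0"
        using in_closed_iff_infdist_zero[of "- U" z] U False by auto
      then have pos: "infdist z (- U) > 0" using infdist_nonneg[of z "- U"] by linarith
      then obtain n0 :: nat where n0: "1 / infdist z (- U) < real n0" using reals_Archimedean2
          by blast
      have "\<phi> n z = 1" if "n \<ge> n0" for n
      proof -
        have "1 / infdist z (- U) \<le> real n" using n0 that by linarith
        then have "1 \<le> real n * infdist z (- U)" using pos by (simp add: pos_divide_le_eq)
        then show ?thesis by (simp add: \<phi>_def)
      qed
      then show ?thesis
        using True by (intro tendsto_eventually) (auto simp: eventually_sequentially)
    next
      case False
      then show ?thesis by (simp add: \<phi>_def)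
    qed
    have conv: "(\<lambda>n. \<integral>z. \<phi> n z \<partial>P) \<longlonglongrightarrow> measure P U" if P: "P \<in> P2" for P
    proof -
      interpret prob_space P by (rule P2D[OF P])
      have "U \<in> sets P" using U by (simp add: P2D(2)[OF P])
      have "(\<lambda>n. \<integral>z. \<phi> n z \<partial>P) \<longlonglongrightarrow> (\<integral>z. indicator U z \<partial>P)"
      proof (rule integral_dominated_convergence[where w = "\<lambda>_. 1"])
        show "\<phi> n \<in> borel_measurable P" for n
          using P2_lipschitz_integrable[OF P lip] by (rule borel_measurable_integrable)
        show "AE z in P. norm (\<phi> n z) \<le> 1" for n
        proof (intro AE_I2)
          fix z
          have "0 \<le> real n * infdist z (- U)" by (simp add: infdist_nonneg)
          then show "norm (\<phi> n z) \<le> 1" by (simp add: \<phi>_def)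
        qed
      qed (use lim \<open>U \<in> sets P\<close> in auto)
      then show ?thesis using \<open>U \<in> sets P\<close> sets.sets_into_space[OF \<open>U \<in> sets P\<close>]
          by (simp add: Int_absorb1 Int_absorb2)
    qed
    have "(\<integral>z. \<phi> n z \<partial>M) = (\<integral>z. \<phi> n z \<partial>N)" for n
      using lip_close_lipschitz[OF M N close, of "\<phi> n" "real n"] lip by simp
    then show ?thesis
      using LIMSEQ_unique[OF conv[OF M]] conv[OF N] by simp
  qed
  show ?thesis
  proof (rule measure_eqI_generator_eq[of "{S. open S}" UNIV M N "\<lambda>_. UNIV"])
    show "Int_stable {S::'a set. open S}" by (auto simp: Int_stable_def)
    show "emeasure M X = emeasure N X" if "X \<in> {S. open S}" for X
      using U[of X] that by (simp add: M.emeasure_eq_measure N.emeasure_eq_measure)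
    show "sets M = sigma_sets UNIV {S. open S}" "sets N = sigma_sets UNIV {S. open S}"
      by (simp_all add: P2D(2)[OF M] P2D(2)[OF N] borel_def)
  qed auto
qed

lemma (in prob_space) norm_integral_le_const:
  fixes F :: "'a \<Rightarrow> 'b::{banach, second_countable_topology}"
  assumes "integrable M F" "AE z in M. norm (F z) \<le> c"
  shows "norm (integral\<^sup>L M F) \<le> c"
proof -
  have "norm (integral\<^sup>L M F) \<le> (\<integral>z. norm (F z) \<partial>M)" by (rule integral_norm_bound)
  also have "\<dots> \<le> (\<integral>z. c \<partial>M)" by (rule integral_mono_AE) (use assms in auto)
  finally show ?thesis by (simp add: prob_space)
qed

text \<open>Composition with the nearest-point map makes a locally Lipschitz function globally
  Lipschitz with the constant of the ball, without changing it on the ball.\<close>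

lemma cball_projection:
  fixes R :: real
  assumes "R \<ge> 0"
  defines "\<pi> \<equiv> closest_point (cball (0::'a::euclidean_space) R)"
  shows "norm (\<pi> x) \<le> R" "norm (\<pi> x - \<pi> y) \<le> norm (x - y)" "norm x \<le> R \<Longrightarrow> \<pi> x = x"
    "norm (\<pi> x) \<le> norm x" "continuous_on S \<pi>"
proof -
  have ne: "cball (0::'a) R \<noteq> {}" using assms by simp
  show "norm (\<pi> x) \<le> R"
    using closest_point_in_set[OF closed_cball ne, of x] by (simp add: \<pi>_def)
  show lip: "norm (\<pi> x - \<pi> y) \<le> norm (x - y)" for x y
    using closest_point_lipschitz[OF convex_cball closed_cball ne, of x y]
        by (simp add: \<pi>_def dist_norm)
  show self: "\<pi> x = x" if "norm x \<le> R" for x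
    using that by (simp add: \<pi>_def closest_point_self)
  show "norm (\<pi> x) \<le> norm x"
    using lip[of x 0] self[of 0] assms by simp
  show "continuous_on S \<pi>"
    by (rule lipschitz_continuous[of _ 1]) (use lip in simp)
qed

section \<open>Stability of the drift and Euler steps for the dual equation\<close>

context mean_field
begin

lemma drift_bounded_on_cball:
  assumes M: "M \<in> P2" and supp: "AE w in M. norm w \<le> R" and z: "norm z \<le> R"
  shows "norm (drift M z) \<le> C * (1 + 2 * R)"
proof -
  interpret prob_space M by (rule P2D[OF M])
  show ?thesis
    unfolding drift_def
  proof (rule norm_integral_le_const[OF drift_integrable[OF M]])
    show "AE w in M. norm (B (z - w)) \<le> C * (1 + 2 * R)"
      using supp
    proof eventually_elim
      case (elim w)
      have "C * (1 + norm z + norm w) \<le> C * (1 + 2 * R)"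
        using elim z by (intro mult_left_mono C_nonneg) simp
      then show ?case using B_diff_growth[of z w] by linarith
    qed
  qed
qed

lemma drift_lipschitz_on_cball:
  assumes M: "M \<in> P2" and supp: "AE w in M. norm w \<le> R" and z: "norm z \<le> R" "norm z' \<le> R"
    and L: "\<And>x y. norm x \<le> 2 * R \<Longrightarrow> norm y \<le> 2 * R \<Longrightarrow> norm (B x - B y) \<le> L * norm (x - y)"
  shows "norm (drift M z - drift M z') \<le> L * norm (z - z')"
proof -
  interpret prob_space M by (rule P2D[OF M])
  have "norm (\<integral>w. B (z - w) - B (z' - w) \<partial>M) \<le> L * norm (z - z')"
  proof (rule norm_integral_le_const)
    show "AE w in M. norm (B (z - w) - B (z' - w)) \<le> L * norm (z - z')"
      using supp
    proof eventually_elim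
      case (elim w)
      have "norm (z - w) \<le> 2 * R" "norm (z' - w) \<le> 2 * R"
        using elim z norm_triangle_ineq4[of z w] norm_triangle_ineq4[of z' w] by linarith+
      from L[OF this] show ?case by simp
    qed
  qed (intro Bochner_Integration.integrable_diff drift_integrable M)
  then show ?thesis
    unfolding drift_def using drift_integrable[OF M] by simp
qed

text \<open>The vector difference \<open>e\<close> is paired with itself:
  \<open>w \<mapsto> B (z - \<pi> w) \<bullet> e\<close> is a real function with Lipschitz constant
  \<open>L * norm e\<close>, so closeness yields
  \<open>norm e * norm e \<le> L * norm e * A\<close>, and one factor cancels.\<close>

lemma drift_close:
  assumes M: "M \<in> P2" and N: "N \<in> P2" and close: "lip_close M N A"
    and supp: "AE w in M. norm w \<le> R" "AE w in N. norm w \<le> R" and z: "norm z \<le> R"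
    and L: "L \<ge> 0" "\<And>x y. norm x \<le> 2 * R \<Longrightarrow> norm y \<le> 2 * R \<Longrightarrow> norm (B x - B y) \<le> L * norm (x - y)"
  shows "norm (drift M z - drift N z) \<le> L * A"
proof -
  have R: "R \<ge> 0" using z norm_ge_zero order_trans by blast
  define \<pi> where "\<pi> = closest_point (cball (0::'a) R)"
  note \<pi> = cball_projection[OF R, where 'a='a, folded \<pi>_def]
  define e where "e = drift M z - drift N z"
  define F where "F w = B (z - \<pi> w) \<bullet> e" for w
  have lip: "\<bar>F x - F y\<bar> \<le> (L * norm e) * norm (x - y)" for x y
  proof -
    have cs: "\<bar>F x - F y\<bar> \<le> norm (B (z - \<pi> x) - B (z - \<pi> y)) * norm e"
      unfolding F_def inner_diff_left[symmetric] by (rule Cauchy_Schwarz_ineq2)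
    have "norm (B (z - \<pi> x) - B (z - \<pi> y)) \<le> L * norm ((z - \<pi> x) - (z - \<pi> y))"
      using norm_triangle_ineq4[of z "\<pi> x"] norm_triangle_ineq4[of z "\<pi> y"] z \<pi>(1)[of x] \<pi>(1)[of y]
      by (intro L(2)) linarith+
    also have "L * norm ((z - \<pi> x) - (z - \<pi> y)) \<le> L * norm (x - y)"
      using \<pi>(2)[of x y] by (intro mult_left_mono L(1)) (simp add: norm_minus_commute)
    finally have "norm (B (z - \<pi> x) - B (z - \<pi> y)) * norm e \<le> L * norm (x - y) * norm e"
      by (rule mult_right_mono) simp
    with cs show ?thesis by (simp add: mult_ac)
  qed
  have int: "(\<integral>w. F w \<partial>P) = drift P z \<bullet> e" if P: "P \<in> P2" and s: "AE w in P. norm w \<le> R" for P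
  proof -
    have "(\<integral>w. F w \<partial>P) = (\<integral>w. B (z - w) \<bullet> e \<partial>P)"
    proof (rule integral_cong_AE)
      show "F \<in> borel_measurable P"
        by (rule borel_measurable_integrable[OF P2_lipschitz_integrable[OF P, of _ "L * norm e"]])
            (use lip in simp)
      show "(\<lambda>w. B (z - w) \<bullet> e) \<in> borel_measurable P"
        using drift_integrable[OF P]
            by (intro borel_measurable_inner borel_measurable_integrable) auto
      show "AE w in P. F w = B (z - w) \<bullet> e"
        using s by eventually_elim (simp add: F_def \<pi>(3))
    qed
    also have "\<dots> = drift P z \<bullet> e"
      unfolding drift_def using drift_integrable[OF P] by simp
    finally show ?thesis .
  qed
  have "(norm e)\<^sup>2 = drift M z \<bullet> e - drift N z \<bullet> e"
    by (simp add: e_def inner_diff_left power2_norm_eq_inner)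
  also have "\<dots> \<le> (L * norm e) * A"
    using lip_close_lipschitz[OF M N close lip] int[OF M supp(1)] int[OF N supp(2)] by simp
  finally have le: "norm e * norm e \<le> norm e * (L * A)" by (simp add: power2_eq_square mult_ac)
  show ?thesis
  proof (cases "norm e = 0")
    case True
    \<comment> \<open>Nothing can be cancelled for \<open>e = 0\<close>. What is needed then is
      \<open>0 \<le> A\<close>, which results from testing with the zero function and Lipschitz
      constant 1.\<close>
    have "norm e \<le> L * A"
    proof -
      have "\<bar>(\<integral>z. 0 \<partial>M) - (\<integral>z. 0 \<partial>N)\<bar> \<le> 1 * A"
        using close unfolding lip_close_def
            by (elim allE[of _ "\<lambda>_. 0"] allE[of _ 1] impE) (auto simp: smooth_const)
      then show ?thesis using True L(1) by simp
    qed
    then show ?thesis by (simp add: e_def)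
  next
    case False
    then show ?thesis using le by (simp add: e_def)
  qed
qed

text \<open>Inside the ball mass moves with speed at most \<open>C * (1 + 2 * R)\<close>, and a test
  function that is constant in time changes along the motion at most \<open>\<Lambda>\<close> times
  as fast.\<close>

lemma weak_sol_time_lipschitz:
  assumes g: "weak_sol T f0 g" and T: "0 < T"
    and f0: "AE z in f0. norm z \<le> R" "sets f0 = sets borel"
    and gR: "\<And>t. t \<in> {0..T} \<Longrightarrow> AE z in g t. norm z \<le> R" and st: "0 \<le> s" "s \<le> t" "t \<le> T"
  shows "lip_close (g t) (g s) (C * (1 + 2 * R) * (t - s))"
  unfolding lip_close_def
proof (intro allI impI)
  fix \<phi> :: "'a \<Rightarrow> real" and \<Lambda>
  assume \<phi>: "smooth \<phi>" "\<forall>x y. \<bar>\<phi> x - \<phi> y\<bar> \<le> \<Lambda> * norm (x - y)"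
  then have \<Lambda>: "\<Lambda> \<ge> 0" by (intro lipschitz_constant_nonneg[of \<phi>]) simp
  have h: "smooth (\<lambda>x :: real \<times> 'a. \<phi> (snd x))"
    by (intro smooth_compose[OF \<phi>(1)] smooth_snd smooth_ident)
  have "\<bar>(\<integral>z. \<phi> (snd (t, z)) \<partial>g t) - (\<integral>z. \<phi> (snd (s, z)) \<partial>g s)\<bar> \<le> \<Lambda> * (C * (1 + 2 * R)) * (t - s)"
  proof (rule weak_sol_increment[OF g T h f0 gR st])
    fix r and z :: 'a assume r: "s \<le> r" "r \<le> t" and z: "norm z \<le> R"
    have rT: "r \<in> {0..T}" using r st by auto
    have "((\<lambda>x :: real \<times> 'a. \<phi> (snd x)) has_derivative (\<lambda>u. frechet_derivative \<phi> (at z) (snd u)))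
        (at (r, z))"
      by (rule has_derivative_compose[OF has_derivative_snd[OF has_derivative_ident]])
        (use smoothD[OF \<phi>(1), of z] in simp)
    from frechet_derivative_at[OF this, symmetric]
    have "\<bar>frechet_derivative (\<lambda>x :: real \<times> 'a. \<phi> (snd x)) (at (r, z)) (1, drift (g r) z)\<bar>
        = norm (frechet_derivative \<phi> (at z) (drift (g r) z))" by simp
    also have "\<dots> \<le> \<Lambda> * norm (drift (g r) z)"
      by (rule lipschitz_derivative_bound[OF _ smoothD[OF \<phi>(1)]]) (use \<phi>(2) in simp)
    also have "\<dots> \<le> \<Lambda> * (C * (1 + 2 * R))"
      by (intro mult_left_mono drift_bounded_on_cball[OF weak_sol_P2[OF g rT] gR[OF rT] z] \<Lambda>)
    finally show "\<bar>frechet_derivative (\<lambda>x :: real \<times> 'a. \<phi> (snd x)) (at (r, z)) (1, drift (g r) z)\<bar>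
        \<le> \<Lambda> * (C * (1 + 2 * R))" .
  qed auto
  then show "\<bar>(\<integral>z. \<phi> z \<partial>g t) - (\<integral>z. \<phi> z \<partial>g s)\<bar> \<le> \<Lambda> * (C * (1 + 2 * R) * (t - s))"
    by (simp add: mult.assoc)
qed

text \<open>One Euler step of the dual equation: \<open>h (r, z) = \<phi> (z + (t - r) c (z))\<close> solves the backward
  transport equation of the drift of \<open>f s\<close> up to an error of order \<open>t - s\<close> that involves only the
  Lipschitz constant of \<open>\<phi>\<close>.\<close>

lemma lip_close_step:
  assumes f: "weak_sol T f0 f" and g: "weak_sol T f0 g" and T: "0 < T" and R: "R \<ge> 0"
    and f0: "AE z in f0. norm z \<le> R" "sets f0 = sets borel"
    and fR: "\<And>t. t \<in> {0..T} \<Longrightarrow> AE z in f t. norm z \<le> R"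
    and gR: "\<And>t. t \<in> {0..T} \<Longrightarrow> AE z in g t. norm z \<le> R" and st: "0 \<le> s" "s \<le> t" "t \<le> T"
    and L: "L \<ge> 0" "\<And>x y. norm x \<le> 2 * R \<Longrightarrow> norm y \<le> 2 * R \<Longrightarrow> norm (B x - B y) \<le> L * norm (x - y)"
    and close: "lip_close (f s) (g s) A"
  defines "M \<equiv> C * (1 + 2 * R)" and "\<tau> \<equiv> t - s"
  shows "lip_close (f t) (g t) ((1 + 2 * L * \<tau>) * A + (4 * L * M + 2) * \<tau>\<^sup>2)"
proof (cases "s = t")
  case True
  then show ?thesis using close by (simp add: \<tau>_def)
next
  case False
  then have \<tau>: "\<tau> > 0" using st by (simp add: \<tau>_def)
  have sT: "s \<in> {0..T}" using st by auto
  have M: "M \<ge> 0" using R C_nonneg by (simp add: M_def)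
  define \<pi> where "\<pi> = closest_point (cball (0::'a) R)"
  note \<pi> = cball_projection[OF R, where 'a='a, folded \<pi>_def]
  have "norm (drift (f s) (\<pi> x) - drift (f s) (\<pi> y)) \<le> L * norm (x - y)" for x y
  proof -
    have "norm (drift (f s) (\<pi> x) - drift (f s) (\<pi> y)) \<le> L * norm (\<pi> x - \<pi> y)"
      by (rule drift_lipschitz_on_cball[OF weak_sol_P2[OF f sT] fR[OF sT] \<pi>(1) \<pi>(1) L(2)])
    also have "\<dots> \<le> L * norm (x - y)" by (intro mult_left_mono \<pi> L)
    finally show ?thesis .
  qed
  \<comment> \<open>The accuracy of the mollification is the time step itself; over a step of that
    length it costs only the square of \<open>\<tau>\<close>.\<close>
  then obtain c where c: "smooth c" "\<And>x y. norm (c x - c y) \<le> L * norm (x - y)"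
    "\<And>x. norm (c x - drift (f s) (\<pi> x)) \<le> \<tau>"
    using smooth_lipschitz_approx[of "\<lambda>z. drift (f s) (\<pi> z)" L \<tau>] \<tau> by blast
  show ?thesis
    unfolding lip_close_def
  proof (intro allI impI)
    fix \<phi> :: "'a \<Rightarrow> real" and \<Lambda>
    assume \<phi>: "smooth \<phi>" "\<forall>x y. \<bar>\<phi> x - \<phi> y\<bar> \<le> \<Lambda> * norm (x - y)"
    then have \<Lambda>: "\<Lambda> \<ge> 0" by (intro lipschitz_constant_nonneg[of \<phi>]) simp
    define q where "q x = snd x + (t - fst x) *\<^sub>R c (snd x)" for x :: "real \<times> 'a"
    have sq: "smooth q"
      unfolding q_def[abs_def]
      by (intro smooth_add smooth_scaleR smooth_diff smooth_const smooth_fst smooth_snd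
          smooth_ident smooth_compose[OF c(1)])
    have h: "smooth (\<lambda>x. \<phi> (q x))" by (rule smooth_compose[OF \<phi>(1) sq])
    \<comment> \<open>The time derivative of \<open>q\<close> produces \<open>- c z\<close>, which
      compensates the velocity \<open>b\<close>. The remaining term contains the derivative of
      \<open>c\<close>, bounded by \<open>L\<close>; of \<open>\<phi>\<close> only the Lipschitz
      constant survives.\<close>
    have Dh: "\<bar>frechet_derivative (\<lambda>x. \<phi> (q x)) (at (r, z)) (1, b)\<bar>
        \<le> \<Lambda> * (norm (b - c z) + \<tau> * L * norm b)"
      if r: "s \<le> r" "r \<le> t" for r z b
    proof -
      let ?Dc = "frechet_derivative c (at z)"
      have Dq: "(q has_derivative (\<lambda>u. snd u + ((t - r) *\<^sub>R ?Dc (snd u) - fst u *\<^sub>R c z)))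
          (at (r, z))"
      proof -
        have "((\<lambda>x. c (snd x)) has_derivative (\<lambda>u. ?Dc (snd u))) (at (r, z))"
          by (rule has_derivative_compose[OF has_derivative_snd[OF has_derivative_ident]])
            (use smoothD[OF c(1), of z] in simp)
        then show ?thesis
          unfolding q_def[abs_def] by (auto intro!: derivative_eq_intros)
      qed
      have "((\<lambda>x. \<phi> (q x)) has_derivative (\<lambda>u. frechet_derivative \<phi> (at (q (r, z))) (snd u
          + ((t - r) *\<^sub>R ?Dc (snd u) - fst u *\<^sub>R c z)))) (at (r, z))"
        by (rule has_derivative_compose[OF Dq smoothD[OF \<phi>(1)]])
      from frechet_derivative_at[OF this, symmetric]
      have "\<bar>frechet_derivative (\<lambda>x. \<phi> (q x)) (at (r, z)) (1, b)\<bar> =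
          norm (frechet_derivative \<phi> (at (q (r, z))) (b + ((t - r) *\<^sub>R ?Dc b - c z)))" by simp
      also have "\<dots> \<le> \<Lambda> * norm (b + ((t - r) *\<^sub>R ?Dc b - c z))"
        by (rule lipschitz_derivative_bound[OF _ smoothD[OF \<phi>(1)]]) (use \<phi>(2) in simp)
      also have "\<dots> \<le> \<Lambda> * (norm (b - c z) + \<tau> * L * norm b)"
      proof (rule mult_left_mono[OF _ \<Lambda>])
        have "norm (b + ((t - r) *\<^sub>R ?Dc b - c z)) = norm ((b - c z) + (t - r) *\<^sub>R ?Dc b)"
          by (simp add: algebra_simps)
        also have "\<dots> \<le> norm (b - c z) + (t - r) * norm (?Dc b)"
          by (rule order_trans[OF norm_triangle_ineq]) (use r in simp)
        also have "(t - r) * norm (?Dc b) \<le> \<tau> * (L * norm b)"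
          by (rule mult_mono[OF _ lipschitz_derivative_bound[OF c(2) smoothD[OF c(1)]]])
              (use r \<tau> in \<open>auto simp: \<tau>_def\<close>)
        finally show "norm (b + ((t - r) *\<^sub>R ?Dc b - c z)) \<le> norm (b - c z) + \<tau> * L * norm b"
          by (simp add: mult.assoc)
      qed
      finally show ?thesis .
    qed
    have ds: "norm (drift P z - c z) \<le> norm (drift P z - drift (f s) z) + \<tau>" if "norm z \<le> R" for P z
    proof -
      have "norm (drift (f s) z - c z) \<le> \<tau>"
        using c(3)[of z] \<pi>(3)[OF that] by (simp add: norm_minus_commute)
      then show ?thesis
        using norm_triangle_ineq[of "drift P z - drift (f s) z" "drift (f s) z - c z"] by simp
    qed
    \<comment> \<open>One estimate for both solutions: \<open>E\<close> measures how far the drift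
      of \<open>k s\<close> is from that of \<open>f s\<close>, from which \<open>q\<close> was
      built. It is 0 for \<open>f\<close> and \<open>L * A\<close> for \<open>g\<close>.\<close>
    have inc: "\<bar>(\<integral>z. \<phi> z \<partial>k t) - (\<integral>z. \<phi> (q (s, z)) \<partial>k s)\<bar>
        \<le> \<Lambda> * (L * (M * \<tau>) + E + \<tau> + \<tau> * L * M) * \<tau>"
      if k: "weak_sol T f0 k" and kR: "\<And>t. t \<in> {0..T} \<Longrightarrow> AE z in k t. norm z \<le> R"
        and E: "\<And>z. norm z \<le> R \<Longrightarrow> norm (drift (k s) z - drift (f s) z) \<le> E" for k E
    proof -
      have "\<bar>(\<integral>z. \<phi> (q (t, z)) \<partial>k t) - (\<integral>z. \<phi> (q (s, z)) \<partial>k s)\<bar>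
          \<le> \<Lambda> * (L * (M * \<tau>) + E + \<tau> + \<tau> * L * M) * (t - s)"
      proof (rule weak_sol_increment[OF k T h f0 kR st])
        fix r and z :: 'a assume r: "s \<le> r" "r \<le> t" and z: "norm z \<le> R"
        have rT: "r \<in> {0..T}" using r st by auto
        have "lip_close (k r) (k s) (M * (r - s))"
          unfolding M_def by (rule weak_sol_time_lipschitz[OF k T f0 kR]) (use r st in auto)
        then have "lip_close (k r) (k s) (M * \<tau>)"
          by (rule lip_close_mono) (use r M in \<open>auto simp: \<tau>_def intro: mult_left_mono\<close>)
        then have "norm (drift (k r) z - drift (k s) z) \<le> L * (M * \<tau>)"
          by (rule drift_close[OF weak_sol_P2[OF k rT] weak_sol_P2[OF k sT] _ kR[OF rT] kR[OF sT]
              z L])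
        moreover have "norm (drift (k r) z - drift (f s) z) \<le>
            norm (drift (k r) z - drift (k s) z) + norm (drift (k s) z - drift (f s) z)"
          using norm_triangle_ineq[of "drift (k r) z - drift (k s) z"
              "drift (k s) z - drift (f s) z"] by simp
        ultimately have "norm (drift (k r) z - c z) \<le> L * (M * \<tau>) + E + \<tau>"
          using ds[OF z, of "k r"] E[OF z] by linarith
        moreover have "\<tau> * L * norm (drift (k r) z) \<le> \<tau> * L * M"
          using drift_bounded_on_cball[OF weak_sol_P2[OF k rT] kR[OF rT] z] \<tau> L(1)
          by (intro mult_left_mono) (auto simp: M_def)
        ultimately have "\<Lambda> * (norm (drift (k r) z - c z) + \<tau> * L * norm (drift (k r) z))
            \<le> \<Lambda> * (L * (M * \<tau>) + E + \<tau> + \<tau> * L * M)"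
          by (intro mult_left_mono \<Lambda>) linarith
        with Dh[OF r, of z "drift (k r) z"]
        show "\<bar>frechet_derivative (\<lambda>x. \<phi> (q x)) (at (r, z)) (1, drift (k r) z)\<bar>
            \<le> \<Lambda> * (L * (M * \<tau>) + E + \<tau> + \<tau> * L * M)"
          by linarith
      qed auto
      then show ?thesis by (simp add: q_def \<tau>_def)
    qed
    have incf: "\<bar>(\<integral>z. \<phi> z \<partial>f t) - (\<integral>z. \<phi> (q (s, z)) \<partial>f s)\<bar>
        \<le> \<Lambda> * (L * (M * \<tau>) + 0 + \<tau> + \<tau> * L * M) * \<tau>"
      by (rule inc[OF f fR]) auto
    have incg: "\<bar>(\<integral>z. \<phi> z \<partial>g t) - (\<integral>z. \<phi> (q (s, z)) \<partial>g s)\<bar>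
        \<le> \<Lambda> * (L * (M * \<tau>) + L * A + \<tau> + \<tau> * L * M) * \<tau>"
    proof (rule inc[OF g gR])
      show "norm (drift (g s) z - drift (f s) z) \<le> L * A" if "norm z \<le> R" for z
        by (rule drift_close[OF weak_sol_P2[OF g sT] weak_sol_P2[OF f sT] lip_close_sym[OF close]
            gR[OF sT] fR[OF sT] that L])
    qed
    \<comment> \<open>At time \<open>s\<close> the step is a perturbation of the identity and
      stretches distances at most by the factor \<open>1 + \<tau> * L\<close>.\<close>
    have start: "\<bar>(\<integral>z. \<phi> (q (s, z)) \<partial>f s) - (\<integral>z. \<phi> (q (s, z)) \<partial>g s)\<bar> \<le> (\<Lambda> * (1 + \<tau> * L)) * A"
    proof (rule lip_close_lipschitz[OF weak_sol_P2[OF f sT] weak_sol_P2[OF g sT] close])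
      fix x y
      have "\<bar>\<phi> (q (s, x)) - \<phi> (q (s, y))\<bar> \<le> \<Lambda> * norm (q (s, x) - q (s, y))" using \<phi>(2) by blast
      also have "\<dots> \<le> \<Lambda> * ((1 + \<tau> * L) * norm (x - y))"
      proof (rule mult_left_mono[OF _ \<Lambda>])
        have "q (s, x) - q (s, y) = (x - y) + \<tau> *\<^sub>R (c x - c y)"
          by (simp add: q_def \<tau>_def algebra_simps)
        also have "norm \<dots> \<le> norm (x - y) + \<tau> * norm (c x - c y)"
          by (rule order_trans[OF norm_triangle_ineq]) (use \<tau> in simp)
        also have "\<dots> \<le> norm (x - y) + \<tau> * (L * norm (x - y))"
          using c(2)[of x y] \<tau> by simp
        finally show "norm (q (s, x) - q (s, y)) \<le> (1 + \<tau> * L) * norm (x - y)"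
          by (simp add: algebra_simps)
      qed
      finally show "\<bar>\<phi> (q (s, x)) - \<phi> (q (s, y))\<bar> \<le> \<Lambda> * (1 + \<tau> * L) * norm (x - y)"
          by (simp add: mult.assoc)
    qed
    \<comment> \<open>The two copies of \<open>L * \<tau> * A\<close> come from the stretching at
      time \<open>s\<close> and from the drift mismatch of \<open>g\<close>. The quadratic error
      collects \<open>2 * L * M + 1\<close> from each solution.\<close>
    have "\<bar>(\<integral>z. \<phi> z \<partial>f t) - (\<integral>z. \<phi> z \<partial>g t)\<bar> \<le> (\<Lambda> * (1 + \<tau> * L)) * A
        + \<Lambda> * (L * (M * \<tau>) + 0 + \<tau> + \<tau> * L * M) * \<tau> + \<Lambda> * (L * (M * \<tau>) + L * A + \<tau> + \<tau> * L * M) * \<tau>"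
      using incf incg start by linarith
    also have "\<dots> = \<Lambda> * ((1 + 2 * L * \<tau>) * A + (4 * L * M + 2) * \<tau>\<^sup>2)"
      by (simp add: algebra_simps power2_eq_square)
    finally show "\<bar>(\<integral>z. \<phi> z \<partial>f t) - (\<integral>z. \<phi> z \<partial>g t)\<bar>
        \<le> \<Lambda> * ((1 + 2 * L * \<tau>) * A + (4 * L * M + 2) * \<tau>\<^sup>2)" .
  qed
qed

text \<open>A discrete Gronwall argument with \<open>n\<close> Euler steps of length
  \<open>t / n\<close>; the accumulated error is of order \<open>1 / n\<close>.\<close>

theorem weak_sol_unique:
  assumes f: "weak_sol T f0 f" and g: "weak_sol T f0 g" and T: "0 < T"
    and f0: "AE z in f0. norm z \<le> R0" "sets f0 = sets borel" and t: "t \<in> {0..T}"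
  shows "f t = g t"
proof -
  obtain R1 where R1: "R1 \<ge> 0" "\<And>t. t \<in> {0..T} \<Longrightarrow> AE z in f t. norm z \<le> R1"
    using weak_sol_support[OF f T f0(1)] by blast
  obtain R2 where R2: "R2 \<ge> 0" "\<And>t. t \<in> {0..T} \<Longrightarrow> AE z in g t. norm z \<le> R2"
    using weak_sol_support[OF g T f0(1)] by blast
  \<comment> \<open>A common ball for the initial measure and both solutions, so that one Lipschitz
    constant serves throughout.\<close>
  define R where "R = max (max R0 R1) R2"
  have R: "R \<ge> 0" using R1 by (simp add: R_def)
  have fR: "AE z in f t. norm z \<le> R" if "t \<in> {0..T}" for t
    using R1(2)[OF that] by eventually_elim (simp add: R_def)
  have gR: "AE z in g t. norm z \<le> R" if "t \<in> {0..T}" for t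
    using R2(2)[OF that] by eventually_elim (simp add: R_def)
  have f0R: "AE z in f0. norm z \<le> R"
    using f0(1) by eventually_elim (simp add: R_def)
  obtain L where L: "L \<ge> 0" "\<And>x y. norm x \<le> 2 * R \<Longrightarrow> norm y \<le> 2 * R \<Longrightarrow> norm (B x - B y)
      \<le> L * norm (x - y)"
    using B_lipschitz[of "2 * R"] by blast
  define M where "M = C * (1 + 2 * R)"
  have M: "M \<ge> 0" using R C_nonneg by (simp add: M_def)
  \<comment> \<open>Dominates both coefficients of the one-step estimate, so that the recursion for
    the error has a closed solution.\<close>
  define K where "K = 2 * L + (4 * L * M + 2)"
  have K: "K \<ge> 0" using L(1) M by (simp add: K_def)
  have main: "lip_close (f t) (g t) (t * exp (K * t) / real n)" if n: "n > 0" for n :: nat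
  proof -
    define \<tau> where "\<tau> = t / real n"
    have \<tau>: "\<tau> \<ge> 0" "real n * \<tau> = t" using t n by (auto simp: \<tau>_def)
    \<comment> \<open>The solution of the recursion
      \<open>A' = (1 + K * \<tau>) * A + K * \<tau>^2\<close> with initial value 0.\<close>
    have "lip_close (f (real k * \<tau>)) (g (real k * \<tau>)) (\<tau> * ((1 + K * \<tau>) ^ k - 1))" if "k \<le> n" for k
      using that
    proof (induction k)
      case 0
      \<comment> \<open>That both solutions start from \<open>f0\<close> is itself a consequence of
        the pointwise form at time 0.\<close>
      have "(\<integral>z. \<phi> z \<partial>f 0) = (\<integral>z. \<phi> z \<partial>g 0)" if "smooth \<phi>" for \<phi> :: "'a \<Rightarrow> real"
      proof -
        have h: "smooth (\<lambda>x :: real \<times> 'a. \<phi> (snd x))"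
          by (intro smooth_compose[OF that] smooth_snd smooth_ident)
        have T0: "0 \<in> {0..T}" using T by simp
        show ?thesis
          using weak_sol_pointwise(1)[OF f T h f0R f0(2) fR T0]
              weak_sol_pointwise(1)[OF g T h f0R f0(2) gR T0] by simp
      qed
      then show ?case by (simp add: lip_close_def)
    next
      case (Suc k)
      define A where "A = \<tau> * ((1 + K * \<tau>) ^ k - 1)"
      have A: "A \<ge> 0" using \<tau> K by (simp add: A_def)
      have le: "real k * \<tau> \<le> real (Suc k) * \<tau>" "real (Suc k) * \<tau> \<le> T"
      proof -
        show "real k * \<tau> \<le> real (Suc k) * \<tau>" using \<tau> by (intro mult_right_mono) auto
        have "real (Suc k) * \<tau> \<le> real n * \<tau>" using \<tau> Suc.prems by (intro mult_right_mono) auto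
        then show "real (Suc k) * \<tau> \<le> T" using \<tau> t by auto
      qed
      have d: "real (Suc k) * \<tau> - real k * \<tau> = \<tau>" by (simp add: algebra_simps)
      have "lip_close (f (real k * \<tau>)) (g (real k * \<tau>)) A" using Suc unfolding A_def by simp
      from lip_close_step[OF f g T R f0R f0(2) fR gR _ le L this]
      have "lip_close (f (real (Suc k) * \<tau>)) (g (real (Suc k) * \<tau>)) ((1 + 2 * L * \<tau>) * A
          + (4 * L * M + 2) * \<tau>\<^sup>2)"
        using \<tau> unfolding d M_def by simp
      then show ?case
      proof (rule lip_close_mono)
        have "2 * L * (\<tau> * A) \<le> K * (\<tau> * A)" "(4 * L * M + 2) * \<tau>\<^sup>2 \<le> K * \<tau>\<^sup>2"
          using \<tau> A L(1) M by (intro mult_right_mono, auto simp: K_def)+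
        then have "(1 + 2 * L * \<tau>) * A + (4 * L * M + 2) * \<tau>\<^sup>2 \<le> (1 + K * \<tau>) * A + K * \<tau>\<^sup>2"
          by (simp add: algebra_simps)
        also have "\<dots> = \<tau> * ((1 + K * \<tau>) ^ Suc k - 1)"
          by (simp add: A_def algebra_simps power2_eq_square)
        finally show "(1 + 2 * L * \<tau>) * A + (4 * L * M + 2) * \<tau>\<^sup>2 \<le> \<tau> * ((1 + K * \<tau>) ^ Suc k - 1)" .
      qed
    qed
    from this[of n] have "lip_close (f t) (g t) (\<tau> * ((1 + K * \<tau>) ^ n - 1))" using \<tau> by simp
    then show ?thesis
    proof (rule lip_close_mono)
      have "(1 + K * \<tau>) ^ n \<le> exp (K * \<tau>) ^ n"
        using K \<tau> by (intro power_mono) (auto simp: exp_ge_add_one_self)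
      also have "\<dots> = exp (K * t)" using \<tau>(2) by (simp add: exp_of_nat_mult[symmetric] mult_ac)
      finally have "\<tau> * ((1 + K * \<tau>) ^ n - 1) \<le> \<tau> * exp (K * t)"
        using \<tau>(1) by (intro mult_left_mono) auto
      then show "\<tau> * ((1 + K * \<tau>) ^ n - 1) \<le> t * exp (K * t) / real n" by (simp add: \<tau>_def)
    qed
  qed
  have "lip_close (f t) (g t) 0"
    unfolding lip_close_def
  proof (intro allI impI)
    fix \<phi> :: "'a \<Rightarrow> real" and \<Lambda>
    assume \<phi>: "smooth \<phi>" "\<forall>x y. \<bar>\<phi> x - \<phi> y\<bar> \<le> \<Lambda> * norm (x - y)"
    let ?d = "\<bar>(\<integral>z. \<phi> z \<partial>f t) - (\<integral>z. \<phi> z \<partial>g t)\<bar>"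
    have le: "?d \<le> \<Lambda> * (t * exp (K * t) / real n)" if "n > 0" for n
      using main[OF that] \<phi> unfolding lip_close_def by blast
    have "(\<lambda>n. \<Lambda> * (t * exp (K * t) / real n)) \<longlonglongrightarrow> \<Lambda> * 0"
      by (intro tendsto_intros lim_const_over_n)
    then have "?d \<le> \<Lambda> * 0"
      by (rule LIMSEQ_le_const) (use le in \<open>auto intro!: exI[of _ 1]\<close>)
    then show "?d \<le> \<Lambda> * 0" .
  qed
  then show ?thesis
    by (rule lip_close_0_imp_eq[OF weak_sol_P2[OF f t] weak_sol_P2[OF g t]])
qed

end


section \<open>Existence\<close>

instance bcontfun :: (metric_space, banach) banach ..

text \<open>Picard iteration on the whole half line at once. The unknown is the weighted curve
  \<open>exp (- \<mu> * t) *\<^sub>R X t\<close>, bounded because \<open>X\<close> grows at most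
  linearly; the weight makes the Picard map a contraction without any restriction on the length of
  time.\<close>

lemma bounded_lipschitz_ode:
  fixes G :: "'b::banach \<Rightarrow> 'b"
  assumes K: "K \<ge> 0" "\<And>x y. norm (G x - G y) \<le> K * norm (x - y)" and M: "\<And>x. norm (G x) \<le> M"
  obtains X where "X 0 = x0" "\<And>T t. t \<in> {0..T}
      \<Longrightarrow> (X has_vector_derivative G (X t)) (at t within {0..T})"
    "\<And>t. 0 \<le> t \<Longrightarrow> X t = x0 + integral {0..t} (\<lambda>s. G (X s))"
proof -
  \<comment> \<open>The contraction factor is \<open>K / \<mu>\<close>, at most one half by this
    choice; the summand 1 keeps \<open>\<mu>\<close> positive for \<open>K = 0\<close>.\<close>
  define \<mu> where "\<mu> = 2 * K + 1"
  have \<mu>: "\<mu> > 0" "2 * K \<le> \<mu>" using K by (auto simp: \<mu>_def)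
  have M0: "M \<ge> 0" using order_trans[OF norm_ge_zero M] by blast
  have Gc: "continuous_on S G" for S
    by (rule lipschitz_on_continuous_on[of K]) (use K in \<open>auto simp: lipschitz_on_def dist_norm\<close>)
  let ?g = "\<lambda>(Y :: real \<Rightarrow>\<^sub>C 'b) s. G (exp (\<mu> * s) *\<^sub>R Y s)"
  have gc: "continuous_on S (?g Y)" for S Y
    by (intro continuous_on_compose2[OF Gc[of UNIV]] continuous_intros) auto
  \<comment> \<open>Bounded continuous functions live on the whole line here; \<open>max t 0\<close>
    continues the curve constantly to negative times.\<close>
  define \<Phi> where "\<Phi> Y t = exp (- \<mu> * max t 0) *\<^sub>R (x0 + integral {0..max t 0} (?g Y))" for Y t
  have Ibound: "norm (integral {0..t} (?g Y)) \<le> M * t" if "t \<ge> 0" for t Y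
    using integral_bound[of 0 t "?g Y" M] gc M that by simp
  have \<Phi>bound: "norm (\<Phi> Y t) \<le> norm x0 + M / \<mu>" for Y t
  proof -
    define r where "r = max t 0"
    have r: "r \<ge> 0" by (simp add: r_def)
    have "norm (\<Phi> Y t) \<le> exp (- \<mu> * r) * (norm x0 + M * r)"
      unfolding \<Phi>_def r_def[symmetric] norm_scaleR
      using norm_triangle_ineq[of x0 "integral {0..r} (?g Y)"] Ibound[OF r, of Y]
          by (simp add: mult_left_mono)
    also have "\<dots> \<le> exp (- \<mu> * r) * (exp (\<mu> * r) * (norm x0 + M / \<mu>))"
    proof (rule mult_left_mono)
      have e: "1 + \<mu> * r \<le> exp (\<mu> * r)" by (rule exp_ge_add_one_self)
      have "1 \<le> exp (\<mu> * r)" using \<mu> r by simp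
      then have "1 * norm x0 \<le> exp (\<mu> * r) * norm x0" by (rule mult_right_mono) simp
      moreover have "\<mu> * r * (M / \<mu>) \<le> exp (\<mu> * r) * (M / \<mu>)"
        by (rule mult_right_mono) (use e in linarith, use M0 \<mu> in simp)
      moreover have "\<mu> * r * (M / \<mu>) = M * r" using \<mu> by simp
      ultimately show "norm x0 + M * r \<le> exp (\<mu> * r) * (norm x0 + M / \<mu>)"
          by (simp add: distrib_left)
    qed simp
    also have "\<dots> = norm x0 + M / \<mu>" by (simp add: exp_minus)
    finally show ?thesis .
  qed
  have Ic: "continuous_on {0..} (\<lambda>t. integral {0..t} (?g Y))" for Y
  proof (rule lipschitz_on_continuous_on[of M])
    show "M-lipschitz_on {0..} (\<lambda>t. integral {0..t} (?g Y))"
    proof (rule lipschitz_onI[OF _ M0])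
      fix s t :: real assume st: "s \<in> {0..}" "t \<in> {0..}"
      have *: "dist (integral {0..s} (?g Y)) (integral {0..t} (?g Y)) \<le> M * dist s t"
          if "0 \<le> s" "s \<le> t" for s t
      proof -
        have eq: "integral {0..s} (?g Y) + integral {s..t} (?g Y) = integral {0..t} (?g Y)"
          by (rule Henstock_Kurzweil_Integration.integral_combine)
            (use that in \<open>auto intro!: integrable_continuous_real gc\<close>)
        have "dist (integral {0..s} (?g Y)) (integral {0..t} (?g Y))
            = norm (integral {s..t} (?g Y))"
          unfolding eq[symmetric] dist_norm by simp
        also have "\<dots> \<le> M * (t - s)"
          by (rule integral_bound) (use that M gc in auto)
        finally show ?thesis using that by (simp add: dist_real_def)
      qed
      show "dist (integral {0..s} (?g Y)) (integral {0..t} (?g Y)) \<le> M * dist s t"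
        using *[of s t] *[of t s] st by (cases "s \<le> t") (auto simp: dist_commute)
    qed
  qed
  have \<Phi>c: "continuous_on UNIV (\<Phi> Y)" for Y
    unfolding \<Phi>_def[abs_def]
    by (intro continuous_intros continuous_on_compose2[OF Ic]) auto
  have \<Phi>_bc: "\<Phi> Y \<in> bcontfun" for Y
    by (rule bcontfun_normI[OF \<Phi>c \<Phi>bound])
  define \<Psi> where "\<Psi> Y = Bcontfun (\<Phi> Y)" for Y
  have \<Psi>: "apply_bcontfun (\<Psi> Y) t = \<Phi> Y t" for Y t
    unfolding \<Psi>_def using Bcontfun_inverse[OF \<Phi>_bc] by simp
  have "dist (\<Psi> Y) (\<Psi> Y') \<le> 1 / 2 * dist Y Y'" for Y Y'
  proof (rule dist_bound)
    fix t :: real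
    define r where "r = max t 0"
    have r: "r \<ge> 0" by (simp add: r_def)
    have "((\<lambda>s. exp (\<mu> * s)) has_integral (exp (\<mu> * r) / \<mu> - exp (\<mu> * 0) / \<mu>)) {0..r}"
      using r \<mu> by (intro fundamental_theorem_of_calculus)
        (auto intro!: derivative_eq_intros simp:
            has_real_derivative_iff_has_vector_derivative[symmetric])
    then have ei: "((\<lambda>s. K * dist Y Y' * exp (\<mu> * s))
        has_integral (K * dist Y Y' * ((exp (\<mu> * r) - 1) / \<mu>))) {0..r}"
      by (intro has_integral_mult_right) (simp add: diff_divide_distrib)
    have "dist (\<Psi> Y t) (\<Psi> Y' t)
        = norm (exp (- \<mu> * r) *\<^sub>R (integral {0..r} (?g Y) - integral {0..r} (?g Y')))"
      unfolding \<Psi> \<Phi>_def r_def[symmetric] dist_norm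
          by (simp add: scaleR_diff_right[symmetric] del: scaleR_diff_right)
    also have "\<dots> = exp (- \<mu> * r) * norm (integral {0..r} (?g Y) - integral {0..r} (?g Y'))"
      by simp
    also have "integral {0..r} (?g Y) - integral {0..r} (?g Y')
        = integral {0..r} (\<lambda>s. ?g Y s - ?g Y' s)"
      by (rule integral_diff[symmetric]) (intro integrable_continuous_real gc)+
    also have "norm \<dots> \<le> integral {0..r} (\<lambda>s. K * dist Y Y' * exp (\<mu> * s))"
    proof (rule integral_norm_bound_integral)
      show "(\<lambda>s. ?g Y s - ?g Y' s) integrable_on {0..r}"
        by (intro integrable_continuous_real continuous_intros gc)
      show "(\<lambda>s. K * dist Y Y' * exp (\<mu> * s)) integrable_on {0..r}" using ei by blast
      fix s
      have "norm (?g Y s - ?g Y' s) \<le> K * norm (exp (\<mu> * s) *\<^sub>R Y s - exp (\<mu> * s) *\<^sub>R Y' s)"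
          by (rule K(2))
      also have "\<dots> = K * (exp (\<mu> * s) * dist (Y s) (Y' s))"
        by (simp add: scaleR_diff_right[symmetric] dist_norm del: scaleR_diff_right)
      also have "\<dots> \<le> K * (exp (\<mu> * s) * dist Y Y')"
        by (intro mult_left_mono dist_bounded K(1)) auto
      finally show "norm (?g Y s - ?g Y' s) \<le> K * dist Y Y' * exp (\<mu> * s)" by (simp add: mult_ac)
    qed
    also have "integral {0..r} (\<lambda>s. K * dist Y Y' * exp (\<mu> * s))
        = K * dist Y Y' * ((exp (\<mu> * r) - 1) / \<mu>)"
      by (rule integral_unique[OF ei])
    finally have "dist (\<Psi> Y t) (\<Psi> Y' t) \<le> exp (- \<mu> * r) * (K * dist Y Y' * ((exp (\<mu> * r) - 1) / \<mu>))"
      by (simp add: mult_left_mono)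
    also have "\<dots> \<le> exp (- \<mu> * r) * (K * dist Y Y' * (exp (\<mu> * r) / \<mu>))"
      using \<mu> K by (intro mult_left_mono divide_right_mono) auto
    also have "\<dots> = K / \<mu> * dist Y Y'" by (simp add: exp_minus)
    also have "\<dots> \<le> 1 / 2 * dist Y Y'"
      using \<mu> by (intro mult_right_mono) (auto simp: divide_le_eq)
    finally show "dist (\<Psi> Y t) (\<Psi> Y' t) \<le> 1 / 2 * dist Y Y'" .
  qed
  then have "\<exists>!Y. \<Psi> Y = Y"
    by (intro banach_fix_type[of "1/2"]) auto
  then obtain Y where Y: "\<Psi> Y = Y" by blast
  define X where "X t = exp (\<mu> * t) *\<^sub>R Y t" for t
  have Xeq: "X t = x0 + integral {0..t} (\<lambda>s. G (X s))" if "0 \<le> t" for t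
  proof -
    have "Y t = exp (- \<mu> * t) *\<^sub>R (x0 + integral {0..t} (?g Y))"
      using \<Psi>[of Y t] that unfolding Y \<Phi>_def by simp
    then show ?thesis unfolding X_def by (simp add: exp_minus)
  qed
  have GX: "continuous_on S (\<lambda>s. G (X s))" for S unfolding X_def using gc .
  show thesis
  proof
    show "X 0 = x0" using Xeq[of 0] by simp
    show "(X has_vector_derivative G (X t)) (at t within {0..T})" if "t \<in> {0..T}" for t T
    proof (rule has_vector_derivative_transform[OF that])
      show "((\<lambda>t. x0 + integral {0..t} (\<lambda>s. G (X s))) has_vector_derivative G (X t))
          (at t within {0..T})"
        using integral_has_vector_derivative[OF GX that] by (auto intro!: derivative_eq_intros)
    qed (use Xeq in auto)
  qed (use Xeq in auto)
qed

text \<open>The majorant \<open>a + c * integral {0..s} u\<close>, multiplied by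
  \<open>exp (- c * s)\<close>, has a nonpositive derivative, because \<open>u\<close> lies below
  the majorant.\<close>

lemma gronwall_integral:
  fixes u :: "real \<Rightarrow> real"
  assumes u: "continuous_on {0..T} u" "\<And>t. t \<in> {0..T} \<Longrightarrow> u t \<le> a + c * integral {0..t} u"
      and c: "c \<ge> 0"
    and t: "t \<in> {0..T}"
  shows "u t \<le> a * exp (c * t)"
proof -
  define w where "w s = exp (- c * s) * (a + c * integral {0..s} u)" for s
  have I: "((\<lambda>s. integral {0..s} u) has_real_derivative u s) (at s within {0..T})" if "s \<in> {0..T}"
      for s
    by (rule integral_has_real_derivative[OF u(1) that])
  have w': "(w has_real_derivative exp (- c * s) * (c * (u s - (a + c * integral {0..s} u))))
      (at s within {0..T})"
    if "s \<in> {0..T}" for s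
    unfolding w_def[abs_def] using I[OF that]
        by (auto intro!: derivative_eq_intros simp: algebra_simps)
  have wc: "continuous_on {0..T} w"
    using w' by (meson DERIV_continuous continuous_on_eq_continuous_within)
  have "w t \<le> w 0"
  proof (rule DERIV_nonpos_imp_decreasing_open[of 0 t w])
    show "0 \<le> t" using t by simp
    show "continuous_on {0..t} w" by (rule continuous_on_subset[OF wc]) (use t in auto)
    fix s assume s: "0 < s" "s < t"
    then have sT: "s \<in> {0..T}" using t by auto
    have "at s within {0..T} = at s" by (rule at_within_interior) (use s t in auto)
    then have "(w has_real_derivative exp (- c * s) * (c * (u s - (a + c * integral {0..s} u))))
        (at s)"
      using w'[OF sT] by simp
    moreover have "exp (- c * s) * (c * (u s - (a + c * integral {0..s} u))) \<le> 0"
      using u(2)[OF sT] c by (intro mult_nonneg_nonpos) auto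
    ultimately show "\<exists>y. (w has_real_derivative y) (at s) \<and> y \<le> 0" by blast
  qed
  then have "exp (- c * t) * (a + c * integral {0..t} u) \<le> a" by (simp add: w_def)
  then have "a + c * integral {0..t} u \<le> a * exp (c * t)"
    by (simp add: exp_minus field_simps)
  with u(2)[OF t] show ?thesis by linarith
qed

text \<open>The uniform bound on \<open>F'\<close> bounds all difference quotients by the mean value
  inequality. Constants are integrable for a probability measure, so dominated convergence applies
  along every sequence approaching \<open>t\<close>.\<close>

lemma has_real_derivative_prob_integral:
  fixes F F' :: "real \<Rightarrow> 'a \<Rightarrow> real"
  assumes P: "prob_space P" and ab: "t \<in> {a..b}"
    and D: "\<And>s z. s \<in> {a..b} \<Longrightarrow> ((\<lambda>s. F s z) has_real_derivative F' s z) (at s within {a..b})"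
    and K: "\<And>s z. s \<in> {a..b} \<Longrightarrow> \<bar>F' s z\<bar> \<le> K"
    and F: "\<And>s. s \<in> {a..b} \<Longrightarrow> integrable P (F s)" and F': "F' t \<in> borel_measurable P"
  shows "((\<lambda>s. \<integral>z. F s z \<partial>P) has_real_derivative (\<integral>z. F' t z \<partial>P)) (at t within {a..b})"
  unfolding has_field_derivative_iff tendsto_at_iff_sequentially
proof (intro allI impI)
  interpret prob_space P by (rule P)
  fix X :: "nat \<Rightarrow> real"
  assume X: "\<forall>i. X i \<in> {a..b} - {t}" "X \<longlonglongrightarrow> t"
  have Xn: "X n \<in> {a..b}" "X n \<noteq> t" for n using X by auto
  have Xlim: "filterlim X (at t within {a..b}) sequentially"
    using X by (auto simp: filterlim_at)
  have conv: "(\<lambda>n. \<integral>z. (F (X n) z - F t z) / (X n - t) \<partial>P) \<longlonglongrightarrow> (\<integral>z. F' t z \<partial>P)"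
  proof (rule integral_dominated_convergence[where w = "\<lambda>_. K"])
    show "(\<lambda>z. (F (X n) z - F t z) / (X n - t)) \<in> borel_measurable P" for n
      using F[OF Xn(1)[of n]] F[OF ab] by simp
    show "AE z in P. (\<lambda>n. (F (X n) z - F t z) / (X n - t)) \<longlonglongrightarrow> F' t z"
    proof (rule AE_I2)
      fix z
      have "((\<lambda>y. (F y z - F t z) / (y - t)) \<longlongrightarrow> F' t z) (at t within {a..b})"
        using D[OF ab, of z] by (simp add: has_field_derivative_iff)
      from filterlim_compose[OF this Xlim]
      show "(\<lambda>n. (F (X n) z - F t z) / (X n - t)) \<longlonglongrightarrow> F' t z" .
    qed
    show "AE z in P. norm ((F (X n) z - F t z) / (X n - t)) \<le> K" for n
    proof (rule AE_I2)
      fix z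
      have "norm (F (X n) z - F t z) \<le> K * norm (X n - t)"
        by (rule field_differentiable_bound[of "{a..b}" "\<lambda>s. F s z" "\<lambda>s. F' s z"])
          (use D K Xn ab in auto)
      then show "norm ((F (X n) z - F t z) / (X n - t)) \<le> K"
        using Xn(2)[of n] by (simp add: divide_le_eq)
    qed
  qed (use F' in auto)
  have q: "(\<integral>z. (F (X n) z - F t z) / (X n - t) \<partial>P)
      = ((\<integral>z. F (X n) z \<partial>P) - (\<integral>z. F t z \<partial>P)) / (X n - t)" for n
    using F[OF Xn(1)[of n]] F[OF ab] by simp
  show "((\<lambda>y. ((\<integral>z. F y z \<partial>P) - (\<integral>z. F t z \<partial>P)) / (y - t)) \<circ> X) \<longlonglongrightarrow> (\<integral>z. F' t z \<partial>P)"
    using conv unfolding o_def q .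
qed

text \<open>A test function is constrained only at nonnegative times, so no neighbourhood of a point
  with \<open>t = 0\<close> is available on which it vanishes. Its derivative is shown to be zero
  for \<open>t > 0\<close> far out, and then at \<open>t = 0\<close> by continuity.\<close>

lemma test_space_derivative_bound:
  fixes h :: "real \<times> 'a::euclidean_space \<Rightarrow> real"
  assumes "h \<in> test_space T"
  obtains D where "D \<ge> 0" "\<And>t z u. t \<in> {0..T} \<Longrightarrow> \<bar>frechet_derivative h (at (t, z)) u\<bar> \<le> D * norm u"
proof -
  obtain K where h: "smooth h" and K: "compact K" "\<forall>x\<in>{0..} \<times> UNIV - K. h x = 0"
    using assms by (auto simp: test_space_def)
  obtain R where R: "\<And>x. x \<in> K \<Longrightarrow> norm x \<le> R"
    using compact_imp_bounded[OF K(1)] unfolding bounded_iff by blast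
  have h0: "h (t, z) = 0" if "0 \<le> t" "R < norm z" for t z
  proof -
    have "norm z \<le> norm (t, z)" by (rule norm_snd_le)
    then have "(t, z) \<notin> K" using R[of "(t, z)"] that by auto
    then show ?thesis using K(2) that by auto
  qed
  obtain D where D: "D \<ge> 0" "\<And>x u. x \<in> {0..T} \<times> cball 0 R \<Longrightarrow> \<bar>frechet_derivative h (at x) u\<bar>
      \<le> D * norm u"
    using smooth_derivative_bound[OF h compact_Times[OF compact_Icc compact_cball]] by blast
  have pos: "frechet_derivative h (at (t, z)) u = 0" if "0 < t" "R < norm z" for t z u
  proof -
    have "(h has_derivative (\<lambda>_. 0)) (at (t, z))"
    proof (rule has_derivative_transform_within_open[of "\<lambda>_. 0" _ _ _ "{0<..} \<times> (- cball 0 R)"])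
      show "open ({0<..} \<times> - cball 0 R :: (real \<times> 'a) set)" by (intro open_Times) auto
    qed (use that h0 in auto)
    from frechet_derivative_at[OF this] show ?thesis by metis
  qed
  have zero: "frechet_derivative h (at (t, z)) u = 0" if t: "0 \<le> t" and z: "R < norm z" for t z u
  proof (rule continuous_constant_on_closure[of "{0<..<t+1}"
      "\<lambda>t. frechet_derivative h (at (t, z)) u" 0 t])
    show "continuous_on (closure {0<..<t+1}) (\<lambda>t. frechet_derivative h (at (t, z)) u)"
      by (intro smooth_derivative_continuous[OF h] continuous_intros)
  qed (use t pos[OF _ z] in auto)
  have "\<bar>frechet_derivative h (at (t, z)) u\<bar> \<le> D * norm u" if "t \<in> {0..T}" for t z u
    using D zero[of t z u] that by (cases "norm z \<le> R") auto
  with D(1) show thesis using that by blast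
qed

lemma bounded_linear_apply_bcontfun:
    "bounded_linear (\<lambda>X :: 'a::topological_space \<Rightarrow>\<^sub>C 'b::real_normed_vector. X z)"
  by (rule bounded_linear_intro[where K = 1]) (simp_all add: norm_bounded)

section \<open>The characteristic system\<close>

context mean_field
begin

text \<open>A flow driven by its own image measure. The initial condition is imposed only
  \<open>f0\<close>-almost everywhere: the flow is sought among bounded maps, and the identity is
  replaced outside the initial ball by a truncation.\<close>

definition is_flow :: "real \<Rightarrow> 'a measure \<Rightarrow> (real \<Rightarrow> 'a \<Rightarrow> 'a) \<Rightarrow> bool" where
  "is_flow T f0 X \<longleftrightarrow>
     (\<exists>\<rho>\<ge>0. \<forall>t\<in>{0..T}. \<forall>z. norm (X t z) \<le> \<rho>) \<and>
     (\<exists>M\<ge>0. \<forall>s\<in>{0..T}. \<forall>t\<in>{0..T}. \<forall>z. norm (X s z - X t z) \<le> M * \<bar>s - t\<bar>) \<and>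
     (\<forall>t\<in>{0..T}. continuous_on UNIV (X t)) \<and> (AE z in f0. X 0 z = z) \<and>
     (\<forall>t\<in>{0..T}. \<forall>z. ((\<lambda>s. X s z) has_vector_derivative drift (distr f0 borel (X t)) (X t z)) (at
         t within {0..T}))"

lemma flow_exists:
  assumes f0: "prob_space f0" "sets f0 = sets borel" "AE z in f0. norm z \<le> R0" and T: "T > 0"
  obtains X where "is_flow T f0 X"
proof -
  interpret prob_space f0 by (rule f0(1))
  note [measurable_cong] = f0(2)
  define R where "R = max R0 0"
  have R: "R \<ge> 0" by (simp add: R_def)
  \<comment> \<open>The bound that Gronwall's inequality gives up to time \<open>T\<close> from the
    growth constant alone. Truncating at this radius is therefore invisible to the solution.\<close>
  define \<rho> where "\<rho> = (R + 1) * exp (2 * C * T)"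
  have \<rho>: "\<rho> \<ge> 0" using R by (simp add: \<rho>_def)
  define \<pi> where "\<pi> = closest_point (cball (0::'a) \<rho>)"
  note \<pi> = cball_projection[OF \<rho>, where 'a='a, folded \<pi>_def]
  \<comment> \<open>A bounded initial map that agrees with the identity on the ball carrying
    \<open>f0\<close>.\<close>
  define p0 where "p0 = closest_point (cball (0::'a) R)"
  note p0 = cball_projection[OF R, where 'a='a, folded p0_def]
  obtain L where L: "L \<ge> 0" "\<And>x y. norm x \<le> 2 * \<rho> \<Longrightarrow> norm y \<le> 2 * \<rho> \<Longrightarrow> norm (B x - B y)
      \<le> L * norm (x - y)"
    using B_lipschitz[of "2 * \<rho>"] by blast
  have \<pi>2: "norm (\<pi> x - \<pi> y) \<le> 2 * \<rho>" for x y
    using norm_triangle_ineq4[of "\<pi> x" "\<pi> y"] \<pi>(1)[of x] \<pi>(1)[of y] by linarith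
  \<comment> \<open>Truncating both points separately makes the kernel bounded and globally
    Lipschitz, with growth constant still \<open>C\<close>.\<close>
  define b where "b x y = B (\<pi> x - \<pi> y)" for x y
  have b_lip: "norm (b x y - b x' y') \<le> L * (norm (x - x') + norm (y - y'))" for x y x' y'
  proof -
    have "norm (b x y - b x' y') \<le> L * norm ((\<pi> x - \<pi> y) - (\<pi> x' - \<pi> y'))"
      unfolding b_def by (rule L(2)[OF \<pi>2 \<pi>2])
    also have "\<dots> \<le> L * (norm (x - x') + norm (y - y'))"
    proof (rule mult_left_mono[OF _ L(1)])
      have "norm ((\<pi> x - \<pi> y) - (\<pi> x' - \<pi> y')) = norm ((\<pi> x - \<pi> x') - (\<pi> y - \<pi> y'))"
          by (simp add: algebra_simps)
      also have "\<dots> \<le> norm (\<pi> x - \<pi> x') + norm (\<pi> y - \<pi> y')" by (rule norm_triangle_ineq4)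
      finally show "norm ((\<pi> x - \<pi> y) - (\<pi> x' - \<pi> y')) \<le> norm (x - x') + norm (y - y')"
        using \<pi>(2)[of x x'] \<pi>(2)[of y y'] by linarith
    qed
    finally show ?thesis .
  qed
  have b_growth: "norm (b x y) \<le> C * (1 + norm x + norm y)" for x y
  proof -
    have "C * (1 + norm (\<pi> x) + norm (\<pi> y)) \<le> C * (1 + norm x + norm y)"
      using \<pi>(4)[of x] \<pi>(4)[of y] by (intro mult_left_mono C_nonneg) linarith
    then show ?thesis using B_diff_growth[of "\<pi> x" "\<pi> y"] unfolding b_def by linarith
  qed
  have b_bound: "norm (b x y) \<le> C * (1 + 2 * \<rho>)" for x y
  proof -
    have "C * (1 + norm (\<pi> x) + norm (\<pi> y)) \<le> C * (1 + 2 * \<rho>)"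
      using \<pi>(1)[of x] \<pi>(1)[of y] by (intro mult_left_mono C_nonneg) linarith
    then show ?thesis using B_diff_growth[of "\<pi> x" "\<pi> y"] unfolding b_def by linarith
  qed
  define g where "g X z = (\<integral>w. b (X z) (X w) \<partial>f0)" for X :: "'a \<Rightarrow>\<^sub>C 'a" and z
  have b_int: "integrable f0 (\<lambda>w. b x (X w))" for X :: "'a \<Rightarrow>\<^sub>C 'a" and x
  proof (rule integrable_const_bound[of _ "C * (1 + 2 * \<rho>)"])
    have "continuous_on UNIV (\<lambda>w. b x (X w))"
      unfolding b_def by (intro continuous_on_compose2[OF B_continuous[of UNIV]] continuous_intros
          continuous_on_compose2[OF \<pi>(5)[of UNIV]]) auto
    then show "(\<lambda>w. b x (X w)) \<in> borel_measurable f0"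
      using borel_measurable_continuous_onI by (simp add: measurable_cong_sets[OF f0(2) refl])
  qed (use b_bound in auto)
  \<comment> \<open>For \<open>X = Y\<close> this bound yields continuity in the point, and for
    \<open>z = z'\<close> the Lipschitz estimate in the map.\<close>
  have g_lip: "norm (g X z - g Y z') \<le> L * (norm (X z - Y z') + norm (X - Y))" for X Y z z'
  proof -
    have "norm (\<integral>w. b (X z) (X w) - b (Y z') (Y w) \<partial>f0) \<le> L * (norm (X z - Y z') + norm (X - Y))"
    proof (rule norm_integral_le_const)
      show "AE w in f0. norm (b (X z) (X w) - b (Y z') (Y w))
          \<le> L * (norm (X z - Y z') + norm (X - Y))"
      proof (rule AE_I2)
        fix w
        have "norm (X w - Y w) \<le> norm (X - Y)" using norm_bounded[of "X - Y" w] by simp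
        then have "L * (norm (X z - Y z') + norm (X w - Y w))
            \<le> L * (norm (X z - Y z') + norm (X - Y))"
          by (intro mult_left_mono L(1)) simp
        then show "norm (b (X z) (X w) - b (Y z') (Y w)) \<le> L * (norm (X z - Y z') + norm (X - Y))"
          using b_lip[of "X z" "X w" "Y z'" "Y w"] by linarith
      qed
    qed (intro Bochner_Integration.integrable_diff b_int)
    then show ?thesis unfolding g_def by (simp add: b_int)
  qed
  have g_bound: "norm (g X z) \<le> C * (1 + 2 * \<rho>)" for X z
    unfolding g_def by (rule norm_integral_le_const[OF b_int]) (use b_bound in auto)
  have g_cont: "continuous_on UNIV (g X)" for X
    unfolding continuous_on_def
  proof
    fix z
    have "((\<lambda>y. L * norm (X y - X z)) \<longlongrightarrow> L * norm (X z - X z)) (at z)"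
      using continuous_on_apply_bcontfun[of UNIV X]
          by (intro tendsto_intros) (auto simp: continuous_on_def)
    then have lim: "((\<lambda>y. L * norm (X y - X z)) \<longlongrightarrow> 0) (at z)" by simp
    have "((\<lambda>y. g X y - g X z) \<longlongrightarrow> 0) (at z)"
      by (rule Lim_null_comparison[OF _ lim])
          (use g_lip[of X _ X z] in \<open>auto intro!: always_eventually\<close>)
    then show "(g X \<longlongrightarrow> g X z) (at z within UNIV)" by (simp add: LIM_zero_cancel)
  qed
  define G where "G X = Bcontfun (g X)" for X
  have G: "apply_bcontfun (G X) z = g X z" for X z
    unfolding G_def using Bcontfun_inverse[OF bcontfun_normI[OF g_cont g_bound]] by simp
  have G_lip: "norm (G X - G Y) \<le> (2 * L) * norm (X - Y)" for X Y
  proof (rule norm_bound)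
    fix z
    have "norm (X z - Y z) \<le> norm (X - Y)" using norm_bounded[of "X - Y" z] by simp
    then have "L * (norm (X z - Y z) + norm (X - Y)) \<le> L * (2 * norm (X - Y))"
      by (intro mult_left_mono L(1)) simp
    then show "norm ((G X - G Y) z) \<le> (2 * L) * norm (X - Y)"
      using g_lip[of X z Y z] by (simp add: G)
  qed
  have G_bound: "norm (G X) \<le> C * (1 + 2 * \<rho>)" for X
    by (rule norm_bound) (simp add: G g_bound)
  \<comment> \<open>A second bound, free of \<open>\<rho>\<close>: the bound \<open>G_bound\<close>
    contains \<open>\<rho>\<close> and would make the a priori estimate circular.\<close>
  have G_growth: "norm (G X) \<le> 2 * C * (1 + norm X)" for X
  proof (rule norm_bound)
    fix z
    have "norm (g X z) \<le> 2 * C * (1 + norm X)"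
      unfolding g_def
    proof (rule norm_integral_le_const[OF b_int], rule AE_I2)
      fix w
      have "C * (1 + norm (X z) + norm (X w)) \<le> C * (2 * (1 + norm X))"
        using norm_bounded[of X z] norm_bounded[of X w] by (intro mult_left_mono C_nonneg) simp
      then show "norm (b (X z) (X w)) \<le> 2 * C * (1 + norm X)"
        using b_growth[of "X z" "X w"] by (simp add: mult.assoc mult.left_commute)
    qed
    then show "norm (G X z) \<le> 2 * C * (1 + norm X)" by (simp add: G)
  qed
  define x0 where "x0 = Bcontfun p0"
  have x0: "apply_bcontfun x0 z = p0 z" for z
    unfolding x0_def using Bcontfun_inverse[OF bcontfun_normI[OF p0(5) p0(1)]] by simp
  have "0 \<le> 2 * L" using L(1) by simp
  from bounded_lipschitz_ode[OF this G_lip G_bound, of x0]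
  obtain X where X: "X 0 = x0" "\<And>T t. t \<in> {0..T}
      \<Longrightarrow> (X has_vector_derivative G (X t)) (at t within {0..T})"
    "\<And>t. 0 \<le> t \<Longrightarrow> X t = x0 + integral {0..t} (\<lambda>s. G (X s))"
    by blast
  have Xc: "continuous_on {0..T} X"
    using X(2) by (meson has_vector_derivative_continuous continuous_on_eq_continuous_within)
  have GXc: "continuous_on {0..T} (\<lambda>s. G (X s))"
    by (rule continuous_on_compose2[OF lipschitz_on_continuous_on[of "2 * L" UNIV G] Xc])
      (use G_lip L(1) in \<open>auto simp: lipschitz_on_def dist_norm\<close>)
  have Xbound: "norm (X t) \<le> \<rho>" if t: "t \<in> {0..T}" for t
  proof -
    have "1 + norm (X t) \<le> (R + 1) * exp (2 * C * t)"
    proof (rule gronwall_integral[of T "\<lambda>t. 1 + norm (X t)", OF _ _ _ t])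
      show "continuous_on {0..T} (\<lambda>t. 1 + norm (X t))" by (intro continuous_intros Xc)
      fix s assume s: "s \<in> {0..T}"
      have sub: "{0..s} \<subseteq> {0..T}" using s by auto
      have "norm (integral {0..s} (\<lambda>s. G (X s))) \<le> integral {0..s} (\<lambda>s. 2 * C * (1 + norm (X s)))"
        by (rule integral_norm_bound_integral)
          (auto intro!: integrable_continuous_real continuous_intros continuous_on_subset[OF Xc sub]
            continuous_on_subset[OF GXc sub] G_growth)
      moreover have "norm x0 \<le> R" by (rule norm_bound) (simp add: x0 p0)
      moreover have "norm (X s) \<le> norm x0 + norm (integral {0..s} (\<lambda>s. G (X s)))"
        using X(3)[of s] s norm_triangle_ineq by simp
      ultimately show "1 + norm (X s) \<le> R + 1 + 2 * C * integral {0..s} (\<lambda>t. 1 + norm (X t))"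
        by simp
    qed (use C_nonneg in auto)
    also have "\<dots> \<le> \<rho>"
      using t C_nonneg R by (auto simp: \<rho>_def intro!: mult_left_mono)
    finally show ?thesis by simp
  qed
  have inball: "norm (X t z) \<le> \<rho>" if "t \<in> {0..T}" for t z
    using norm_bounded[of "X t" z] Xbound[OF that] by linarith
  \<comment> \<open>Here the truncation disappears, since all trajectories stay in the ball on which
    \<open>\<pi>\<close> is the identity.\<close>
  have drift_eq: "drift (distr f0 borel (X t)) (X t z) = G (X t) z" if t: "t \<in> {0..T}" for t z
  proof -
    have [measurable]: "apply_bcontfun (X t) \<in> borel_measurable borel"
      by (rule borel_measurable_continuous_onI) simp
    have [measurable]: "B \<in> borel_measurable borel"
      by (rule borel_measurable_continuous_onI[OF B_continuous])
    have "drift (distr f0 borel (X t)) (X t z) = (\<integral>w. B (X t z - X t w) \<partial>f0)"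
      unfolding drift_def by (subst integral_distr) auto
    also have "\<dots> = (\<integral>w. b (X t z) (X t w) \<partial>f0)"
      unfolding b_def using \<pi>(3)[OF inball[OF t]] by simp
    finally show ?thesis by (simp add: G g_def)
  qed
  have "is_flow T f0 (\<lambda>t. apply_bcontfun (X t))"
    unfolding is_flow_def
  proof (intro conjI ballI allI)
    show "\<exists>\<rho>\<ge>0. \<forall>t\<in>{0..T}. \<forall>z. norm (X t z) \<le> \<rho>" using inball \<rho> by blast
    show "\<exists>M\<ge>0. \<forall>s\<in>{0..T}. \<forall>t\<in>{0..T}. \<forall>z. norm (X s z - X t z) \<le> M * \<bar>s - t\<bar>"
    proof (intro exI[of _ "C * (1 + 2 * \<rho>)"] conjI ballI allI)
      show "0 \<le> C * (1 + 2 * \<rho>)" using C_nonneg \<rho> by simp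
      fix s t z assume st: "s \<in> {0..T}" "t \<in> {0..T}"
      have "norm (X s - X t) \<le> C * (1 + 2 * \<rho>) * norm (s - t)"
      proof (rule differentiable_bound[of "{0..T}" X "\<lambda>t x. x *\<^sub>R G (X t)"])
        show "(X has_derivative (\<lambda>x. x *\<^sub>R G (X r))) (at r within {0..T})" if "r \<in> {0..T}" for r
          using X(2)[OF that] by (simp add: has_vector_derivative_def)
        show "onorm (\<lambda>x. x *\<^sub>R G (X r)) \<le> C * (1 + 2 * \<rho>)" for r
          by (rule onorm_le) (use mult_left_mono[OF G_bound[of "X r"] abs_ge_zero] in \<open>simp add:
              mult.commute\<close>)
      qed (use st in auto)
      then show "norm (X s z - X t z) \<le> C * (1 + 2 * \<rho>) * \<bar>s - t\<bar>"
        using norm_bounded[of "X s - X t" z] by simp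
    qed
    show "AE z in f0. X 0 z = z"
      using f0(3) by eventually_elim (auto simp: X(1) x0 R_def intro!: p0(3))
    show "((\<lambda>s. X s z) has_vector_derivative drift (distr f0 borel (X t)) (X t z))
        (at t within {0..T})"
      if "t \<in> {0..T}" for t z
      unfolding drift_eq[OF that]
      by (rule bounded_linear.has_vector_derivative[OF bounded_linear_apply_bcontfun X(2)[OF that]])
  qed simp
  then show thesis using that by blast
qed

lemma is_flow_subset:
  assumes "is_flow T f0 X" "S \<le> T"
  shows "is_flow S f0 X"
proof -
  have sub: "{0..S} \<subseteq> {0..T}" using assms by auto
  note X = assms(1)[unfolded is_flow_def]
  show ?thesis
    unfolding is_flow_def
  proof (intro conjI ballI allI)
    show "\<exists>\<rho>\<ge>0. \<forall>t\<in>{0..S}. \<forall>z. norm (X t z) \<le> \<rho>"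
      using X sub by (meson subsetD)
    show "\<exists>M\<ge>0. \<forall>s\<in>{0..S}. \<forall>t\<in>{0..S}. \<forall>z. norm (X s z - X t z) \<le> M * \<bar>s - t\<bar>"
      using X sub by (meson subsetD)
    show "AE z in f0. X 0 z = z" using X by blast
    fix t assume "t \<in> {0..S}"
    then have t: "t \<in> {0..T}" using sub by blast
    show "continuous_on UNIV (X t)" using X t by blast
    have "((\<lambda>s. X s z) has_vector_derivative drift (distr f0 borel (X t)) (X t z))
        (at t within {0..T})" for z
      using X t by blast
    then show "((\<lambda>s. X s z) has_vector_derivative drift (distr f0 borel (X t)) (X t z))
        (at t within {0..S})" for z
      by (rule has_vector_derivative_within_subset[OF _ sub])
  qed
qed

text \<open>The function \<open>h (t, X t z)\<close> is differentiable in time with the integrand of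
  the rate as derivative. Integration over \<open>f0\<close> and then over time leaves only the
  boundary terms.\<close>

lemma is_flow_weak_sol:
  assumes f0: "prob_space f0" "sets f0 = sets borel" and X: "is_flow T f0 X" and T: "T > 0"
  shows "weak_sol T f0 (\<lambda>t. distr f0 borel (X t))"
proof -
  interpret prob_space f0 by (rule f0(1))
  note [measurable_cong] = f0(2)
  let ?f = "\<lambda>t. distr f0 borel (X t)"
  have "\<exists>\<rho>\<ge>0. \<forall>t\<in>{0..T}. \<forall>z. norm (X t z) \<le> \<rho>"
    using X unfolding is_flow_def by (elim conjE)
  then obtain \<rho> where \<rho>: "\<rho> \<ge> 0" "\<And>t z. t \<in> {0..T} \<Longrightarrow> norm (X t z) \<le> \<rho>"
    by blast
  have "\<exists>M\<ge>0. \<forall>s\<in>{0..T}. \<forall>t\<in>{0..T}. \<forall>z. norm (X s z - X t z) \<le> M * \<bar>s - t\<bar>"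
    using X unfolding is_flow_def by (elim conjE)
  then obtain M where M: "M \<ge> 0" "\<And>s t z. s \<in> {0..T} \<Longrightarrow> t \<in> {0..T} \<Longrightarrow> norm (X s z - X t z)
      \<le> M * \<bar>s - t\<bar>"
    by blast
  have Xc: "continuous_on UNIV (X t)" if "t \<in> {0..T}" for t using X that unfolding is_flow_def
      by blast
  have Xm: "X t \<in> borel_measurable borel" if "t \<in> {0..T}" for t
    by (rule borel_measurable_continuous_onI[OF Xc[OF that]])
  have X0: "AE z in f0. X 0 z = z" using X unfolding is_flow_def by blast
  have XD: "((\<lambda>s. X s z) has_vector_derivative drift (?f t) (X t z)) (at t within {0..T})"
      if "t \<in> {0..T}" for t z
    using X that unfolding is_flow_def by blast
  have fP: "?f t \<in> P2" if t: "t \<in> {0..T}" for t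
  proof -
    note [measurable] = Xm[OF t]
    have "prob_space (?f t)" by (rule prob_space_distr) simp
    moreover have "integrable f0 (\<lambda>z. (norm (X t z))\<^sup>2)"
      by (rule integrable_const_bound[of _ "\<rho>\<^sup>2"]) (auto intro!: AE_I2 power_mono \<rho>(2)[OF t])
    then have "integrable (?f t) (\<lambda>z. (norm z)\<^sup>2)" by (subst integrable_distr_eq) auto
    ultimately show ?thesis by (simp add: P2_def)
  qed
  have W2: "W2 (?f s) (?f t) \<le> M * \<bar>s - t\<bar>" if s: "s \<in> {0..T}" and t: "t \<in> {0..T}" for s t
  proof -
    note [measurable] = Xm[OF s] Xm[OF t] borel_measurable_fst[where 'a='a
        and 'b='a] borel_measurable_snd[where 'a='a and 'b='a]
    have [measurable]: "(\<lambda>z. (X s z, X t z)) \<in> borel_measurable f0"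
      by (rule borel_measurable_Pair) measurable
    \<comment> \<open>Following each point from time \<open>s\<close> to time \<open>t\<close> is a
      coupling, with displacement at most \<open>M * \<bar>s - t\<bar>\<close>.\<close>
    let ?\<gamma> = "distr f0 borel (\<lambda>z. (X s z, X t z))"
    have "?\<gamma> \<in> couplings (?f s) (?f t)"
      unfolding couplings_def
      by (auto simp: distr_distr o_def intro!: prob_space_distr)
    then show ?thesis
    proof (rule W2_le_coupling)
      have "(\<integral>z. (dist (fst z) (snd z))\<^sup>2 \<partial>?\<gamma>) = (\<integral>z. (dist (X s z) (X t z))\<^sup>2 \<partial>f0)"
        by (subst integral_distr) auto
      also have "\<dots> \<le> \<bar>\<dots>\<bar>" by simp
      also have "\<dots> \<le> (M * \<bar>s - t\<bar>)\<^sup>2"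
        by (rule integral_abs_le_const)
            (use M(2)[OF s t] in \<open>auto simp: dist_norm intro!: power_mono\<close>)
      finally show "(\<integral>z. (dist (fst z) (snd z))\<^sup>2 \<partial>?\<gamma>) \<le> (M * \<bar>s - t\<bar>)\<^sup>2" .
    qed (use M in simp)
  qed
  have fc: "P2_continuous_on {0..T} ?f"
    unfolding P2_continuous_on_def
  proof (intro conjI ballI fP)
    fix t assume t: "t \<in> {0..T}"
    have "((\<lambda>s. M * \<bar>s - t\<bar>) \<longlongrightarrow> M * \<bar>t - t\<bar>) (at t within {0..T})" by (intro tendsto_intros)
    then have lim: "((\<lambda>s. M * \<bar>s - t\<bar>) \<longlongrightarrow> 0) (at t within {0..T})" by simp
    show "((\<lambda>s. W2 (?f s) (?f t)) \<longlongrightarrow> 0) (at t within {0..T})"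
      by (rule Lim_null_comparison[OF _ lim])
        (use W2 W2_nonneg[OF fP fP] t in \<open>auto simp: eventually_at_filter intro!:
            always_eventually\<close>)
  qed
  have supp: "AE z in ?f t. norm z \<le> \<rho>" if t: "t \<in> {0..T}" for t
    using \<rho>(2)[OF t] Xm[OF t] by (subst AE_distr_iff) auto
  show ?thesis
    unfolding weak_sol_def
  proof (intro conjI fc ballI)
    fix h :: "real \<times> 'a \<Rightarrow> real" assume hT: "h \<in> test_space T"
    then obtain K where h: "smooth h"
        and K: "compact K" "K \<subseteq> {0..<T} \<times> UNIV" "\<forall>x\<in>{0..} \<times> UNIV - K. h x = 0"
      by (auto simp: test_space_def)
    obtain D where D: "D \<ge> 0" "\<And>x u. x \<in> {0..T} \<times> cball 0 \<rho> \<Longrightarrow> \<bar>frechet_derivative h (at x) u\<bar>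
        \<le> D * norm u"
      using smooth_derivative_bound[OF h compact_Times[OF compact_Icc compact_cball]] by blast
    define F where "F t z = h (t, X t z)" for t z
    define F' where "F' t z = frechet_derivative h (at (t, X t z)) (1, drift (?f t) (X t z))"
        for t z
    have FD: "((\<lambda>s. F s z) has_real_derivative F' t z) (at t within {0..T})" if t: "t \<in> {0..T}"
        for t z
    proof -
      have "((\<lambda>s. (s, X s z)) has_vector_derivative (1, drift (?f t) (X t z))) (at t within {0..T})"
        by (intro has_vector_derivative_Pair has_vector_derivative_id XD t)
      then have "((\<lambda>s. (s, X s z)) has_derivative (\<lambda>x. x *\<^sub>R (1, drift (?f t) (X t z))))
          (at t within {0..T})"
        by (simp add: has_vector_derivative_def)
      from has_derivative_compose[OF this smoothD[OF h]]
      have "((\<lambda>s. F s z) has_derivative (\<lambda>x. frechet_derivative h (at (t, X t z)) (x *\<^sub>R (1, drift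
          (?f t) (X t z))))) (at t within {0..T})"
        unfolding F_def .
      then show ?thesis
        by (simp add: has_field_derivative_def F'_def linear_scale[OF has_derivative_linear[OF
            smoothD[OF h]], simplified] mult_commute_abs del: scaleR_Pair)
    qed
    have F'K: "\<bar>F' t z\<bar> \<le> D * (1 + C * (1 + 2 * \<rho>))" if t: "t \<in> {0..T}" for t z
    proof -
      have "\<bar>F' t z\<bar> \<le> D * norm (1::real, drift (?f t) (X t z))"
        unfolding F'_def by (rule D(2)) (use t \<rho> in auto)
      also have "\<dots> \<le> D * (1 + C * (1 + 2 * \<rho>))"
        using norm_Pair_le[of "1::real" "drift (?f t) (X t z)"]
            drift_bounded_on_cball[OF fP[OF t] supp[OF t] \<rho>(2)[OF t], of z]
        by (intro mult_left_mono D(1)) auto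
      finally show ?thesis .
    qed
    have hm: "(\<lambda>y. h (t, y)) \<in> borel_measurable borel" for t
      by (intro borel_measurable_continuous_onI continuous_on_compose2[OF smooth_continuous[OF h,
          of UNIV]] continuous_intros) auto
    have Fi: "integrable f0 (F t)" if t: "t \<in> {0..T}" for t
    proof -
      have "compact (h ` ({0..T} \<times> cball 0 \<rho>))"
        by (intro compact_continuous_image smooth_continuous h compact_Times) auto
      from compact_imp_bounded[OF this] obtain H where "\<And>x. x \<in> {0..T} \<times> cball 0 \<rho> \<Longrightarrow> \<bar>h x\<bar> \<le> H"
        unfolding bounded_iff by auto
      then have "\<bar>F t z\<bar> \<le> H" for z using t \<rho> by (auto simp: F_def)
      moreover have "F t \<in> borel_measurable f0"
        unfolding F_def[abs_def] using measurable_compose[OF Xm[OF t] hm]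
            by (simp add: measurable_cong_sets[OF f0(2) refl])
      ultimately show ?thesis by (intro integrable_const_bound[of _ H]) auto
    qed
    have F'm: "F' t \<in> borel_measurable f0" if t: "t \<in> {0..T}" for t
      unfolding F'_def[abs_def]
          using measurable_compose[OF Xm[OF t] rate_integrand_measurable[OF fP[OF t] h]]
      by (simp add: measurable_cong_sets[OF f0(2) refl])
    have rate: "rate h (?f t) t = (\<integral>z. F' t z \<partial>f0)" if t: "t \<in> {0..T}" for t
      unfolding rate_def F'_def
      using rate_integrand_measurable[OF fP[OF t] h] Xm[OF t] by (subst integral_distr) auto
    define u where "u t = (\<integral>z. F t z \<partial>f0)" for t
    have "(u has_real_derivative rate h (?f t) t) (at t within {0..T})" if t: "t \<in> {0..T}" for t
      unfolding u_def rate[OF t]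
      by (rule has_real_derivative_prob_integral[OF f0(1) t FD F'K Fi F'm[OF t]])
    then have "((\<lambda>t. rate h (?f t) t) has_integral (u T - u 0)) {0..T}"
      using T by (intro fundamental_theorem_of_calculus)
          (auto simp: has_real_derivative_iff_has_vector_derivative)
    \<comment> \<open>The support of a test function lies strictly before \<open>T\<close>, so the
      upper boundary term vanishes.\<close>
    moreover have "u T = 0"
    proof -
      have "F T z = 0" for z
        unfolding F_def using K T by (intro bspec[OF K(3)]) auto
      then show ?thesis by (simp add: u_def)
    qed
    moreover have "u 0 = (\<integral>z. h (0, z) \<partial>f0)"
      unfolding u_def
    proof (rule integral_cong_AE)
      show "F 0 \<in> borel_measurable f0" using Fi[of 0] T by simp
      show "(\<lambda>z. h (0, z)) \<in> borel_measurable f0" using hm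
          by (simp add: measurable_cong_sets[OF f0(2) refl])
      show "AE z in f0. F 0 z = h (0, z)" using X0 by eventually_elim (simp add: F_def)
    qed
    ultimately have "integral {0..T} (\<lambda>t. rate h (?f t) t) = - (\<integral>z. h (0, z) \<partial>f0)"
      by (simp add: integral_unique)
    moreover have "(LINT t:{0..T}|lborel. rate h (?f t) t) = integral {0..T} (\<lambda>t. rate h (?f t) t)"
    proof (rule set_borel_integral_eq_integral)
      obtain D' where "D' \<ge> 0" "\<And>t z u. t \<in> {0..T} \<Longrightarrow> \<bar>frechet_derivative h (at (t, z)) u\<bar>
          \<le> D' * norm u"
        using test_space_derivative_bound[OF hT] by blast
      from rate_continuous[OF fc less_imp_le[OF T] h this]
      have "continuous_on {0..T} (\<lambda>t. rate h (?f t) t)" .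
      then show "set_integrable lborel {0..T} (\<lambda>t. rate h (?f t) t)"
        unfolding set_integrable_def by (intro borel_integrable_compact) auto
    qed
    ultimately show "(LINT t:{0..T}|lborel. rate h (?f t) t) + (\<integral>z. h (0, z) \<partial>f0) = 0" by simp
  qed
qed

end


section \<open>The interaction kernel of the particle system\<close>

text \<open>Since \<open>gradient\<close> is a definite description, it is identified by exhibiting
  the Riesz vector of \<open>D\<close> in the basis and proving that it is the only one.\<close>

lemma GDERIV_gradient:
  fixes f :: "'a::euclidean_space \<Rightarrow> real"
  assumes D: "(f has_derivative D) (at x)"
  shows "w \<bullet> gradient f x = D w"
proof -
  define G where "G = (\<Sum>i\<in>Basis. D i *\<^sub>R i)"
  have "D w = w \<bullet> G" for w
    unfolding G_def inner_sum_right
    by (subst linear_sum_Basis[OF has_derivative_linear[OF D]]) (simp add: mult.commute)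
  then have *: "D = (\<lambda>w. w \<bullet> G)" by blast
  have "(THE D. GDERIV f x :> D) = G"
  proof (rule the_equality)
    show "GDERIV f x :> G" using D * by (simp add: gderiv_def)
    show "H = G" if "GDERIV f x :> H" for H
    proof -
      have "(\<lambda>w. w \<bullet> H) = (\<lambda>w. w \<bullet> G)"
        using that D * has_derivative_unique unfolding gderiv_def by metis
      then show ?thesis by (metis vector_eq_ldot)
    qed
  qed
  then show ?thesis by (simp add: gradient_def *)
qed

lemma gradient_has_derivative:
  fixes f :: "'a::euclidean_space \<Rightarrow> real"
  assumes "f differentiable (at x)"
  shows "(f has_derivative (\<lambda>w. w \<bullet> gradient f x)) (at x)"
proof -
  obtain D where D: "(f has_derivative D) (at x)" using assms by (auto simp: differentiable_def)
  have "D = (\<lambda>w. w \<bullet> gradient f x)" using GDERIV_gradient[OF D] by auto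
  with D show ?thesis by simp
qed

definition pair_force :: "(real \<Rightarrow> real) \<Rightarrow> (real^'d \<Rightarrow> real) \<Rightarrow> real^'d \<Rightarrow> real^'d \<Rightarrow> real^'d" where
  "pair_force \<psi> V r v = \<psi> (norm r) *\<^sub>R v + gradient V r"

definition interaction :: "(real \<Rightarrow> real) \<Rightarrow> (real^'d \<Rightarrow> real) \<Rightarrow> (real^'d) \<times> (real^'d) \<Rightarrow> (real^'d) \<times>
    (real^'d)" where
  "interaction \<psi> V z = (snd z, - pair_force \<psi> V (fst z) (snd z))"

text \<open>Restricted to \<open>{..<2}\<close> because the points of a
  \<open>product_topology\<close> are extensional functions.\<close>

definition two_config :: "real^'d \<Rightarrow> nat \<Rightarrow> real^'d" where
  "two_config a = (\<lambda>j\<in>{..<2}. if j = 1 then a else 0)"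

lemma lessThan_two: "{..<2::nat} = {0, 1}"
  by auto

lemma config_two_config:
  "config_norm 2 (two_config a) = norm a" "config_dist 2 (two_config a) (two_config b) = dist a b"
  by (simp_all add: config_norm_def config_dist_def L2_set_def two_config_def lessThan_two)

text \<open>Particle 0 exerts no force on itself, and oddness turns the subtracted
  \<open>gradient V (- a)\<close> into \<open>gradient V a\<close>. The factor is
  \<open>1 / N\<close> for two particles.\<close>

lemma force_two_config:
  assumes "gradient V (- a) = - gradient V a" "gradient V 0 = 0"
  shows "force \<psi> V 2 0 (two_config a) (two_config b) = (1 / 2) *\<^sub>R pair_force \<psi> V a b"
  using assms by (simp add: force_def two_config_def lessThan_two pair_force_def scaleR_add_right)

lemma continuous_map_two_config:
    "continuous_map euclidean (product_topology (\<lambda>_. euclidean) {..<2}) two_config"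
  unfolding continuous_map_componentwise
proof (intro conjI ballI)
  show "two_config ` topspace euclidean \<subseteq> extensional {..<2}" by (auto simp: two_config_def)
  fix k :: nat assume "k \<in> {..<2}"
  then show "continuous_map euclidean euclidean (\<lambda>x :: real^'d. two_config x k)"
    by (simp add: two_config_def)
qed

text \<open>Putting one of two particles at the origin at rest, the assumptions on the forces
  become statements about the pair force.\<close>

lemma standing_assumptions_pair_force:
  fixes V :: "real^'d \<Rightarrow> real"
  assumes st: "standing_assumptions \<psi> V"
  obtains C where "C \<ge> 0" "\<And>a b. norm (pair_force \<psi> V a b) \<le> C * (1 + norm a + norm b)"
    "\<And>R. \<exists>L\<ge>0. \<forall>a b a' b'. norm a \<le> R \<longrightarrow> norm b \<le> R \<longrightarrow> norm a' \<le> R \<longrightarrow> norm b' \<le> R \<longrightarrow>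
       norm (pair_force \<psi> V a b - pair_force \<psi> V a' b') \<le> L * norm ((a, b) - (a', b'))"
proof -
  have odd: "gradient V (- a) = - gradient V a" for a using st
      by (simp add: standing_assumptions_def)
  have "gradient V 0 = 0"
  proof -
    have "gradient V 0 = - gradient V 0" using odd[of 0] by simp
    then show ?thesis by (simp add: eq_neg_iff_add_eq_0 scaleR_2[symmetric])
  qed
  note fc = force_two_config[OF odd this]
  have top: "(two_config a, two_config b) \<in> topspace (phase_space 2)" for a b :: "real^'d"
    by (auto simp: phase_space_def two_config_def)
  have st2: "(\<exists>C>0. \<forall>i<2. \<forall>(x, v) \<in> topspace (phase_space 2).
           norm (force \<psi> V 2 i x v) \<le> C * (1 + config_norm 2 x + config_norm 2 v))"
    "\<forall>K. compactin (phase_space 2) K \<longrightarrow>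
           (\<exists>L. \<forall>i<2. \<forall>(x, v) \<in> K. \<forall>(y, w) \<in> K.
              norm (force \<psi> V 2 i x v - force \<psi> V 2 i y w)
                \<le> L * sqrt ((config_dist 2 x y)\<^sup>2 + (config_dist 2 v w)\<^sup>2))"
    using st unfolding standing_assumptions_def by (meson order_refl)+
  from st2(1) obtain C where C: "C > 0" "\<And>x v. (x, v) \<in> topspace (phase_space 2) \<Longrightarrow>
      norm (force \<psi> V 2 0 x v) \<le> C * (1 + config_norm 2 x + config_norm 2 v)"
    by fastforce
  show thesis
  proof (rule that[of "2 * C"])
    show "0 \<le> 2 * C" using C by simp
    show "norm (pair_force \<psi> V a b) \<le> 2 * C * (1 + norm a + norm b)" for a b
      using C(2)[OF top, of a b] by (simp add: fc config_two_config)
    fix R :: real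
    define K where "K = (\<lambda>(a, b). (two_config a, two_config b)) `
        (cball (0::real^'d) R \<times> cball (0::real^'d) R)"
    have "continuous_map euclidean (phase_space 2)
        (\<lambda>(a, b). (two_config a, two_config b :: nat \<Rightarrow> real^'d))"
      unfolding phase_space_def continuous_map_pairwise split_beta o_def
      by (auto intro!: continuous_map_compose[OF _ continuous_map_two_config, unfolded o_def]
          continuous_intros)
    moreover have "compactin euclidean (cball (0::real^'d) R \<times> cball (0::real^'d) R)"
      by (simp add: compact_Times)
    ultimately have "compactin (phase_space 2) K"
      unfolding K_def using image_compactin by blast
    with st2(2) obtain L where L: "\<forall>i<2. \<forall>(x, v) \<in> K. \<forall>(y, w) \<in> K.
              norm (force \<psi> V 2 i x v - force \<psi> V 2 i y w) \<le> L * sqrt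
                  ((config_dist 2 x y)\<^sup>2 + (config_dist 2 v w)\<^sup>2)"
      by blast
    \<comment> \<open>The factor 2 undoes the \<open>1 / 2\<close> of the force; \<open>max\<close>
      is taken because the constant from the assumption has no prescribed sign.\<close>
    have "norm (pair_force \<psi> V a b - pair_force \<psi> V a' b')
        \<le> (2 * max L 0) * norm ((a, b) - (a', b'))"
      if "norm a \<le> R" "norm b \<le> R" "norm a' \<le> R" "norm b' \<le> R" for a b a' b'
    proof -
      have "(two_config a, two_config b) \<in> K" "(two_config a', two_config b') \<in> K"
        using that by (auto simp: K_def)
      then have "norm (force \<psi> V 2 0 (two_config a) (two_config b) - force \<psi> V 2 0 (two_config a')
          (two_config b'))
          \<le> L * sqrt ((config_dist 2 (two_config a) (two_config a'))\<^sup>2 + (config_dist 2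
              (two_config b) (two_config b'))\<^sup>2)"
        using L by fastforce
      then have "norm ((1 / 2) *\<^sub>R (pair_force \<psi> V a b - pair_force \<psi> V a' b'))
          \<le> L * norm ((a, b) - (a', b'))"
        unfolding fc config_two_config by (simp add: scaleR_diff_right norm_Pair dist_norm)
      also have "\<dots> \<le> max L 0 * norm ((a, b) - (a', b'))" by (intro mult_right_mono) auto
      finally show ?thesis by simp
    qed
    then show "\<exists>L\<ge>0. \<forall>a b a' b'. norm a \<le> R \<longrightarrow> norm b \<le> R \<longrightarrow> norm a' \<le> R \<longrightarrow> norm b' \<le> R \<longrightarrow>
       norm (pair_force \<psi> V a b - pair_force \<psi> V a' b') \<le> L * norm ((a, b) - (a', b'))"
      by (intro exI[of _ "2 * max L 0"]) auto
  qed
qed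

lemma mean_field_interaction:
  fixes V :: "real^'d \<Rightarrow> real"
  assumes "standing_assumptions \<psi> V"
  obtains C where "mean_field (interaction \<psi> V) C"
proof -
  obtain C where C: "C \<ge> 0" "\<And>a b. norm (pair_force \<psi> V a b) \<le> C * (1 + norm a + norm b)"
    and lip: "\<And>R. \<exists>L\<ge>0. \<forall>a b a' b'. norm a \<le> R \<longrightarrow> norm b \<le> R \<longrightarrow> norm a' \<le> R \<longrightarrow> norm b' \<le> R \<longrightarrow>
       norm (pair_force \<psi> V a b - pair_force \<psi> V a' b') \<le> L * norm ((a, b) - (a', b'))"
    using standing_assumptions_pair_force[OF assms] by blast
  have le: "norm (fst z) \<le> norm z" "norm (snd z) \<le> norm z" for z :: "(real^'d) \<times> (real^'d)"
    using norm_fst_le[of "fst z" "snd z"] norm_snd_le[of "snd z" "fst z"] by auto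
  have "mean_field (interaction \<psi> V) (1 + 2 * C)"
  proof
    fix z :: "(real^'d) \<times> (real^'d)" and R :: real
    have "norm (interaction \<psi> V z) \<le> norm (snd z) + norm (pair_force \<psi> V (fst z) (snd z))"
      unfolding interaction_def using norm_Pair_le[of "snd z" "- pair_force \<psi> V (fst z) (snd z)"]
          by simp
    also have "\<dots> \<le> norm z + C * (1 + norm z + norm z)"
      using C(2)[of "fst z" "snd z"]
          mult_left_mono[OF _ C(1), of "1 + norm (fst z) + norm (snd z)" "1 + norm z + norm z"]
          le[of z]
      by linarith
    also have "\<dots> \<le> (1 + 2 * C) * (1 + norm z)" using C(1) by (simp add: algebra_simps)
    finally show "norm (interaction \<psi> V z) \<le> (1 + 2 * C) * (1 + norm z)" .
    obtain L where L: "L \<ge> 0" "\<And>a b a' b'. norm a \<le> R \<Longrightarrow> norm b \<le> R \<Longrightarrow> norm a' \<le> R \<Longrightarrow> norm b' \<le> R \<Longrightarrow>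
       norm (pair_force \<psi> V a b - pair_force \<psi> V a' b') \<le> L * norm ((a, b) - (a', b'))"
      using lip[of R] by blast
    have "norm (interaction \<psi> V x - interaction \<psi> V y) \<le> (1 + L) * norm (x - y)"
        if "norm x \<le> R" "norm y \<le> R" for x y
    proof -
      have "interaction \<psi> V x - interaction \<psi> V y =
          (snd (x - y), - (pair_force \<psi> V (fst x) (snd x) - pair_force \<psi> V (fst y) (snd y)))"
        by (simp add: interaction_def)
      also have "norm \<dots> \<le> norm (snd (x - y))
          + norm (pair_force \<psi> V (fst x) (snd x) - pair_force \<psi> V (fst y) (snd y))"
        using norm_Pair_le[of "snd (x - y)"
            "- (pair_force \<psi> V (fst x) (snd x) - pair_force \<psi> V (fst y) (snd y))"]
        by (simp only: norm_minus_cancel)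
      also have "\<dots> \<le> norm (x - y) + L * norm (x - y)"
        using L(2)[of "fst x" "snd x" "fst y" "snd y"] le[of x] le[of y] le[of "x - y"] that
        by (intro add_mono) (auto intro: order_trans)
      finally show ?thesis by (simp add: algebra_simps)
    qed
    then show "\<exists>L\<ge>0. \<forall>x y. norm x \<le> R \<longrightarrow> norm y \<le> R \<longrightarrow> norm (interaction \<psi> V x - interaction \<psi> V y)
        \<le> L * norm (x - y)"
      using L(1) by (intro exI[of _ "1 + L"]) auto
  qed
  then show thesis using that by blast
qed

text \<open>The partial derivative and the two gradients of the weak formulation are values of one
  Frechet derivative, which then can be recombined into a single directional derivative.\<close>

lemma smooth_partial_derivatives:
  fixes h :: "real \<times> (real^'d) \<times> (real^'d) \<Rightarrow> real"
  assumes h: "smooth h"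
  shows "deriv (\<lambda>s. h (s, r, v)) t = frechet_derivative h (at (t, r, v)) (1, 0, 0)"
    "w \<bullet> gradient (\<lambda>r. h (t, r, v)) r = frechet_derivative h (at (t, r, v)) (0, w, 0)"
    "w \<bullet> gradient (\<lambda>v. h (t, r, v)) v = frechet_derivative h (at (t, r, v)) (0, 0, w)"
proof -
  let ?D = "frechet_derivative h (at (t, r, v))"
  note D = smoothD[OF h, of "(t, r, v)"]
  have "((\<lambda>s. (s, r, v)) has_derivative (\<lambda>s. (s, 0, 0))) (at t)"
    by (intro has_derivative_Pair has_derivative_ident has_derivative_const)
  from has_derivative_compose[OF this D]
  have "((\<lambda>s. h (s, r, v)) has_derivative (\<lambda>s. ?D (s, 0, 0))) (at t)" .
  moreover have "(\<lambda>s. ?D (s, 0, 0)) = (\<lambda>s. ?D (1, 0, 0) * s)"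
  proof
    fix s
    have "(s, 0, 0) = s *\<^sub>R (1, 0 :: real^'d, 0 :: real^'d)" by simp
    then show "?D (s, 0, 0) = ?D (1, 0, 0) * s"
      using linear_scale[OF has_derivative_linear[OF D], of s "(1, 0, 0)"]
          by (simp only: real_scaleR_def mult.commute)
  qed
  ultimately have "((\<lambda>s. h (s, r, v)) has_real_derivative ?D (1, 0, 0)) (at t)"
    by (simp only: has_field_derivative_def)
  then show "deriv (\<lambda>s. h (s, r, v)) t = ?D (1, 0, 0)" by (rule DERIV_imp_deriv)
  have "((\<lambda>r. (t, r, v)) has_derivative (\<lambda>w. (0, w, 0))) (at r)"
    by (intro has_derivative_Pair has_derivative_ident has_derivative_const)
  from has_derivative_compose[OF this D]
  show "w \<bullet> gradient (\<lambda>r. h (t, r, v)) r = ?D (0, w, 0)" by (rule GDERIV_gradient)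
  have "((\<lambda>v. (t, r, v)) has_derivative (\<lambda>w. (0, 0, w))) (at v)"
    by (intro has_derivative_Pair has_derivative_ident has_derivative_const)
  from has_derivative_compose[OF this D]
  show "w \<bullet> gradient (\<lambda>v. h (t, r, v)) v = ?D (0, 0, w)" by (rule GDERIV_gradient)
qed

lemma test_functions_eq_test_space: "test_functions T = test_space T"
  by (simp add: test_functions_def test_space_def)

locale alignment =
  fixes \<psi> :: "real \<Rightarrow> real" and V :: "real^'d \<Rightarrow> real" and C :: real
  assumes standing: "standing_assumptions \<psi> V" and mf: "mean_field (interaction \<psi> V) C"
begin

sublocale mean_field "interaction \<psi> V" C by (rule mf)

lemma drift_interaction:
  assumes M: "M \<in> P2"
  shows "drift M (r, v)
      = (\<integral>(r', v'). v - v' \<partial>M, - (\<integral>(r', v'). pair_force \<psi> V (r - r') (v - v') \<partial>M))"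
proof -
  note int = drift_integrable[OF M, of "(r, v)"]
  have "fst (drift M (r, v)) = (\<integral>w. fst (interaction \<psi> V ((r, v) - w)) \<partial>M)"
    unfolding drift_def using integral_bounded_linear[OF bounded_linear_fst int] by simp
  moreover have "snd (drift M (r, v)) = (\<integral>w. snd (interaction \<psi> V ((r, v) - w)) \<partial>M)"
    unfolding drift_def using integral_bounded_linear[OF bounded_linear_snd int] by simp
  ultimately show ?thesis
    by (simp add: prod_eq_iff interaction_def case_prod_unfold)
qed

text \<open>The projection \<open>Pr\<close> keeps the time and position directions,
  \<open>Pv\<close> the velocity direction. Each part of the rate is continuous in time, hence
  integrable, so the difference of the two time integrals may be merged into one.\<close>

lemma weak_solution_iff_weak_sol:
  assumes T: "0 < T"
  shows "weak_solution \<psi> V T f0 g \<longleftrightarrow> weak_sol T f0 g"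
proof (cases "P2_continuous_on {0..T} g")
  case gc: True
  define Pr where "Pr u = (fst u, fst (snd u), 0 :: real^'d)"
      for u :: "real \<times> (real^'d) \<times> (real^'d)"
  define Pv where "Pv u = (0 :: real, 0 :: real^'d, snd (snd u))"
      for u :: "real \<times> (real^'d) \<times> (real^'d)"
  have bl: "bounded_linear Pr" "bounded_linear Pv"
    unfolding Pr_def[abs_def] Pv_def[abs_def]
    by (intro bounded_linear_Pair bounded_linear_fst bounded_linear_zero
        bounded_linear_compose[OF bounded_linear_fst bounded_linear_snd]
        bounded_linear_compose[OF bounded_linear_snd bounded_linear_snd])+
  have nP: "norm (Pr u) \<le> norm u" "norm (Pv u) \<le> norm u" for u
  proof -
    obtain a b c where u: "u = (a, b, c)" by (cases u) auto
    have n: "norm u = sqrt ((norm a)\<^sup>2 + ((norm b)\<^sup>2 + (norm c)\<^sup>2))"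
      by (simp add: u norm_Pair)
    show "norm (Pr u) \<le> norm u" "norm (Pv u) \<le> norm u"
      unfolding n by (simp_all add: u Pr_def Pv_def norm_Pair real_le_rsqrt)
  qed
  have "(LINT t:{0..T}|lborel.
           (\<integral>(r, v). deriv (\<lambda>s. h (s, r, v)) t
              + (\<integral>(r', v'). v - v' \<partial>g t) \<bullet> gradient (\<lambda>r. h (t, r, v)) r \<partial>g t))
        - (LINT t:{0..T}|lborel.
             (\<integral>(r, v). (\<integral>(r', v'). \<psi> (norm (r - r')) *\<^sub>R (v - v') + gradient V (r - r') \<partial>g t)
                \<bullet> gradient (\<lambda>v. h (t, r, v)) v \<partial>g t))
        = (LINT t:{0..T}|lborel. rate h (g t) t)" if "h \<in> test_functions T" for h
  proof -
    have hT: "h \<in> test_space T" and h: "smooth h"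
      using that by (auto simp: test_functions_eq_test_space test_space_def)
    obtain D where D: "D \<ge> 0" "\<And>t z u. t \<in> {0..T} \<Longrightarrow> \<bar>frechet_derivative h (at (t, z)) u\<bar>
        \<le> D * norm u"
      using test_space_derivative_bound[OF hT] by blast
    define I1 where "I1 t = (\<integral>z. frechet_derivative h (at (t, z)) (Pr (1, drift (g t) z)) \<partial>g t)"
        for t
    define I2 where "I2 t = (\<integral>z. frechet_derivative h (at (t, z)) (Pv (1, drift (g t) z)) \<partial>g t)"
        for t
    have c: "continuous_on {0..T} I1" "continuous_on {0..T} I2"
      unfolding I1_def I2_def
      using partial_rate_continuous[OF gc less_imp_le[OF T] h D bl(1) nP(1)]
        partial_rate_continuous[OF gc less_imp_le[OF T] h D bl(2) nP(2)] by blast+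
    have si: "set_integrable lborel {0..T} I1" "set_integrable lborel {0..T} I2"
      unfolding set_integrable_def
      using borel_integrable_compact[OF compact_Icc c(1)]
          borel_integrable_compact[OF compact_Icc c(2)] by blast+
    have gP: "g t \<in> P2" if "t \<in> {0..T}" for t using gc that by (simp add: P2_continuous_on_def)
    have 1: "(\<integral>(r, v). deriv (\<lambda>s. h (s, r, v)) t
              + (\<integral>(r', v'). v - v' \<partial>g t) \<bullet> gradient (\<lambda>r. h (t, r, v)) r \<partial>g t) = I1 t" if t: "t \<in>
                  {0..T}" for t
    proof -
      have key: "deriv (\<lambda>s. h (s, r, v)) t + (\<integral>(r', v'). v - v' \<partial>g t) \<bullet> gradient (\<lambda>r. h (t, r, v)) r
        = frechet_derivative h (at (t, r, v)) (Pr (1, drift (g t) (r, v)))" for r v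
        using linear_add[OF has_derivative_linear[OF smoothD[OF h, of "(t, r, v)"]], of
            "(1, 0, 0)" "(0, \<integral>(r', v'). v - v' \<partial>g t, 0)"]
        by (simp add: smooth_partial_derivatives[OF h] drift_interaction[OF gP[OF t]] Pr_def)
      have "(\<lambda>(r, v). deriv (\<lambda>s. h (s, r, v)) t
          + (\<integral>(r', v'). v - v' \<partial>g t) \<bullet> gradient (\<lambda>r. h (t, r, v)) r)
          = (\<lambda>z. frechet_derivative h (at (t, z)) (Pr (1, drift (g t) z)))" (is "?L = ?R")
      proof
        fix z :: "(real^'d) \<times> (real^'d)"
        obtain r v where z: "z = (r, v)" by (cases z)
        show "?L z = ?R z" by (simp only: z prod.case key)
      qed
      then show ?thesis unfolding I1_def by simp
    qed
    \<comment> \<open>The minus sign reflects that the velocity component of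
      \<open>interaction\<close> is the negative pair force, while the weak formulation has that
      term on the right-hand side.\<close>
    have 2: "(\<integral>(r, v). (\<integral>(r', v'). \<psi> (norm (r - r')) *\<^sub>R (v - v') + gradient V (r - r') \<partial>g t)
                \<bullet> gradient (\<lambda>v. h (t, r, v)) v \<partial>g t) = - I2 t" if t: "t \<in> {0..T}" for t
    proof -
      have key: "(\<integral>(r', v'). \<psi> (norm (r - r')) *\<^sub>R (v - v') + gradient V (r - r') \<partial>g t) \<bullet> gradient
          (\<lambda>v. h (t, r, v)) v
        = - frechet_derivative h (at (t, r, v)) (Pv (1, drift (g t) (r, v)))" for r v
        using linear_neg[OF has_derivative_linear[OF smoothD[OF h, of "(t, r, v)"]], of
            "(0, 0, \<integral>(r', v'). pair_force \<psi> V (r - r') (v - v') \<partial>g t)"]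
        by (simp add: smooth_partial_derivatives[OF h] drift_interaction[OF gP[OF t]] Pv_def
            pair_force_def)
      have "(\<lambda>(r, v). (\<integral>(r', v'). \<psi> (norm (r - r')) *\<^sub>R (v - v')
          + gradient V (r - r') \<partial>g t) \<bullet> gradient (\<lambda>v. h (t, r, v)) v)
          = (\<lambda>z. - frechet_derivative h (at (t, z)) (Pv (1, drift (g t) z)))" (is "?L = ?R")
      proof
        fix z :: "(real^'d) \<times> (real^'d)"
        obtain r v where z: "z = (r, v)" by (cases z)
        show "?L z = ?R z" by (simp only: z prod.case key)
      qed
      then show ?thesis unfolding I2_def by simp
    qed
    have r: "rate h (g t) t = I1 t + I2 t" if t: "t \<in> {0..T}" for t
    proof -
      note i = partial_rate_integrable[OF gP[OF t] h D(1) D(2)[OF t] bl(1) nP(1)]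
        partial_rate_integrable[OF gP[OF t] h D(1) D(2)[OF t] bl(2) nP(2)]
      have "frechet_derivative h (at (t, z)) (1, d) = frechet_derivative h (at (t, z)) (Pr (1, d))
          + frechet_derivative h (at (t, z)) (Pv (1, d))" for z d
        using linear_add[OF has_derivative_linear[OF smoothD[OF h, of "(t, z)"]], of "Pr (1, d)"
            "Pv (1, d)"]
        by (simp add: Pr_def Pv_def)
      then show ?thesis
        unfolding rate_def I1_def I2_def using i by simp
    qed
    have "(LINT t:{0..T}|lborel. rate h (g t) t) = (LINT t:{0..T}|lborel. I1 t + I2 t)"
      by (rule set_lebesgue_integral_cong) (auto simp: r)
    also have "\<dots> = (LINT t:{0..T}|lborel. I1 t) - (LINT t:{0..T}|lborel. - I2 t)"
      using si by (simp add: set_integral_uminus)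
    also have "(LINT t:{0..T}|lborel. I1 t) = (LINT t:{0..T}|lborel.
           (\<integral>(r, v). deriv (\<lambda>s. h (s, r, v)) t
              + (\<integral>(r', v'). v - v' \<partial>g t) \<bullet> gradient (\<lambda>r. h (t, r, v)) r \<partial>g t))"
      by (rule set_lebesgue_integral_cong) (auto simp only: 1 sets_lborel atLeastAtMost_borel)
    also have "(LINT t:{0..T}|lborel. - I2 t) = (LINT t:{0..T}|lborel.
             (\<integral>(r, v). (\<integral>(r', v'). \<psi> (norm (r - r')) *\<^sub>R (v - v') + gradient V (r - r') \<partial>g t)
                \<bullet> gradient (\<lambda>v. h (t, r, v)) v \<partial>g t))"
      by (rule set_lebesgue_integral_cong) (auto simp only: 2 sets_lborel atLeastAtMost_borel)
    finally show ?thesis ..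
  qed
  moreover have "(\<integral>(r, v). h (0, r, v) \<partial>f0) = (\<integral>z. h (0, z) \<partial>f0)"
      for h :: "real \<times> (real^'d) \<times> (real^'d) \<Rightarrow> real"
    by (simp add: case_prod_unfold)
  ultimately show ?thesis
    unfolding weak_solution_def weak_sol_def test_functions_eq_test_space[symmetric]
    by (smt (verit, best))
next
  case False
  then show ?thesis by (simp add: weak_solution_def weak_sol_def)
qed

end


section \<open>Momentum and energy\<close>

text \<open>By Fubini and exchange of the two points, twice the integral of \<open>A\<close> is the
  integral of \<open>A x y + A y x\<close>. Applied to a kernel and its negative, it also yields
  equality to 0.\<close>

lemma (in prob_space) symmetrized_integral_nonpos:
  fixes A :: "'a \<Rightarrow> 'a \<Rightarrow> real"
  assumes meas: "case_prod A \<in> borel_measurable (M \<Otimes>\<^sub>M M)" and bound: "\<And>x y. \<bar>A x y\<bar> \<le> K"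
    and sym: "\<And>x y. A x y + A y x \<le> 0"
  shows "(\<integral>x. \<integral>y. A x y \<partial>M \<partial>M) \<le> 0"
proof -
  interpret P: pair_prob_space M M ..
  note [measurable] = meas
  have int: "integrable (M \<Otimes>\<^sub>M M) (case_prod A)"
    by (rule P.integrable_const_bound[of _ K]) (use bound in auto)
  have int2: "integrable (M \<Otimes>\<^sub>M M) (\<lambda>(x, y). A y x)"
    by (rule P.integrable_const_bound[of _ K]) (use bound in auto)
  have "(\<integral>x. \<integral>y. A x y \<partial>M \<partial>M) = (\<integral>p. case_prod A p \<partial>(M \<Otimes>\<^sub>M M))"
    using P.integral_fst'[OF int] by simp
  moreover have "(\<integral>p. case_prod A p \<partial>(M \<Otimes>\<^sub>M M)) = (\<integral>(x, y). A y x \<partial>(M \<Otimes>\<^sub>M M))"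
    using P.integral_product_swap[OF meas] by simp
  moreover have "(\<integral>p. case_prod A p \<partial>(M \<Otimes>\<^sub>M M)) + (\<integral>(x, y). A y x \<partial>(M \<Otimes>\<^sub>M M))
      = (\<integral>p. case_prod A p + (case p of (x, y) \<Rightarrow> A y x) \<partial>(M \<Otimes>\<^sub>M M))"
    by (rule Bochner_Integration.integral_add[OF int int2, symmetric])
  moreover have "\<dots> \<le> 0"
  proof -
    have "(\<integral>p. case_prod A p + (case p of (x, y) \<Rightarrow> A y x) \<partial>(M \<Otimes>\<^sub>M M)) \<le> (\<integral>p. 0 \<partial>(M \<Otimes>\<^sub>M M))"
      by (rule integral_mono') (auto simp: sym)
    then show ?thesis by simp
  qed
  ultimately show ?thesis by linarith
qed

lemma continuous_bounded_on_ball: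
  fixes a :: "'a::euclidean_space \<Rightarrow> real"
  assumes "continuous_on UNIV a"
  obtains K where "\<And>x. norm x \<le> \<rho> \<Longrightarrow> \<bar>a x\<bar> \<le> K"
proof -
  have "compact (a ` cball 0 \<rho>)"
    by (intro compact_continuous_image continuous_on_subset[OF assms]) auto
  from compact_imp_bounded[OF this] obtain K where "\<forall>x\<in>cball 0 \<rho>. \<bar>a x\<bar> \<le> K"
    unfolding bounded_iff by auto
  then show thesis by (intro that[of K]) auto
qed

text \<open>Limits and derivatives on the half line are local, so a finite interval reaching
  strictly beyond \<open>t\<close> is enough.\<close>

lemma at_within_atLeast:
  assumes "0 \<le> t" "t < (T::real)"
  shows "at t within {0..} = at t within {0..T}"
  by (rule at_within_nhd[of t "{..<T}"]) (use assms in auto)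

context alignment
begin

lemma gradient_continuous: "continuous_on S (gradient V)"
proof -
  have "continuous_on UNIV (gradient V)" using standing by (simp add: standing_assumptions_def)
  then show ?thesis by (rule continuous_on_subset) simp
qed

lemma V_has_derivative: "(V has_derivative (\<lambda>w. w \<bullet> gradient V x)) (at x)"
  using standing by (intro gradient_has_derivative) (simp add: standing_assumptions_def)

lemma V_continuous: "continuous_on S V"
  by (intro continuous_at_imp_continuous_on ballI has_derivative_continuous[OF V_has_derivative])

lemma gradient_odd: "gradient V (- x) = - gradient V x"
  using standing by (simp add: standing_assumptions_def)

lemma pair_force_odd: "pair_force \<psi> V (- r) (- v) = - pair_force \<psi> V r v"
  by (simp add: pair_force_def gradient_odd)

lemma pair_force_continuous:
  assumes "continuous_on S f" "continuous_on S g"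
  shows "continuous_on S (\<lambda>x. pair_force \<psi> V (f x) (g x))"
proof -
  have "continuous_on S (\<lambda>x. - snd (interaction \<psi> V (f x, g x)))"
    by (intro continuous_intros continuous_on_compose2[OF B_continuous[of UNIV]] assms) auto
  then show ?thesis by (simp add: interaction_def)
qed

lemma pair_force_friction:
  assumes "\<psi> (norm r) \<ge> 0"
  shows "v \<bullet> pair_force \<psi> V r v \<ge> v \<bullet> gradient V r"
  using assms by (simp add: pair_force_def inner_add_right)

end

text \<open>One flow on a finite interval with its bound made explicit, so that continuous
  integrands are evaluated on a fixed compact set.\<close>

locale alignment_flow = alignment \<psi> V C
  for \<psi> :: "real \<Rightarrow> real" and V :: "real^'d \<Rightarrow> real" and C +
  fixes f0 :: "((real^'d) \<times> (real^'d)) measure" and T :: real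
    and X :: "real \<Rightarrow> (real^'d) \<times> (real^'d) \<Rightarrow> (real^'d) \<times> (real^'d)" and \<rho> :: real
  assumes prob_f0: "prob_space f0" and sets_f0: "sets f0 = sets borel" and T_pos: "0 < T"
    and flow: "is_flow T f0 X" and \<rho>: "\<rho> \<ge> 0" "\<And>t z. t \<in> {0..T} \<Longrightarrow> norm (X t z) \<le> \<rho>"
begin

sublocale f0: prob_space f0 by (rule prob_f0)

abbreviation ft where "ft t \<equiv> distr f0 borel (X t)"

lemma X_measurable: "t \<in> {0..T} \<Longrightarrow> X t \<in> borel_measurable f0"
  using flow unfolding is_flow_def
  by (simp add: borel_measurable_continuous_onI measurable_cong_sets[OF sets_f0 refl])

lemma ft_P2: "t \<in> {0..T} \<Longrightarrow> ft t \<in> P2"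
  by (rule weak_sol_P2[OF is_flow_weak_sol[OF prob_f0 sets_f0 flow T_pos]])

lemma integral_ft:
  fixes \<phi> :: "(real^'d) \<times> (real^'d) \<Rightarrow> 'b::{banach, second_countable_topology}"
  assumes "t \<in> {0..T}" "continuous_on UNIV \<phi>"
  shows "(\<integral>z. \<phi> z \<partial>ft t) = (\<integral>z. \<phi> (X t z) \<partial>f0)"
  using X_measurable[OF assms(1)] borel_measurable_continuous_onI[OF assms(2)]
      by (rule integral_distr)

lemma flow_integrable:
  fixes \<phi> :: "(real^'d) \<times> (real^'d) \<Rightarrow> real"
  assumes t: "t \<in> {0..T}" and \<phi>: "continuous_on UNIV \<phi>"
  shows "integrable f0 (\<lambda>z. \<phi> (X t z))"
proof -
  obtain K where K: "\<And>x. norm x \<le> \<rho> \<Longrightarrow> \<bar>\<phi> x\<bar> \<le> K"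
    using continuous_bounded_on_ball[OF \<phi>] by blast
  show ?thesis
    by (rule f0.integrable_const_bound[of _ K])
      (use K \<rho>(2)[OF t] measurable_compose[OF X_measurable[OF t]
          borel_measurable_continuous_onI[OF \<phi>]] in auto)
qed

lemma norm_pair_flow: "t \<in> {0..T} \<Longrightarrow> norm (X t z, X t w) \<le> 2 * \<rho>"
  using norm_Pair_le[of "X t z" "X t w"] \<rho>(2)[of t z] \<rho>(2)[of t w] by simp

lemma flow_pair_measurable:
  fixes a :: "((real^'d) \<times> (real^'d)) \<times> (real^'d) \<times> (real^'d) \<Rightarrow> real"
  assumes t: "t \<in> {0..T}" and a: "continuous_on UNIV a"
  shows "(\<lambda>(z, w). a (X t z, X t w)) \<in> borel_measurable (f0 \<Otimes>\<^sub>M f0)"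
proof -
  note [measurable] = X_measurable[OF t] borel_measurable_continuous_onI[OF a]
  show ?thesis by measurable
qed

lemma flow_pair_integral_measurable:
  fixes a :: "((real^'d) \<times> (real^'d)) \<times> (real^'d) \<times> (real^'d) \<Rightarrow> real"
  assumes t: "t \<in> {0..T}" and a: "continuous_on UNIV a"
  shows "(\<lambda>z. \<integral>w. a (X t z, X t w) \<partial>f0) \<in> borel_measurable f0"
    "(\<lambda>w. a (X t z, X t w)) \<in> borel_measurable f0"
proof -
  note [measurable] = flow_pair_measurable[OF t a]
  show "(\<lambda>z. \<integral>w. a (X t z, X t w) \<partial>f0) \<in> borel_measurable f0" by measurable
  show "(\<lambda>w. a (X t z, X t w)) \<in> borel_measurable f0"
  proof -
    have "continuous_on UNIV (\<lambda>y. a (X t z, y))"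
      by (rule continuous_on_compose2[OF a continuous_on_Pair[OF continuous_on_const
          continuous_on_id]]) simp
    from measurable_compose[OF X_measurable[OF t] borel_measurable_continuous_onI[OF this]]
    show ?thesis .
  qed
qed

text \<open>Bounds uniform in time and in both points, as required for differentiating under each of
  the two integrals.\<close>

lemma flow_pair_bounds:
  fixes a :: "((real^'d) \<times> (real^'d)) \<times> (real^'d) \<times> (real^'d) \<Rightarrow> real"
  assumes a: "continuous_on UNIV a"
  obtains K where "\<And>t z w. t \<in> {0..T} \<Longrightarrow> \<bar>a (X t z, X t w)\<bar> \<le> K"
    "\<And>t z. t \<in> {0..T} \<Longrightarrow> \<bar>\<integral>w. a (X t z, X t w) \<partial>f0\<bar> \<le> K"
proof -
  obtain K where "\<And>x. norm x \<le> 2 * \<rho> \<Longrightarrow> \<bar>a x\<bar> \<le> K"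
    using continuous_bounded_on_ball[OF a] by blast
  then have K: "\<bar>a (X t z, X t w)\<bar> \<le> K" if "t \<in> {0..T}" for t z w
    using norm_pair_flow[OF that] by blast
  have "\<bar>\<integral>w. a (X t z, X t w) \<partial>f0\<bar> \<le> K" if t: "t \<in> {0..T}" for t z
    by (rule f0.integral_abs_le_const[OF flow_pair_integral_measurable(2)[OF t a]])
        (use K[OF t] in auto)
  with K show thesis using that by blast
qed

lemma drift_flow_eq:
  assumes t: "t \<in> {0..T}"
  shows "fst (drift (ft t) (X t z)) = (\<integral>w. snd (X t z) - snd (X t w) \<partial>f0)"
    "snd (drift (ft t) (X t z))
        = - (\<integral>w. pair_force \<psi> V (fst (X t z) - fst (X t w)) (snd (X t z) - snd (X t w)) \<partial>f0)"
proof -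
  obtain r v where z: "X t z = (r, v)" by (cases "X t z")
  have "drift (ft t) (X t z)
      = (\<integral>y. v - snd y \<partial>ft t, - (\<integral>y. pair_force \<psi> V (r - fst y) (v - snd y) \<partial>ft t))"
    unfolding z drift_interaction[OF ft_P2[OF t]] case_prod_unfold by simp
  moreover have "(\<integral>y. v - snd y \<partial>ft t) = (\<integral>w. v - snd (X t w) \<partial>f0)"
    by (rule integral_ft[OF t]) (intro continuous_intros)
  moreover have "(\<integral>y. pair_force \<psi> V (r - fst y) (v - snd y) \<partial>ft t)
      = (\<integral>w. pair_force \<psi> V (r - fst (X t w)) (v - snd (X t w)) \<partial>f0)"
    by (rule integral_ft[OF t]) (intro pair_force_continuous continuous_intros)
  ultimately show "fst (drift (ft t) (X t z)) = (\<integral>w. snd (X t z) - snd (X t w) \<partial>f0)"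
    "snd (drift (ft t) (X t z))
        = - (\<integral>w. pair_force \<psi> V (fst (X t z) - fst (X t w)) (snd (X t z) - snd (X t w)) \<partial>f0)"
    by (simp_all add: z)
qed

lemma flow_vec_integrable:
  fixes \<phi> :: "(real^'d) \<times> (real^'d) \<Rightarrow> real^'d"
  assumes t: "t \<in> {0..T}" and \<phi>: "continuous_on UNIV \<phi>"
  shows "integrable f0 (\<lambda>z. \<phi> (X t z))"
proof -
  obtain K where K: "\<And>x. norm x \<le> \<rho> \<Longrightarrow> \<bar>norm (\<phi> x)\<bar> \<le> K"
    using continuous_bounded_on_ball[of "\<lambda>x. norm (\<phi> x)"] \<phi> continuous_on_norm by blast
  show ?thesis
    by (rule f0.integrable_const_bound[of _ K])
      (use K \<rho>(2)[OF t] measurable_compose[OF X_measurable[OF t]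
          borel_measurable_continuous_onI[OF \<phi>]] in auto)
qed

lemma X_vector_derivative:
  "t \<in> {0..T} \<Longrightarrow> ((\<lambda>s. X s z) has_vector_derivative drift (ft t) (X t z)) (at t within {0..T})"
  using flow unfolding is_flow_def by blast

lemma fst_X_derivative:
  "t \<in> {0..T} \<Longrightarrow> ((\<lambda>s. fst (X s z)) has_vector_derivative fst (drift (ft t) (X t z)))
      (at t within {0..T})"
  and snd_X_derivative:
  "t \<in> {0..T} \<Longrightarrow> ((\<lambda>s. snd (X s z)) has_vector_derivative snd (drift (ft t) (X t z)))
      (at t within {0..T})"
  by (rule bounded_linear.has_vector_derivative[OF bounded_linear_fst X_vector_derivative]
      bounded_linear.has_vector_derivative[OF bounded_linear_snd X_vector_derivative]; assumption)+

lemma mean_velocity_ft: "t \<in> {0..T} \<Longrightarrow> mean_velocity (ft t) = (\<integral>z. snd (X t z) \<partial>f0)"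
  unfolding mean_velocity_def case_prod_unfold by (intro integral_ft continuous_intros)

text \<open>In each fixed direction \<open>e\<close> the derivative of the momentum is a double
  integral of a kernel that is antisymmetric under exchange of the two points.\<close>

lemma mean_velocity_constant:
  assumes t: "t \<in> {0..T}"
  shows "mean_velocity (ft t) = mean_velocity (ft 0)"
proof -
  have "(\<integral>z. snd (X t z) \<partial>f0) \<bullet> e = (\<integral>z. snd (X 0 z) \<partial>f0) \<bullet> e" for e
  proof -
    define m where "m s = (\<integral>z. snd (X s z) \<bullet> e \<partial>f0)" for s
    define a where "a p = - (pair_force \<psi> V (fst (fst p) - fst (snd p)) (snd (fst p) - snd (snd
        p)) \<bullet> e)"
      for p :: "((real^'d) \<times> (real^'d)) \<times> (real^'d) \<times> (real^'d)"
    have a: "continuous_on UNIV a"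
      unfolding a_def[abs_def] by (intro continuous_intros pair_force_continuous)
    obtain K where K: "\<And>t z w. t \<in> {0..T} \<Longrightarrow> \<bar>a (X t z, X t w)\<bar> \<le> K"
      "\<And>t z. t \<in> {0..T} \<Longrightarrow> \<bar>\<integral>w. a (X t z, X t w) \<partial>f0\<bar> \<le> K"
      using flow_pair_bounds[OF a] by blast
    have mc: "m s = (\<integral>z. snd (X s z) \<partial>f0) \<bullet> e" if "s \<in> {0..T}" for s
      unfolding m_def by (rule integral_inner_left)
          (intro flow_vec_integrable[OF that] continuous_intros)
    have "(m has_real_derivative 0) (at s within {0..T})" if s: "s \<in> {0..T}" for s
    proof -
      have "(m has_real_derivative (\<integral>z. \<integral>w. a (X s z, X s w) \<partial>f0 \<partial>f0)) (at s within {0..T})"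
        unfolding m_def[abs_def]
      proof (rule has_real_derivative_prob_integral[OF prob_f0 s _ K(2)])
        fix r z assume r: "r \<in> {0..T}"
        have "((\<lambda>s. snd (X s z) \<bullet> e) has_vector_derivative (snd (drift (ft r) (X r z)) \<bullet> e))
            (at r within {0..T})"
          by (rule bounded_linear.has_vector_derivative[OF bounded_linear_inner_left
              snd_X_derivative[OF r]])
        moreover have "snd (drift (ft r) (X r z)) \<bullet> e = (\<integral>w. a (X r z, X r w) \<partial>f0)"
        proof -
          have int: "integrable f0 (\<lambda>w. pair_force \<psi> V (fst (X r z) - fst (X r w)) (snd (X r z) -
              snd (X r w)))"
            by (rule flow_vec_integrable[OF r]) (intro pair_force_continuous continuous_intros)
          show ?thesis
            unfolding drift_flow_eq(2)[OF r] a_def fst_conv snd_conv inner_minus_left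
                Bochner_Integration.integral_minus
            by (subst integral_inner_left) (use int in auto)
        qed
        ultimately show "((\<lambda>s. snd (X s z) \<bullet> e) has_real_derivative (\<integral>w. a (X r z, X r w) \<partial>f0))
            (at r within {0..T})"
          by (simp add: has_real_derivative_iff_has_vector_derivative)
      next
        show "integrable f0 (\<lambda>z. snd (X r z) \<bullet> e)" if "r \<in> {0..T}" for r
          by (intro flow_integrable[OF that] continuous_intros)
        show "(\<lambda>z. \<integral>w. a (X s z, X s w) \<partial>f0) \<in> borel_measurable f0"
          by (rule flow_pair_integral_measurable[OF s a])
      qed
      \<comment> \<open>Antisymmetry makes the symmetrised sums of \<open>a\<close> and of
        \<open>- a\<close> vanish, so the integral is bounded by 0 from both sides.\<close>
      moreover have "(\<integral>z. \<integral>w. a (X s z, X s w) \<partial>f0 \<partial>f0) = 0"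
      proof -
        have anti: "a (x, y) + a (y, x) = 0" for x y
          using pair_force_odd[of "fst x - fst y" "snd x - snd y"] by (simp add: a_def)
        have "(\<integral>z. \<integral>w. a (X s z, X s w) \<partial>f0 \<partial>f0) \<le> 0"
        proof (rule f0.symmetrized_integral_nonpos[OF flow_pair_measurable[OF s a] K(1)[OF s]])
          show "a (X s x, X s y) + a (X s y, X s x) \<le> 0" for x y
            using anti[of "X s x" "X s y"] by linarith
        qed
        moreover have "(\<integral>z. \<integral>w. - a (X s z, X s w) \<partial>f0 \<partial>f0) \<le> 0"
        proof (rule f0.symmetrized_integral_nonpos)
          show "(\<lambda>(z, w). - a (X s z, X s w)) \<in> borel_measurable (f0 \<Otimes>\<^sub>M f0)"
            by (rule flow_pair_measurable[OF s continuous_on_minus[OF a]])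
          show "- a (X s x, X s y) + - a (X s y, X s x) \<le> 0" for x y
            using anti[of "X s x" "X s y"] by linarith
        qed (use K(1)[OF s] in simp)
        ultimately show ?thesis by simp
      qed
      ultimately show ?thesis by simp
    qed
    from has_field_derivative_zero_constant[OF convex_real_interval(5) this]
    obtain c where c: "\<And>s. s \<in> {0..T} \<Longrightarrow> m s = c" by blast
    have "0 \<in> {0..T}" using T_pos by simp
    then show ?thesis using c[OF t] c[of 0] mc[OF t] mc[of 0] by simp
  qed
  then have "(\<integral>z. snd (X t z) \<partial>f0) = (\<integral>z. snd (X 0 z) \<partial>f0)"
    by (rule vector_eq_rdot[THEN iffD1, OF allI])
  then show ?thesis using mean_velocity_ft[OF t] mean_velocity_ft[of 0] T_pos by simp
qed

text \<open>Conservation of momentum lets the kinetic energy be taken about the fixed vector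
  \<open>m\<close>. After symmetrisation \<open>m\<close> drops out, the work of the potential
  cancels between kinetic and potential part, and \<open>- 2 * \<psi>\<close> times the squared
  relative velocity remains.\<close>

lemma hamiltonian_derivative:
  assumes t: "t \<in> {0..T}" and \<psi>: "\<And>s. \<psi> s \<ge> 0"
  shows "\<exists>D\<le>0. ((\<lambda>s. hamiltonian V (ft s)) has_real_derivative D) (at t within {0..T})"
proof -
  define m where "m = mean_velocity (ft 0)"
  let ?F = "\<lambda>p :: ((real^'d) \<times> (real^'d)) \<times> (real^'d) \<times> (real^'d). pair_force \<psi> V
      (fst (fst p) - fst (snd p)) (snd (fst p) - snd (snd p))"
  \<comment> \<open>\<open>a\<close> and \<open>b\<close> are the integrands of the derivatives of
    \<open>kin\<close> and \<open>pot\<close>, written on pairs of points so that both can be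
    symmetrised together.\<close>
  define a where "a p = - 2 * ((snd (fst p) - m) \<bullet> ?F p)" for p
  define b where "b p = (snd (fst p) - snd (snd p)) \<bullet> gradient V (fst (fst p) - fst (snd p))"
    for p :: "((real^'d) \<times> (real^'d)) \<times> (real^'d) \<times> (real^'d)"
  define e where "e p = V (fst (fst p) - fst (snd p))"
      for p :: "((real^'d) \<times> (real^'d)) \<times> (real^'d) \<times> (real^'d)"
  have a: "continuous_on UNIV a"
    unfolding a_def[abs_def] by (intro continuous_intros pair_force_continuous)
  have b: "continuous_on UNIV b"
    unfolding b_def[abs_def]
        by (intro continuous_intros continuous_on_compose2[OF gradient_continuous[of UNIV]]) auto
  have ec: "continuous_on UNIV e"
    unfolding e_def[abs_def]
        by (intro continuous_on_compose2[OF V_continuous[of UNIV]] continuous_intros) auto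
  obtain Ka where Ka: "\<And>t z w. t \<in> {0..T} \<Longrightarrow> \<bar>a (X t z, X t w)\<bar> \<le> Ka"
    "\<And>t z. t \<in> {0..T} \<Longrightarrow> \<bar>\<integral>w. a (X t z, X t w) \<partial>f0\<bar> \<le> Ka"
    using flow_pair_bounds[OF a] by blast
  obtain Kb where Kb: "\<And>t z w. t \<in> {0..T} \<Longrightarrow> \<bar>b (X t z, X t w)\<bar> \<le> Kb"
    "\<And>t z. t \<in> {0..T} \<Longrightarrow> \<bar>\<integral>w. b (X t z, X t w) \<partial>f0\<bar> \<le> Kb"
    using flow_pair_bounds[OF b] by blast
  obtain Ke where Ke: "\<And>t z w. t \<in> {0..T} \<Longrightarrow> \<bar>e (X t z, X t w)\<bar> \<le> Ke"
    "\<And>t z. t \<in> {0..T} \<Longrightarrow> \<bar>\<integral>w. e (X t z, X t w) \<partial>f0\<bar> \<le> Ke"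
    using flow_pair_bounds[OF ec] by blast
  have pair_int: "integrable f0 (\<lambda>w. q (X s z, X s w))" if "s \<in> {0..T}" "continuous_on UNIV q"
    for s z and q :: "((real^'d) \<times> (real^'d)) \<times> (real^'d) \<times> (real^'d) \<Rightarrow> real"
    by (rule flow_integrable[OF that(1)])
        (intro continuous_on_compose2[OF that(2)] continuous_intros, auto)
  define kin where "kin s = (\<integral>z. (snd (X s z) - m) \<bullet> (snd (X s z) - m) \<partial>f0)" for s
  define pot where "pot s = (\<integral>z. \<integral>w. e (X s z, X s w) \<partial>f0 \<partial>f0)" for s
  have H: "hamiltonian V (ft s) = 1 / 2 * kin s + 1 / 2 * pot s" if s: "s \<in> {0..T}" for s
  proof -
    have ms: "mean_velocity (ft s) = m" using mean_velocity_constant[OF s] by (simp add: m_def)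
    have "(\<integral>z. (norm (snd z - m))\<^sup>2 \<partial>ft s) = kin s"
      unfolding kin_def power2_norm_eq_inner by (rule integral_ft[OF s]) (intro continuous_intros)
    moreover have "(\<integral>z. \<integral>w. V (fst z - fst w) \<partial>ft s \<partial>ft s) = pot s"
    proof -
      have inner: "(\<integral>w. V (fst z - fst w) \<partial>ft s) = (\<integral>w. V (fst z - fst (X s w)) \<partial>f0)"
          for z :: "(real^'d) \<times> (real^'d)"
        by (rule integral_ft[OF s])
            (intro continuous_on_compose2[OF V_continuous[of UNIV]] continuous_intros, auto)
      have "(\<integral>z. \<integral>w. V (fst z - fst w) \<partial>ft s \<partial>ft s) = (\<integral>z. \<integral>w. V (fst (X s z) - fst w) \<partial>ft s \<partial>f0)"
      proof (rule integral_distr[OF X_measurable[OF s]])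
        interpret fs: prob_space "ft s" by (rule P2D[OF ft_P2[OF s]])
        have "case_prod (\<lambda>z w. e (z, w)) \<in> borel_measurable (borel \<Otimes>\<^sub>M borel)"
          unfolding borel_prod case_prod_Pair_iden case_prod_eta
              by (rule borel_measurable_continuous_onI[OF ec])
        moreover have "sets (borel \<Otimes>\<^sub>M ft s) = sets (borel \<Otimes>\<^sub>M borel)"
          by (intro sets_pair_measure_cong) simp_all
        ultimately have "case_prod (\<lambda>z w. e (z, w)) \<in> borel_measurable (borel \<Otimes>\<^sub>M ft s)"
          by (subst measurable_cong_sets[OF _ refl])
        then have "(\<lambda>z. \<integral>w. e (z, w) \<partial>ft s) \<in> borel_measurable borel"
          by (rule fs.borel_measurable_lebesgue_integral)
        then show "(\<lambda>z :: (real^'d) \<times> (real^'d). \<integral>w. V (fst z - fst w) \<partial>ft s)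
            \<in> borel_measurable borel"
          by (simp add: e_def)
      qed
      then show ?thesis by (simp add: inner pot_def e_def)
    qed
    ultimately show ?thesis
      by (simp add: hamiltonian_def ms case_prod_unfold)
  qed
  have dkin: "(kin has_real_derivative (\<integral>z. \<integral>w. a (X t z, X t w) \<partial>f0 \<partial>f0)) (at t within {0..T})"
    unfolding kin_def[abs_def]
  proof (rule has_real_derivative_prob_integral[OF prob_f0 t _ Ka(2)])
    fix r z assume r: "r \<in> {0..T}"
    let ?d = "snd (drift (ft r) (X r z))"
    have d: "((\<lambda>s. snd (X s z) - m) has_derivative (\<lambda>x. x *\<^sub>R ?d)) (at r within {0..T})"
      using has_derivative_diff[OF snd_X_derivative[OF r, unfolded has_vector_derivative_def]
          has_derivative_const] by simp
    from has_derivative_inner[OF d d]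
    have "((\<lambda>s. (snd (X s z) - m) \<bullet> (snd (X s z) - m))
        has_real_derivative 2 * ((snd (X r z) - m) \<bullet> ?d)) (at r within {0..T})"
      unfolding has_field_derivative_def
      by (rule has_derivative_eq_rhs) (auto simp: fun_eq_iff inner_commute algebra_simps)
    moreover have "2 * ((snd (X r z) - m) \<bullet> ?d) = (\<integral>w. a (X r z, X r w) \<partial>f0)"
    proof -
      have "integrable f0 (\<lambda>w. ?F (X r z, X r w))"
        unfolding fst_conv snd_conv
            by (rule flow_vec_integrable[OF r]) (intro pair_force_continuous continuous_intros)
      then have "(\<integral>w. (snd (X r z) - m) \<bullet> ?F (X r z, X r w) \<partial>f0)
          = (snd (X r z) - m) \<bullet> (\<integral>w. ?F (X r z, X r w) \<partial>f0)"
        by (intro integral_inner_right) simp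
      then show ?thesis
        unfolding drift_flow_eq(2)[OF r] a_def by simp
    qed
    ultimately show "((\<lambda>s. (snd (X s z) - m) \<bullet> (snd (X s z) - m))
        has_real_derivative (\<integral>w. a (X r z, X r w) \<partial>f0)) (at r within {0..T})"
      by simp
  next
    show "integrable f0 (\<lambda>z. (snd (X r z) - m) \<bullet> (snd (X r z) - m))" if "r \<in> {0..T}" for r
      by (intro flow_integrable[OF that] continuous_intros)
    show "(\<lambda>z. \<integral>w. a (X t z, X t w) \<partial>f0) \<in> borel_measurable f0"
      by (rule flow_pair_integral_measurable[OF t a])
  qed
  have dpot: "(pot has_real_derivative (\<integral>z. \<integral>w. b (X t z, X t w) \<partial>f0 \<partial>f0)) (at t within {0..T})"
    unfolding pot_def[abs_def]
  proof (rule has_real_derivative_prob_integral[OF prob_f0 t _ Kb(2)])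
    fix r z assume r: "r \<in> {0..T}"
    show "((\<lambda>s. \<integral>w. e (X s z, X s w) \<partial>f0) has_real_derivative (\<integral>w. b (X r z, X r w) \<partial>f0))
        (at r within {0..T})"
    proof (rule has_real_derivative_prob_integral[OF prob_f0 r _ Kb(1)])
      fix s w assume s: "s \<in> {0..T}"
      let ?d = "fst (drift (ft s) (X s z)) - fst (drift (ft s) (X s w))"
      have si: "integrable f0 (\<lambda>w. snd (X s w))"
          by (intro flow_vec_integrable[OF s] continuous_intros)
      \<comment> \<open>The mean velocity is subtracted in the position drift of both points and
        cancels in the difference.\<close>
      have d: "?d = snd (X s z) - snd (X s w)"
        unfolding drift_flow_eq(1)[OF s] using si by (simp add: f0.prob_space)
      have "((\<lambda>s. fst (X s z) - fst (X s w)) has_derivative (\<lambda>x. x *\<^sub>R ?d)) (at s within {0..T})"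
        using has_vector_derivative_diff[OF fst_X_derivative[OF s, of z] fst_X_derivative[OF s, of
            w]]
        by (simp add: has_vector_derivative_def)
      from has_derivative_compose[OF this V_has_derivative]
      show "((\<lambda>s. e (X s z, X s w)) has_real_derivative b (X s z, X s w)) (at s within {0..T})"
        by (simp add: e_def b_def d has_field_derivative_def mult_commute_abs)
    next
      show "integrable f0 (\<lambda>w. e (X s z, X s w))" if "s \<in> {0..T}" for s
          by (rule pair_int[OF that ec])
      show "(\<lambda>w. b (X r z, X r w)) \<in> borel_measurable f0"
          by (rule flow_pair_integral_measurable[OF r b])
    qed
  next
    show "integrable f0 (\<lambda>z. \<integral>w. e (X r z, X r w) \<partial>f0)" if "r \<in> {0..T}" for r
      by (rule f0.integrable_const_bound[of _ Ke])
          (use Ke(2)[OF that] flow_pair_integral_measurable(1)[OF that ec] in auto)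
    show "(\<lambda>z. \<integral>w. b (X t z, X t w) \<partial>f0) \<in> borel_measurable f0"
      by (rule flow_pair_integral_measurable[OF t b])
  qed
  define D where "D = 1 / 2 * (\<integral>z. \<integral>w. a (X t z, X t w) \<partial>f0 \<partial>f0)
      + 1 / 2 * (\<integral>z. \<integral>w. b (X t z, X t w) \<partial>f0 \<partial>f0)"
  have "((\<lambda>s. 1 / 2 * kin s + 1 / 2 * pot s) has_real_derivative D) (at t within {0..T})"
    unfolding D_def by (intro DERIV_add DERIV_cmult dkin dpot)
  then have "((\<lambda>s. hamiltonian V (ft s)) has_real_derivative D) (at t within {0..T})"
    by (rule has_field_derivative_transform_within[OF _ zero_less_one t]) (simp add: H)
  moreover have "D \<le> 0"
  proof -
    define q where "q p = a p + b p" for p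
    have q: "continuous_on UNIV q" unfolding q_def[abs_def] by (intro continuous_intros a b)
    have Kq: "\<bar>q (X t z, X t w)\<bar> \<le> Ka + Kb" for z w
      unfolding q_def using Ka(1)[OF t, of z w] Kb(1)[OF t, of z w] by linarith
    have "(\<integral>z. \<integral>w. a (X t z, X t w) \<partial>f0 \<partial>f0) + (\<integral>z. \<integral>w. b (X t z, X t w) \<partial>f0 \<partial>f0)
        = (\<integral>z. (\<integral>w. a (X t z, X t w) \<partial>f0) + (\<integral>w. b (X t z, X t w) \<partial>f0) \<partial>f0)"
    proof (rule Bochner_Integration.integral_add[symmetric])
      show "integrable f0 (\<lambda>z. \<integral>w. a (X t z, X t w) \<partial>f0)"
        by (rule f0.integrable_const_bound[of _ Ka])
            (use Ka(2)[OF t] flow_pair_integral_measurable(1)[OF t a] in auto)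
      show "integrable f0 (\<lambda>z. \<integral>w. b (X t z, X t w) \<partial>f0)"
        by (rule f0.integrable_const_bound[of _ Kb])
            (use Kb(2)[OF t] flow_pair_integral_measurable(1)[OF t b] in auto)
    qed
    also have "\<dots> = (\<integral>z. \<integral>w. q (X t z, X t w) \<partial>f0 \<partial>f0)"
      unfolding q_def using pair_int[OF t a] pair_int[OF t b] by simp
    also have "\<dots> \<le> 0"
    proof (rule f0.symmetrized_integral_nonpos[OF flow_pair_measurable[OF t q] Kq])
      fix z w
      obtain r v r' v' where zw: "X t z = (r, v)" "X t w = (r', v')"
          by (cases "X t z", cases "X t w")
      have odd: "pair_force \<psi> V (r' - r) (v' - v) = - pair_force \<psi> V (r - r') (v - v')"
        using pair_force_odd[of "r - r'" "v - v'"] by simp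
      have oddg: "gradient V (r' - r) = - gradient V (r - r')"
        using gradient_odd[of "r - r'"] by simp
      \<comment> \<open>Exchanging the points reverses the pair force, so the two occurrences of
        \<open>m\<close> cancel and only relative velocities are left.\<close>
      have "q (X t z, X t w) + q (X t w, X t z) =
          - 2 * ((v - v') \<bullet> pair_force \<psi> V (r - r') (v - v')) + 2 *
              ((v - v') \<bullet> gradient V (r - r'))"
        unfolding zw q_def a_def b_def fst_conv snd_conv odd oddg
        by (simp add: inner_diff_left algebra_simps)
      also have "\<dots> \<le> 0"
        using pair_force_friction[OF \<psi>, where r="r - r'" and v="v - v'"] by simp
      finally show "q (X t z, X t w) + q (X t w, X t z) \<le> 0" .
    qed
    finally show ?thesis by (simp add: D_def)
  qed
  ultimately show ?thesis by blast
qed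

end

text \<open>The complement of the support is a union of null open sets; by second countability a
  countable subfamily has the same union.\<close>

lemma AE_measure_support:
  fixes M :: "'a::{second_countable_topology, real_normed_vector} measure"
  assumes "sets M = sets borel"
  shows "AE z in M. z \<in> measure_support M"
proof -
  obtain F where F: "F \<subseteq> {U. open U \<and> emeasure M U = 0}" "countable F" "\<Union>F = \<Union>{U. open U
      \<and> emeasure M U = 0}"
    using Lindelof[of "{U. open U \<and> emeasure M U = 0}"] by auto
  have "(\<Union>U\<in>F. U) \<in> null_sets M"
  proof (rule null_sets_UN'[OF F(2)])
    fix U assume "U \<in> F"
    then have "open U" "emeasure M U = 0" using F(1) by auto
    then show "U \<in> null_sets M" using assms by (intro null_setsI) auto
  qed
  then have "\<Union>{U. open U \<and> emeasure M U = 0} \<in> null_sets M" using F(3) by simp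
  from AE_not_in[OF this] show ?thesis
    by (simp add: measure_support_def)
qed

theorem theorem4p1:
  fixes \<psi> :: "real \<Rightarrow> real"
    and V :: "real^'d \<Rightarrow> real"
    and f0 :: "((real^'d) \<times> (real^'d)) measure"
  assumes "standing_assumptions \<psi> V"
    and "\<And>x. \<psi> x > 0"
    and "prob_space f0" and "sets f0 = sets borel" and "compact (measure_support f0)"
  shows "\<exists>f. global_weak_solution \<psi> V f0 f
    \<and> (\<forall>g. global_weak_solution \<psi> V f0 g \<longrightarrow> (\<forall>t\<ge>0. g t = f t))
    \<and> (\<forall>T>0. \<forall>g. weak_solution \<psi> V T f0 g \<longrightarrow> (\<forall>t\<in>{0..T}. g t = f t))
    \<and> (\<forall>t\<ge>0. \<exists>D\<le>0. ((\<lambda>s. hamiltonian V (f s)) has_real_derivative D) (at t within {0..}))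
    \<and> (\<exists>v_bar. \<forall>t\<ge>0. (\<integral>(r, v). v \<partial>f t) = v_bar)"
proof -
  obtain C where mf: "mean_field (interaction \<psi> V) C"
    using mean_field_interaction[OF assms(1)] by blast
  interpret alignment \<psi> V C by (rule alignment.intro[OF assms(1) mf])
  obtain R0 where R0: "\<And>z. z \<in> measure_support f0 \<Longrightarrow> norm z \<le> R0"
    using compact_imp_bounded[OF assms(5)] unfolding bounded_iff by blast
  have supp: "AE z in f0. norm z \<le> R0"
    using AE_measure_support[OF assms(4)] by eventually_elim (rule R0)
  \<comment> \<open>One flow is chosen for every final time; no relation between the choices is
    built in.\<close>
  define X where "X T = (SOME X. is_flow T f0 X)" for T
  have X: "is_flow T f0 (X T)" if T: "T > 0" for T
  proof -
    obtain Y where "is_flow T f0 Y" using flow_exists[OF assms(3,4) supp T] by blast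
    then show ?thesis unfolding X_def by (rule someI[of "is_flow T f0"])
  qed
  have sol: "weak_sol S f0 (\<lambda>t. distr f0 borel (X T t))" if "0 < S" "S \<le> T" for S T
    by (rule is_flow_weak_sol[OF assms(3,4) is_flow_subset[OF X]]) (use that in auto)
  \<comment> \<open>The horizon \<open>t + 1\<close> is positive also for \<open>t = 0\<close> and
    leaves room to the right of \<open>t\<close>.\<close>
  define f where "f t = distr f0 borel (X (t + 1) t)" for t
  \<comment> \<open>Uniqueness on a common interval identifies the image measures of flows with
    different horizons, although the maps themselves may differ.\<close>
  have f: "f t = distr f0 borel (X T t)" if "T > 0" "t \<in> {0..T}" for t T
  proof -
    have S: "0 < min (t + 1) T" "t \<in> {0..min (t + 1) T}" using that by auto
    show ?thesis
      unfolding f_def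
      by (rule weak_sol_unique[OF sol[OF S(1)] sol[OF S(1)] S(1) supp assms(4) S(2)]) simp_all
  qed
  have f_cont: "P2_continuous_on {0..T} f" if "T > 0" for T
  proof -
    have "P2_continuous_on {0..T} (\<lambda>t. distr f0 borel (X T t))"
      using sol[OF that order_refl] by (simp add: weak_sol_def)
    moreover have "((\<lambda>s. W2 (f s) (f t)) \<longlongrightarrow> 0) (at t within {0..T}) \<longleftrightarrow>
        ((\<lambda>s. W2 (distr f0 borel (X T s)) (distr f0 borel (X T t))) \<longlongrightarrow> 0) (at t within {0..T})"
      if "t \<in> {0..T}" for t
      by (rule Lim_cong_within) (use that in \<open>simp_all add: f[OF \<open>T > 0\<close>]\<close>)
    ultimately show ?thesis
      unfolding P2_continuous_on_def by (simp add: f[OF that])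
  qed
  have f_sol: "weak_sol T f0 f" if T: "T > 0" for T
  proof -
    have "(LINT t:{0..T}|lborel. rate h (f t) t)
        = (LINT t:{0..T}|lborel. rate h (distr f0 borel (X T t)) t)" for h
      by (rule set_lebesgue_integral_cong) (simp_all add: f[OF T])
    then show ?thesis
      using sol[OF T order_refl] f_cont[OF T] by (simp add: weak_sol_def)
  qed
  have glob: "global_weak_solution \<psi> V f0 f"
    unfolding global_weak_solution_def
  proof (intro conjI allI impI)
    show "weak_solution \<psi> V T f0 f" if "T > 0" for T
      using f_sol[OF that] weak_solution_iff_weak_sol[OF that] by blast
    show "P2_continuous_on {0..} f"
      unfolding P2_continuous_on_def
    proof (intro conjI ballI)
      fix t :: real assume "t \<in> {0..}"
      then have t: "0 \<le> t" "t < t + 1" "t \<in> {0..t + 1}" by auto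
      have "P2_continuous_on {0..t + 1} f" using t by (intro f_cont) simp
      then show "f t \<in> P2" "((\<lambda>s. W2 (f s) (f t)) \<longlongrightarrow> 0) (at t within {0..})"
        using t(3) unfolding at_within_atLeast[OF t(1,2)] P2_continuous_on_def by blast+
    qed
  qed
  have uniq: "g t = f t" if "T > 0" "weak_solution \<psi> V T f0 g" "t \<in> {0..T}" for T g t
    using weak_sol_unique[OF _ f_sol[OF that(1)] that(1) supp assms(4) that(3)]
      that(2) weak_solution_iff_weak_sol[OF that(1)] by blast
  have flow_loc: "\<exists>\<rho>. alignment_flow \<psi> V C f0 T (X T) \<rho>" if T: "T > 0" for T
  proof -
    have "\<exists>\<rho>\<ge>0. \<forall>t\<in>{0..T}. \<forall>z. norm (X T t z) \<le> \<rho>"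
      using X[OF T] unfolding is_flow_def by (elim conjE)
    then obtain \<rho> where "\<rho> \<ge> 0" "\<And>t z. t \<in> {0..T} \<Longrightarrow> norm (X T t z) \<le> \<rho>" by blast
    then show ?thesis
      by (intro exI[of _ \<rho>] alignment_flow.intro alignment_axioms alignment_flow_axioms.intro
          assms(3,4) T X)
  qed
  have ham: "\<exists>D\<le>0. ((\<lambda>s. hamiltonian V (f s)) has_real_derivative D) (at t within {0..})"
      if "t \<ge> 0" for t
  proof -
    have T: "t + 1 > 0" and t: "t \<in> {0..t + 1}" using that by auto
    obtain \<rho> where "alignment_flow \<psi> V C f0 (t + 1) (X (t + 1)) \<rho>" using flow_loc[OF T] by blast
    \<comment> \<open>On \<open>{0..t + 1}\<close> the family \<open>f\<close> is the image under a
      single flow, so the derivative computed for this flow is that of \<open>f\<close> at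
      \<open>t\<close>.\<close>
    then interpret alignment_flow \<psi> V C f0 "t + 1" "X (t + 1)" \<rho> .
    obtain D where D: "D \<le> 0"
        "((\<lambda>s. hamiltonian V (ft s)) has_real_derivative D) (at t within {0..t + 1})"
      using hamiltonian_derivative[OF t] assms(2) less_imp_le by blast
    have "((\<lambda>s. hamiltonian V (f s)) has_real_derivative D) (at t within {0..t + 1})"
      by (rule has_field_derivative_transform_within[OF D(2) zero_less_one t]) (simp add: f[OF T])
    then show ?thesis
      using D(1) at_within_atLeast[of t "t + 1"] that by auto
  qed
  have mom: "(\<integral>(r, v). v \<partial>f t) = mean_velocity (f 0)" if "t \<ge> 0" for t
  proof -
    have T: "t + 1 > 0" and t: "t \<in> {0..t + 1}" "0 \<in> {0..t + 1}" using that by auto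
    obtain \<rho> where "alignment_flow \<psi> V C f0 (t + 1) (X (t + 1)) \<rho>" using flow_loc[OF T] by blast
    then interpret alignment_flow \<psi> V C f0 "t + 1" "X (t + 1)" \<rho> .
    show ?thesis
      using mean_velocity_constant[OF t(1)] f[OF T t(1)] f[OF T t(2)]
      by (simp add: mean_velocity_def)
  qed
  show ?thesis
  proof (intro exI[of _ f] conjI allI impI ballI)
    show "g t = f t" if "global_weak_solution \<psi> V f0 g" "t \<ge> 0" for g t
      by (rule uniq[of "t + 1"]) (use that in \<open>auto simp: global_weak_solution_def\<close>)
  qed (use glob uniq ham mom in auto)
qed

end
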